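(* Let $(U,W)$ be an output normal pair with $W$ of size $n\times n$ and $U$ of size $p\times n$. Let $G(z)=D+C(zI_n-A)^{-1}B$ be a balanced realization of $G(z)\in\mathcal{L}_n^p$, and let $Q$ be the unique solution of the Stein equation $$Q-A^*QW=C^*U.$$ Then the interpolation value $$V=\frac{1}{2i\pi}\int_{\mathbf{T}}G^\sharp(z)U(zI_n-W)^{-1}\,dz$$ and the solution $P$ of $P-W^*PW=U^*U-V^*V$ are given by $$V=D^*U+B^*QW,\qquad P=Q^*Q.$$ Moreover, if $P$ is positive definite (so that $Q$ is invertible), the unitary realization matrix $R=\begin{pmatrix}D&C\\ B&A\end{pmatrix}$ of $G(z)$ can be computed as $$R=\hat{\mathcal{U}}\begin{pmatrix}G_0&0\\0&I_n\end{pmatrix}\hat{\mathcal{V}}^*\qquad\text{for some }G_0\in\mathbb{U}(p),$$ where $\hat{\mathcal{U}}$ and $\hat{\mathcal{V}}$ are the unitary matrices $$\hat{\mathcal{U}}=\begin{pmatrix}X&\tilde U\\ TY&\tilde W\end{pmatrix}\begin{pmatrix}Z^{1/2}&0\\-K^{-1}LZ^{1/2}&K^{-1/2}\end{pmatrix},\qquad\hat{\mathcal{V}}=\begin{pmatrix}(I_p+\tilde V\tilde V^* )^{-1/2}&\tilde V(I_n+\tilde V^*\tilde V)^{-1/2}\\-\tilde V^*(I_p+\tilde V\tilde V^* )^{-1/2}&(I_n+\tilde V^*\tilde V)^{-1/2}\end{pmatrix}$$ with the choice $T=Q$, and $\tilde U=UT^{-1}$, $\tilde W=TWT^{-1}$,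 $\tilde V=VT^{-1}$, $X=I_p-U(I_n-W^* )^{-1}U^*$, $Y=(I_n-W)(I_n-W^* )^{-1}U^*$, $K=\tilde U^*\tilde U+\tilde W^*\tilde W=I_n+\tilde V^*\tilde V$, $L=\tilde U^*X+\tilde W^*TY$, $Z=X^*X+Y^*P^{-1}Y$.
   Context: $^*$ denotes conjugate transpose; $(\cdot)^{1/2}$ of a positive definite matrix is its Hermitian positive square root. $\mathbf{T}$ is the unit circle. $G^\sharp(z)=G(1/\bar z)^*$. A $p\times p$ rational matrix function $G$ is lossless if $G(z)G(z)^*\le I_p$ for $|z|>1$, with equality for $|z|=1$; $\mathcal{L}_n^p$ is the set of $p\times p$ lossless functions of McMillan degree $n$, and $\mathbb{U}(p)$ the set of constant $p\times p$ unitary matrices. For a lossless function, a balanced realization is a minimal realization for which the realization matrix $\begin{pmatrix}D&C\\ B&A\end{pmatrix}$ is unitary. An output normal pair $(U,W)$ is an observable pair with $W$ stable (eigenvalues in the open unit disk) and $U^*U+W^*W=I_n$. *)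

theory Defs
  imports
    "HOL-Complex_Analysis.Complex_Analysis"
    "Jordan_Normal_Form.Schur_Decomposition"
    "Jordan_Normal_Form.Gauss_Jordan_Elimination"
    "Jordan_Normal_Form.DL_Rank"
begin

notation mat_adjoint ("_\<^sup>\<dagger>" [1000] 999)

definition minv :: "complex mat \<Rightarrow> complex mat" where
  "minv M = the (mat_inverse M)"

definition unitary_mat :: "complex mat \<Rightarrow> bool" where
  "unitary_mat M \<longleftrightarrow> square_mat M \<and> M\<^sup>\<dagger> * M = 1\<^sub>m (dim_row M) \<and> M * M\<^sup>\<dagger> = 1\<^sub>m (dim_row M)"

definition unitary_group :: "nat \<Rightarrow> complex mat set" where
  "unitary_group p = {M \<in> carrier_mat p p. unitary_mat M}"

definition pos_semidef :: "complex mat \<Rightarrow> bool" where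
  "pos_semidef M \<longleftrightarrow> square_mat M \<and> M\<^sup>\<dagger> = M \<and>
     (\<forall>v \<in> carrier_vec (dim_row M). 0 \<le> Re ((M *\<^sub>v v) \<bullet>c v))"

definition pos_def :: "complex mat \<Rightarrow> bool" where
  "pos_def M \<longleftrightarrow> square_mat M \<and> M\<^sup>\<dagger> = M \<and>
     (\<forall>v \<in> carrier_vec (dim_row M). v \<noteq> 0\<^sub>v (dim_row M) \<longrightarrow> 0 < Re ((M *\<^sub>v v) \<bullet>c v))"

definition mat_sqrt :: "complex mat \<Rightarrow> complex mat" where
  "mat_sqrt M = (THE S. pos_def S \<and> S * S = M)"

definition mat_isqrt :: "complex mat \<Rightarrow> complex mat" where
  "mat_isqrt M = minv (mat_sqrt M)"

(* Rational functions are represented by their reduced fraction, with the value 0 at the poles.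
   In this way a rational function is determined by its values off a finite set, and its value
   at a removable singularity of some unreduced expression is the correct one. *)
definition rational_fun :: "(complex \<Rightarrow> complex) \<Rightarrow> bool" where
  "rational_fun f \<longleftrightarrow>
     (\<exists>a b :: complex poly. b \<noteq> 0 \<and> coprime a b \<and> (\<forall>z. f z = poly a z / poly b z))"

definition rational_mat_fun :: "nat \<Rightarrow> (complex \<Rightarrow> complex mat) \<Rightarrow> bool" where
  "rational_mat_fun p G \<longleftrightarrow> (\<forall>z. G z \<in> carrier_mat p p) \<and>
     (\<forall>i<p. \<forall>j<p. rational_fun (\<lambda>z. G z $$ (i, j)))"

(* The inequality on |z| > 1 off the poles already excludes poles there and on the unit circle,
   so the value 0 at poles does not enlarge this class. *)
definition lossless :: "nat \<Rightarrow> (complex \<Rightarrow> complex mat) \<Rightarrow> bool" where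
  "lossless p G \<longleftrightarrow> rational_mat_fun p G \<and>
     (\<forall>z. cmod z > 1 \<longrightarrow> pos_semidef (1\<^sub>m p - G z * (G z)\<^sup>\<dagger>)) \<and>
     (\<forall>z. cmod z = 1 \<longrightarrow> G z * (G z)\<^sup>\<dagger> = 1\<^sub>m p)"

definition realization ::
  "nat \<Rightarrow> nat \<Rightarrow> complex mat \<Rightarrow> complex mat \<Rightarrow> complex mat \<Rightarrow> complex mat \<Rightarrow>
   (complex \<Rightarrow> complex mat) \<Rightarrow> bool" where
  "realization p n A B C D G \<longleftrightarrow>
     A \<in> carrier_mat n n \<and> B \<in> carrier_mat n p \<and> C \<in> carrier_mat p n \<and> D \<in> carrier_mat p p \<and>
     (\<forall>z. invertible_mat (z \<cdot>\<^sub>m 1\<^sub>m n - A) \<longrightarrow> G z = D + C * minv (z \<cdot>\<^sub>m 1\<^sub>m n - A) * B)"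

(* Meaningful for functions that are proper (analytic at infinity), as lossless functions are;
   these are the functions that have a realization. *)
definition mcmillan_degree :: "nat \<Rightarrow> (complex \<Rightarrow> complex mat) \<Rightarrow> nat" where
  "mcmillan_degree p G = (LEAST m. \<exists>A B C D. realization p m A B C D G)"

definition lossless_deg :: "nat \<Rightarrow> nat \<Rightarrow> (complex \<Rightarrow> complex mat) set" where
  "lossless_deg p n = {G. lossless p G \<and> mcmillan_degree p G = n}"

definition minimal_realization ::
  "nat \<Rightarrow> nat \<Rightarrow> complex mat \<Rightarrow> complex mat \<Rightarrow> complex mat \<Rightarrow> complex mat \<Rightarrow>
   (complex \<Rightarrow> complex mat) \<Rightarrow> bool" where
  "minimal_realization p n A B C D G \<longleftrightarrow> realization p n A B C D G \<and> n = mcmillan_degree p G"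

definition realization_matrix ::
  "complex mat \<Rightarrow> complex mat \<Rightarrow> complex mat \<Rightarrow> complex mat \<Rightarrow> complex mat" where
  "realization_matrix A B C D = four_block_mat D C B A"

definition balanced_realization ::
  "nat \<Rightarrow> nat \<Rightarrow> complex mat \<Rightarrow> complex mat \<Rightarrow> complex mat \<Rightarrow> complex mat \<Rightarrow>
   (complex \<Rightarrow> complex mat) \<Rightarrow> bool" where
  "balanced_realization p n A B C D G \<longleftrightarrow>
     minimal_realization p n A B C D G \<and> unitary_mat (realization_matrix A B C D)"

(* The blocks U, U W, ..., U W^(n-1), stacked. *)
definition observability_mat :: "nat \<Rightarrow> nat \<Rightarrow> complex mat \<Rightarrow> complex mat \<Rightarrow> complex mat" where
  "observability_mat p n U W = mat (n * p) n (\<lambda>(i, j). (U * W ^\<^sub>m (i div p)) $$ (i mod p, j))"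

definition observable :: "nat \<Rightarrow> nat \<Rightarrow> complex mat \<Rightarrow> complex mat \<Rightarrow> bool" where
  "observable p n U W \<longleftrightarrow> vec_space.rank (n * p) (observability_mat p n U W) = n"

definition stable :: "complex mat \<Rightarrow> bool" where
  "stable W \<longleftrightarrow> (\<forall>k. eigenvalue W k \<longrightarrow> cmod k < 1)"

definition output_normal_pair :: "nat \<Rightarrow> nat \<Rightarrow> complex mat \<Rightarrow> complex mat \<Rightarrow> bool" where
  "output_normal_pair p n U W \<longleftrightarrow> U \<in> carrier_mat p n \<and> W \<in> carrier_mat n n \<and>
     observable p n U W \<and> stable W \<and> U\<^sup>\<dagger> * U + W\<^sup>\<dagger> * W = 1\<^sub>m n"

definition sharp :: "(complex \<Rightarrow> complex mat) \<Rightarrow> complex \<Rightarrow> complex mat" where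
  "sharp G z = (G (1 / cnj z))\<^sup>\<dagger>"

definition interp_integrand ::
  "(complex \<Rightarrow> complex mat) \<Rightarrow> complex mat \<Rightarrow> complex mat \<Rightarrow> complex \<Rightarrow> complex mat" where
  "interp_integrand G U W z = sharp G z * U * minv (z \<cdot>\<^sub>m 1\<^sub>m (dim_row W) - W)"

definition interp_value ::
  "(complex \<Rightarrow> complex mat) \<Rightarrow> complex mat \<Rightarrow> complex mat \<Rightarrow> complex mat" where
  "interp_value G U W = mat (dim_row U) (dim_col U) (\<lambda>(i, j).
     1 / (2 * \<i> * of_real pi) *
     contour_integral (circlepath 0 1) (\<lambda>z. interp_integrand G U W z $$ (i, j)))"

definition stein_solution ::
  "nat \<Rightarrow> complex mat \<Rightarrow> complex mat \<Rightarrow> complex mat \<Rightarrow> complex mat \<Rightarrow> bool" where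
  "stein_solution n M N S X \<longleftrightarrow> X \<in> carrier_mat n n \<and> X - M * X * N = S"

end

theory Submission
  imports Defs "Jordan_Normal_Form.Spectral_Radius"
begin

text \<open>Write \<open>R\<close> for the realization matrix with blocks \<open>D, C, B, A\<close>. It is unitary, and the whole statement
comes from reading the Stein equation for \<open>Q\<close> as an action of its adjoint: together with
\<open>V = D* U + B* Q W\<close> it says that \<open>R*\<close> maps the block column \<open>[U; Q W]\<close> to \<open>[V; Q]\<close>.

\<^item> Since \<open>R*\<close> is isometric, \<open>V* V + Q* Q = U* U + W* Q* Q W\<close>, so \<open>Q* Q\<close> solves the equation for \<open>P\<close>.
  Both Stein equations have a unique solution, because the powers of \<open>W\<close> on the right decay geometrically,
  while on the left the powers of the contraction \<open>A*\<close>, respectively of \<open>W*\<close>, stay bounded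
  (\<open>stein_solution_ex1\<close>).

\<^item> Substituting the Stein equation for \<open>C* U\<close> splits the integrand, inside the disc and near the circle, as
  \<open>(D* U + z B* Q) (z - W)^{-1} + z B* (1 - z A*)^{-1} A* Q\<close>.
  The second summand is holomorphic in the open disc and integrates to zero. The first one involves only
  the moments \<open>1\<close> and \<open>W\<close> of the resolvent of \<open>W\<close> and gives \<open>D* U + B* Q W\<close>. Cauchy's theorem needs
  continuity up to the circle. It comes from losslessness: the entries of \<open>G\<close> are reduced fractions bounded
  by one for \<open>|z| \<ge> 1\<close> and therefore have no pole there (\<open>interpolation_integral\<close>).

\<^item> Multiplying by \<open>Q^{-1}\<close> on the right shows that \<open>R\<close> maps \<open>[Vt; I]\<close> to \<open>[Ut; Wt]\<close>, hence both have
  the Gram matrix \<open>K\<close>. The last \<open>n\<close> columns of the second unitary matrix are \<open>[Vt; I] K^{-1/2}\<close>, those of the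
  first one are \<open>[Ut; Wt] K^{-1/2}\<close>. So \<open>Uhat* R Vhat\<close> fixes the last \<open>n\<close> coordinates, and being unitary it is
  block diagonal with blocks \<open>G0\<close> and \<open>I\<close> (\<open>unitary_block_factorization\<close>).

\<^item> The first unitary matrix arises by a block Gram-Schmidt step. The Cayley-type matrix \<open>[X, U; Y, W]\<close> is
  unitary (\<open>isometry_completion\<close>); multiplying it by \<open>diag(I, Q)\<close> on the left and by \<open>diag(I, Q^{-1})\<close>
  on the right gives an invertible matrix with last block column \<open>[Ut; Wt]\<close>. Projecting its first block
  column onto the orthogonal complement of the last one leaves a Gram matrix equal to a Schur complement,
  whose inverse is the corner \<open>Z\<close> of an inverse matrix (\<open>unitary_from_invertible\<close>).\<close>

unbundle no vec_syntax
unbundle no Formal_Power_Series.fps_syntax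

section \<open>Matrix algebra with dimension conditions\<close>

lemma dim_adjoint [simp]: "dim_row (A\<^sup>\<dagger>) = dim_col A" "dim_col (A\<^sup>\<dagger>) = dim_row A"
  by (auto simp: mat_adjoint_def)

lemma index_adjoint [simp]:
  fixes A :: "complex mat"
  shows "i < dim_col A \<Longrightarrow> j < dim_row A \<Longrightarrow> A\<^sup>\<dagger> $$ (i, j) = cnj (A $$ (j, i))"
  by (simp add: mat_adjoint_def mat_of_rows_def)

lemma adjoint_carrier [simp]: "A \<in> carrier_mat m n \<Longrightarrow> A\<^sup>\<dagger> \<in> carrier_mat n m"
  by auto

lemma adjoint_adjoint [simp]: "((A :: complex mat)\<^sup>\<dagger>)\<^sup>\<dagger> = A"
  by (rule eq_matI) auto

lemma adjoint_one [simp]: "(1\<^sub>m n :: complex mat)\<^sup>\<dagger> = 1\<^sub>m n"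
  by (rule eq_matI) auto

lemma adjoint_zero [simp]: "(0\<^sub>m m n :: complex mat)\<^sup>\<dagger> = 0\<^sub>m n m"
  by (rule eq_matI) auto

lemma adjoint_mult:
  fixes A B :: "complex mat"
  assumes "dim_col A = dim_row B"
  shows "(A * B)\<^sup>\<dagger> = B\<^sup>\<dagger> * A\<^sup>\<dagger>"
  using assms by (intro eq_matI) (auto simp: scalar_prod_def mult.commute intro!: sum.cong)

lemma adjoint_add:
  fixes A B :: "complex mat"
  assumes "dim_row A = dim_row B" "dim_col A = dim_col B"
  shows "(A + B)\<^sup>\<dagger> = A\<^sup>\<dagger> + B\<^sup>\<dagger>"
  using assms by (intro eq_matI) auto

lemma adjoint_minus:
  fixes A B :: "complex mat"
  assumes "dim_row A = dim_row B" "dim_col A = dim_col B"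
  shows "(A - B)\<^sup>\<dagger> = A\<^sup>\<dagger> - B\<^sup>\<dagger>"
  using assms by (intro eq_matI) auto

lemma adjoint_uminus: "(- A :: complex mat)\<^sup>\<dagger> = - A\<^sup>\<dagger>"
  by (intro eq_matI) auto

lemma adjoint_smult: "(c \<cdot>\<^sub>m A :: complex mat)\<^sup>\<dagger> = cnj c \<cdot>\<^sub>m A\<^sup>\<dagger>"
  by (intro eq_matI) auto

lemma adjoint_four_block:
  fixes A B C D :: "complex mat"
  assumes "dim_row B = dim_row A" "dim_col C = dim_col A" "dim_row D = dim_row C" "dim_col D = dim_col B"
  shows "(four_block_mat A B C D)\<^sup>\<dagger> = four_block_mat (A\<^sup>\<dagger>) (C\<^sup>\<dagger>) (B\<^sup>\<dagger>) (D\<^sup>\<dagger>)"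
  using assms by (intro eq_matI) auto

lemma four_block_mult_dim:
  fixes A1 B1 C1 D1 A2 B2 C2 D2 :: "complex mat"
  assumes "dim_row B1 = dim_row A1" "dim_col C1 = dim_col A1" "dim_row D1 = dim_row C1" "dim_col D1 = dim_col B1"
    "dim_row B2 = dim_row A2" "dim_col C2 = dim_col A2" "dim_row D2 = dim_row C2" "dim_col D2 = dim_col B2"
    "dim_col A1 = dim_row A2" "dim_col D1 = dim_row D2"
  shows "four_block_mat A1 B1 C1 D1 * four_block_mat A2 B2 C2 D2 =
    four_block_mat (A1 * A2 + B1 * C2) (A1 * B2 + B1 * D2) (C1 * A2 + D1 * C2) (C1 * B2 + D1 * D2)"
  by (rule mult_four_block_mat[of _ "dim_row A1" "dim_col A1" _ "dim_col B1" _ "dim_row C1"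
        _ _ "dim_col A2" _ "dim_col B2"]; rule carrier_matI) (use assms in simp_all)

lemma carrier_mat_iff: "A \<in> carrier_mat m n \<longleftrightarrow> dim_row A = m \<and> dim_col A = n"
  by auto

lemma carrier_vec_iff: "v \<in> carrier_vec n \<longleftrightarrow> dim_vec v = n"
  by auto

text \<open>The rewrite rules below are conditional on equations between dimensions, which rewriting decides for
rectangular products. Conditions on carrier sets would contain the inner dimension as an unknown. After
expansion with \<open>mat_expand\<close>, an identity between matrices is an identity between sums of products, and
comparing entries reduces it to commutative addition.\<close>

lemma mult_assoc_dim:
  fixes A B C :: "complex mat"
  shows "dim_col A = dim_row B \<Longrightarrow> dim_col B = dim_row C \<Longrightarrow> A * B * C = A * (B * C)"
  by (rule assoc_mult_mat[of _ "dim_row A" "dim_row B" _ "dim_row C" _ "dim_col C"]) auto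

lemma add_mult_dim:
  fixes A B C :: "complex mat"
  shows "dim_row A = dim_row B \<Longrightarrow> dim_col A = dim_col B \<Longrightarrow> dim_col A = dim_row C \<Longrightarrow>
    (A + B) * C = A * C + B * C"
  by (rule add_mult_distrib_mat[of _ "dim_row A" "dim_col A" _ _ "dim_col C"]) auto

lemma mult_add_dim:
  fixes A B C :: "complex mat"
  shows "dim_row A = dim_row B \<Longrightarrow> dim_col A = dim_col B \<Longrightarrow> dim_row A = dim_col C \<Longrightarrow>
    C * (A + B) = C * A + C * B"
  by (rule mult_add_distrib_mat[of _ "dim_row C" "dim_row A" _ "dim_col A"]) auto

lemma minus_mult_dim:
  fixes A B C :: "complex mat"
  shows "dim_row A = dim_row B \<Longrightarrow> dim_col A = dim_col B \<Longrightarrow> dim_col A = dim_row C \<Longrightarrow>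
    (A - B) * C = A * C - B * C"
  by (rule minus_mult_distrib_mat[of _ "dim_row A" "dim_col A" _ _ "dim_col C"]) auto

lemma mult_minus_dim:
  fixes A B C :: "complex mat"
  shows "dim_row A = dim_row B \<Longrightarrow> dim_col A = dim_col B \<Longrightarrow> dim_row A = dim_col C \<Longrightarrow>
    C * (A - B) = C * A - C * B"
  by (rule mult_minus_distrib_mat[of _ "dim_row C" "dim_row A" _ "dim_col A"]) auto

lemma uminus_mult_dim:
  fixes A C :: "complex mat"
  shows "dim_col A = dim_row C \<Longrightarrow> - A * C = - (A * C)" "dim_col A = dim_row C \<Longrightarrow> A * - C = - (A * C)"
  by (auto intro!: eq_matI simp: scalar_prod_def sum_negf)

lemma smult_mult_dim:
  fixes A C :: "complex mat"
  shows "dim_col A = dim_row C \<Longrightarrow> (c \<cdot>\<^sub>m A) * C = c \<cdot>\<^sub>m (A * C)" "dim_col A = dim_row C \<Longrightarrow> A * (c \<cdot>\<^sub>m C) = c \<cdot>\<^sub>m (A * C)"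
  by (auto intro!: eq_matI simp: scalar_prod_def sum_distrib_left mult_ac)

lemma one_mult_dim:
  fixes A :: "complex mat"
  shows "dim_row A = n \<Longrightarrow> 1\<^sub>m n * A = A" "dim_col A = n \<Longrightarrow> A * 1\<^sub>m n = A"
  by auto

lemma zero_mult_dim:
  fixes A :: "complex mat"
  shows "dim_row A = n \<Longrightarrow> 0\<^sub>m m n * A = 0\<^sub>m m (dim_col A)" "dim_col A = n \<Longrightarrow> A * 0\<^sub>m n m = 0\<^sub>m (dim_row A) m"
  by auto

lemma zero_add_dim:
  fixes A :: "complex mat"
  shows "dim_row A = m \<Longrightarrow> dim_col A = n \<Longrightarrow> 0\<^sub>m m n + A = A" "dim_row A = m \<Longrightarrow> dim_col A = n \<Longrightarrow> A + 0\<^sub>m m n = A"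
  by auto

lemmas mat_expand = mult_assoc_dim add_mult_dim mult_add_dim minus_mult_dim mult_minus_dim
  uminus_mult_dim smult_mult_dim one_mult_dim zero_mult_dim zero_add_dim
  adjoint_mult adjoint_add adjoint_minus adjoint_uminus adjoint_smult

lemma eq_mat_diffI:
  fixes A B :: "complex mat"
  assumes "A - B = 0\<^sub>m m n" "dim_row A = m" "dim_col A = n" "dim_row B = m" "dim_col B = n"
  shows "A = B"
proof (rule eq_matI)
  fix i j assume "i < dim_row B" "j < dim_col B"
  then show "A $$ (i, j) = B $$ (i, j)"
    using arg_cong[OF assms(1), of "\<lambda>M. M $$ (i, j)"] assms(2-) by simp
qed (use assms in auto)

lemma left_cancel_dim:
  fixes A B C :: "complex mat"
  assumes "A * B = 1\<^sub>m n" "dim_col A = dim_row B" "dim_row C = n" "dim_col B = dim_row C"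
  shows "A * (B * C) = C"
  using assms by (subst mult_assoc_dim[symmetric]) auto

lemma mat_inverse_right:
  fixes A B :: "complex mat"
  assumes "A \<in> carrier_mat n n" "B \<in> carrier_mat n n" "A * B = 1\<^sub>m n"
  shows "B * A = 1\<^sub>m n"
  using mat_mult_left_right_inverse[OF assms] .

lemma det_nonzero_of_inverse:
  fixes A B :: "complex mat"
  assumes "A \<in> carrier_mat n n" "B \<in> carrier_mat n n" "A * B = 1\<^sub>m n"
  shows "det A \<noteq> 0"
  using det_mult[OF assms(1,2)] assms(3) by auto

lemma minv_works:
  assumes A: "A \<in> carrier_mat n n" and d: "det A \<noteq> 0"
  shows "minv A \<in> carrier_mat n n" "A * minv A = 1\<^sub>m n" "minv A * A = 1\<^sub>m n"
proof -
  have "mat_inverse A \<noteq> None"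
    using mat_inverse(1)[OF A, where b = "()"] det_non_zero_imp_unit[OF A d, where b = "()"] by blast
  then obtain B where B: "mat_inverse A = Some B" by auto
  show "minv A \<in> carrier_mat n n" "A * minv A = 1\<^sub>m n" "minv A * A = 1\<^sub>m n"
    using mat_inverse(2)[OF A B] by (auto simp: minv_def B)
qed

lemma minv_eq:
  assumes A: "A \<in> carrier_mat n n" and B: "B \<in> carrier_mat n n" and AB: "A * B = 1\<^sub>m n"
  shows "minv A = B"
proof -
  note m = minv_works[OF A det_nonzero_of_inverse[OF A B AB]]
  have "minv A = minv A * (A * B)" using m AB by simp
  also have "\<dots> = (minv A * A) * B"
    by (rule assoc_mult_mat[symmetric]) (use m A B in auto)
  finally show ?thesis using m B by simp
qed

text \<open>The adjoint of an inverse is an inverse of the adjoint, so invertibility passes to adjoints without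
computing the determinant of an adjoint.\<close>

lemma det_adjoint_eq_0_iff:
  fixes A :: "complex mat"
  assumes A: "A \<in> carrier_mat n n"
  shows "det (A\<^sup>\<dagger>) = 0 \<longleftrightarrow> det A = 0"
proof -
  have nz: "det (B\<^sup>\<dagger>) \<noteq> 0" if B: "B \<in> carrier_mat n n" and d: "det B \<noteq> 0" for B :: "complex mat"
  proof -
    note m = minv_works[OF B d]
    have "(minv B * B)\<^sup>\<dagger> = B\<^sup>\<dagger> * (minv B)\<^sup>\<dagger>" using B m by (intro adjoint_mult) auto
    then have "B\<^sup>\<dagger> * (minv B)\<^sup>\<dagger> = 1\<^sub>m n" using m by simp
    then show ?thesis
      using B m by (intro det_nonzero_of_inverse[of _ n "(minv B)\<^sup>\<dagger>"]) auto
  qed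
  show ?thesis using nz[of A] nz[of "A\<^sup>\<dagger>"] A by auto
qed

lemma adjoint_minv:
  assumes A: "A \<in> carrier_mat n n" and d: "det A \<noteq> 0"
  shows "(minv A)\<^sup>\<dagger> = minv (A\<^sup>\<dagger>)"
proof (rule minv_eq[symmetric])
  note m = minv_works[OF A d]
  show "A\<^sup>\<dagger> \<in> carrier_mat n n" "(minv A)\<^sup>\<dagger> \<in> carrier_mat n n" using A m by auto
  have "(minv A * A)\<^sup>\<dagger> = A\<^sup>\<dagger> * (minv A)\<^sup>\<dagger>" using A m by (intro adjoint_mult) auto
  then show "A\<^sup>\<dagger> * (minv A)\<^sup>\<dagger> = 1\<^sub>m n" using m by simp
qed

lemma invertible_mat_iff_det:
  fixes A :: "complex mat"
  assumes A: "A \<in> carrier_mat n n"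
  shows "invertible_mat A \<longleftrightarrow> det A \<noteq> 0"
proof
  assume "invertible_mat A"
  then obtain B where AB: "A * B = 1\<^sub>m n" and BA: "B * A = 1\<^sub>m (dim_row B)"
    using A by (auto simp: invertible_mat_def inverts_mat_def)
  have "dim_col B = n" using arg_cong[OF AB, of dim_col] by simp
  moreover have "dim_row B = n" using arg_cong[OF BA, of dim_col] A by simp
  ultimately show "det A \<noteq> 0" using det_nonzero_of_inverse[OF A _ AB] by auto
next
  assume "det A \<noteq> 0"
  from minv_works[OF A this] A show "invertible_mat A"
    by (auto simp: invertible_mat_def inverts_mat_def intro!: exI[of _ "minv A"])
qed

section \<open>Positive definite matrices and their square roots\<close>

lemma cscalar_mult_mat_vec:
  fixes M :: "complex mat"
  assumes M: "M \<in> carrier_mat m n" and v: "v \<in> carrier_vec n" and w: "w \<in> carrier_vec m"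
  shows "(M *\<^sub>v v) \<bullet>c w = v \<bullet>c (M\<^sup>\<dagger> *\<^sub>v w)"
proof -
  have "(M *\<^sub>v v) \<bullet>c w = (\<Sum>i<m. \<Sum>j<n. M $$ (i, j) * v $ j * cnj (w $ i))"
    using assms by (auto simp: scalar_prod_def sum_distrib_right atLeast0LessThan intro!: sum.cong)
  also have "\<dots> = (\<Sum>j<n. \<Sum>i<m. M $$ (i, j) * v $ j * cnj (w $ i))"
    by (rule sum.swap)
  also have "\<dots> = v \<bullet>c (M\<^sup>\<dagger> *\<^sub>v w)"
    using assms by (auto simp: scalar_prod_def sum_distrib_left atLeast0LessThan mult_ac intro!: sum.cong)
  finally show ?thesis .
qed

lemma Re_cscalar_self:
  assumes "v \<in> carrier_vec n"
  shows "Re (v \<bullet>c v) = (\<Sum>i<n. (cmod (v $ i))\<^sup>2)"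
proof -
  have "v \<bullet>c v = (\<Sum>i<n. v $ i * cnj (v $ i))"
    using assms by (simp add: scalar_prod_def atLeast0LessThan)
  also have "Re \<dots> = (\<Sum>i<n. Re (v $ i * cnj (v $ i)))" by (rule Re_sum)
  also have "\<dots> = (\<Sum>i<n. (cmod (v $ i))\<^sup>2)"
    by (rule sum.cong) (auto simp: complex_mult_cnj cmod_power2)
  finally show ?thesis .
qed

lemma Re_cscalar_self_nonneg: "0 \<le> Re (v \<bullet>c v)"
  using Re_cscalar_self[of v "dim_vec v"] by (auto intro: sum_nonneg)

lemma Re_cscalar_self_pos:
  assumes "v \<in> carrier_vec n" "v \<noteq> 0\<^sub>v n"
  shows "0 < Re (v \<bullet>c v)"
proof -
  obtain i where i: "i < n" "v $ i \<noteq> 0"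
    using assms by (metis carrier_vecD eq_vecI index_zero_vec(1,2))
  have "0 < (\<Sum>i<n. (cmod (v $ i))\<^sup>2)"
    by (rule sum_pos2[of _ i]) (use i in auto)
  then show ?thesis using Re_cscalar_self[OF assms(1)] by simp
qed

lemma quadratic_form_gram:
  fixes A :: "complex mat"
  assumes A: "A \<in> carrier_mat m n" and v: "v \<in> carrier_vec n"
  shows "(A\<^sup>\<dagger> * A *\<^sub>v v) \<bullet>c v = (A *\<^sub>v v) \<bullet>c (A *\<^sub>v v)"
proof -
  have "(A\<^sup>\<dagger> * A *\<^sub>v v) = A\<^sup>\<dagger> *\<^sub>v (A *\<^sub>v v)"
    using assms by (intro assoc_mult_mat_vec[of _ n m _ n]) auto
  moreover have "(A\<^sup>\<dagger> *\<^sub>v (A *\<^sub>v v)) \<bullet>c v = (A *\<^sub>v v) \<bullet>c (A *\<^sub>v v)"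
    using cscalar_mult_mat_vec[of "A\<^sup>\<dagger>" n m "A *\<^sub>v v" v] assms by auto
  ultimately show ?thesis by simp
qed

lemma pos_def_det:
  assumes P: "P \<in> carrier_mat n n" "pos_def P"
  shows "det P \<noteq> 0"
proof
  assume "det P = 0"
  then obtain v where v: "v \<in> carrier_vec n" "v \<noteq> 0\<^sub>v n" "P *\<^sub>v v = 0\<^sub>v n"
    using det_0_iff_vec_prod_zero_field[OF P(1)] by auto
  have "0 < Re ((P *\<^sub>v v) \<bullet>c v)" using P v by (auto simp: pos_def_def)
  then show False using v by simp
qed

text \<open>The stacked matrix \<open>[A; B]\<close> has a left inverse, hence trivial kernel, and the sum is its Gram matrix.\<close>

lemma pos_def_gram_sum:
  fixes A B C D :: "complex mat"
  assumes A: "A \<in> carrier_mat p m" and B: "B \<in> carrier_mat q m"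
    and C: "C \<in> carrier_mat m p" and D: "D \<in> carrier_mat m q"
    and left_inverse: "C * A + D * B = 1\<^sub>m m"
  shows "pos_def (A\<^sup>\<dagger> * A + B\<^sup>\<dagger> * B)"
  unfolding pos_def_def
proof (intro conjI ballI impI)
  note [simp] = carrier_matD[OF A] carrier_matD[OF B]
  show "square_mat (A\<^sup>\<dagger> * A + B\<^sup>\<dagger> * B)" by simp
  show "(A\<^sup>\<dagger> * A + B\<^sup>\<dagger> * B)\<^sup>\<dagger> = A\<^sup>\<dagger> * A + B\<^sup>\<dagger> * B"
    by (simp add: adjoint_add adjoint_mult)
  fix v :: "complex vec" assume "v \<in> carrier_vec (dim_row (A\<^sup>\<dagger> * A + B\<^sup>\<dagger> * B))"
    and nz: "v \<noteq> 0\<^sub>v (dim_row (A\<^sup>\<dagger> * A + B\<^sup>\<dagger> * B))"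
  then have v: "v \<in> carrier_vec m" by simp
  have "(A\<^sup>\<dagger> * A + B\<^sup>\<dagger> * B) *\<^sub>v v = (A\<^sup>\<dagger> * A) *\<^sub>v v + (B\<^sup>\<dagger> * B) *\<^sub>v v"
    using v by (intro add_mult_distrib_mat_vec[of _ m m]) (simp_all add: carrier_mat_iff)
  moreover have "((A\<^sup>\<dagger> * A) *\<^sub>v v + (B\<^sup>\<dagger> * B) *\<^sub>v v) \<bullet>c v = ((A\<^sup>\<dagger> * A) *\<^sub>v v) \<bullet>c v + ((B\<^sup>\<dagger> * B) *\<^sub>v v) \<bullet>c v"
    using v by (intro add_scalar_prod_distrib[of _ m]) (simp_all only: carrier_vec_iff, simp_all)
  ultimately have "((A\<^sup>\<dagger> * A + B\<^sup>\<dagger> * B) *\<^sub>v v) \<bullet>c v = (A *\<^sub>v v) \<bullet>c (A *\<^sub>v v) + (B *\<^sub>v v) \<bullet>c (B *\<^sub>v v)"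
    using quadratic_form_gram[OF A v] quadratic_form_gram[OF B v] by metis
  moreover
  have "A *\<^sub>v v \<noteq> 0\<^sub>v p \<or> B *\<^sub>v v \<noteq> 0\<^sub>v q"
  proof (rule ccontr)
    assume "\<not> ?thesis"
    then have z: "A *\<^sub>v v = 0\<^sub>v p" "B *\<^sub>v v = 0\<^sub>v q" by auto
    have "v = (C * A + D * B) *\<^sub>v v" using left_inverse v by simp
    also have "\<dots> = C *\<^sub>v (A *\<^sub>v v) + D *\<^sub>v (B *\<^sub>v v)"
      using add_mult_distrib_mat_vec[of "C * A" m m "D * B" v] assoc_mult_mat_vec[OF C A v]
        assoc_mult_mat_vec[OF D B v] A B C D v
      by (simp del: assoc_mult_mat_vec)
    also have "\<dots> = 0\<^sub>v m" unfolding z using C D by auto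
    finally show False using nz by simp
  qed
  then have "0 < Re ((A *\<^sub>v v) \<bullet>c (A *\<^sub>v v)) \<or> 0 < Re ((B *\<^sub>v v) \<bullet>c (B *\<^sub>v v))"
    using Re_cscalar_self_pos[of "A *\<^sub>v v" p] Re_cscalar_self_pos[of "B *\<^sub>v v" q] A B v
    by auto
  ultimately show "0 < Re (((A\<^sup>\<dagger> * A + B\<^sup>\<dagger> * B) *\<^sub>v v) \<bullet>c v)"
    using Re_cscalar_self_nonneg[of "A *\<^sub>v v"] Re_cscalar_self_nonneg[of "B *\<^sub>v v"]
    by fastforce
qed

lemma pos_def_one_plus_gram:
  fixes V :: "complex mat"
  assumes V: "V \<in> carrier_mat p n"
  shows "1\<^sub>m n + V\<^sup>\<dagger> * V \<in> carrier_mat n n" "pos_def (1\<^sub>m n + V\<^sup>\<dagger> * V)"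
proof -
  note [simp] = carrier_matD[OF V]
  show "1\<^sub>m n + V\<^sup>\<dagger> * V \<in> carrier_mat n n" by (rule carrier_matI) simp_all
  have "1\<^sub>m n * 1\<^sub>m n + 0\<^sub>m n p * V = 1\<^sub>m n" by (simp add: mat_expand)
  from pos_def_gram_sum[OF one_carrier_mat V one_carrier_mat zero_carrier_mat this]
  show "pos_def (1\<^sub>m n + V\<^sup>\<dagger> * V)" by (simp add: mat_expand)
qed

lemma pos_def_gram:
  fixes A C :: "complex mat"
  assumes A: "A \<in> carrier_mat p m" and C: "C \<in> carrier_mat m p" and CA: "C * A = 1\<^sub>m m"
  shows "pos_def (A\<^sup>\<dagger> * A)"
proof -
  note [simp] = carrier_matD[OF A] carrier_matD[OF C]
  have "pos_def (A\<^sup>\<dagger> * A + (0\<^sub>m m m)\<^sup>\<dagger> * 0\<^sub>m m m)"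
    by (rule pos_def_gram_sum[OF A _ C, of _ m "0\<^sub>m m m"]) (simp_all add: CA)
  then show ?thesis by (simp add: mat_expand)
qed

lemma det_factor_nonzero:
  fixes Q :: "complex mat"
  assumes Q: "Q \<in> carrier_mat n n" and pos: "pos_def (Q\<^sup>\<dagger> * Q)"
  shows "det Q \<noteq> 0"
  using pos_def_det[OF mult_carrier_mat[OF adjoint_carrier[OF Q] Q] pos] det_mult[OF adjoint_carrier[OF Q] Q] by auto

text \<open>Gram-Schmidt applied to a basis starting with \<open>v\<close> gives orthogonal columns; dividing by their norms makes
the matrix unitary.\<close>

lemma unitary_with_first_column:
  fixes v :: "complex vec"
  assumes v: "v \<in> carrier_vec n" "v \<noteq> 0\<^sub>v n"
  obtains W c where "W \<in> carrier_mat n n" "W\<^sup>\<dagger> * W = 1\<^sub>m n" "col W 0 = c \<cdot>\<^sub>v v"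
proof -
  have n: "0 < n" using v by (cases n) auto
  interpret cof_vec_space n "TYPE(complex)" .
  define b where "b = basis_completion v"
  define ws where "ws = gram_schmidt n b"
  from basis_completion[OF v, folded b_def]
  have span_b: "span (set b) = carrier_vec n" and dist_b: "distinct b"
    and indep: "\<not> lin_dep (set b)" and b: "set b \<subseteq> carrier_vec n" and hdb: "hd b = v"
    and len_b: "length b = n" by auto
  from hdb len_b n obtain vs where bv: "b = v # vs" by (cases b) auto
  from gram_schmidt_result[OF b dist_b indep refl, folded ws_def]
  have ws: "set ws \<subseteq> carrier_vec n" "corthogonal ws" "length ws = n"
    by (auto simp: len_b)
  from gram_schmidt_hd[OF v(1), of vs, folded bv] have hdws: "hd ws = v" unfolding ws_def .
  then have ws0: "ws ! 0 = v" using ws(3) n by (cases ws) auto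
  define s where "s j = complex_of_real (sqrt (Re (ws ! j \<bullet>c ws ! j)))" for j
  define W where "W = mat n n (\<lambda>(i, j). ws ! j $ i / s j)"
  have wsc: "ws ! j \<in> carrier_vec n" if "j < n" for j using ws that by auto
  have orth: "(ws ! i \<bullet>c ws ! j = 0) = (i \<noteq> j)" if "i < n" "j < n" for i j
    using corthogonalD[OF ws(2)] ws(3) that by auto
  have s: "s j * s j = ws ! j \<bullet>c ws ! j" for j
  proof -
    have "Im (ws ! j \<bullet>c ws ! j) = 0" by (simp add: scalar_prod_def Im_sum)
    then show ?thesis using Re_cscalar_self_nonneg[of "ws ! j"]
      by (simp add: s_def complex_eq_iff)
  qed
  have cnjs: "cnj (s j) = s j" for j by (simp add: s_def)
  have "(W\<^sup>\<dagger> * W) $$ (i, j) = 1\<^sub>m n $$ (i, j)" if ij: "i < n" "j < n" for i j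
  proof -
    have "(W\<^sup>\<dagger> * W) $$ (i, j) = (\<Sum>k<n. cnj (ws ! i $ k / s i) * (ws ! j $ k / s j))"
      using ij by (simp add: W_def scalar_prod_def atLeast0LessThan)
    also have "\<dots> = (\<Sum>k<n. ws ! j $ k * cnj (ws ! i $ k) / (s i * s j))"
      by (rule sum.cong) (auto simp: cnjs)
    also have "\<dots> = (ws ! j \<bullet>c ws ! i) / (s i * s j)"
      using wsc[OF ij(1)] wsc[OF ij(2)] by (simp add: scalar_prod_def atLeast0LessThan sum_divide_distrib)
    also have "\<dots> = 1\<^sub>m n $$ (i, j)"
      using orth[OF ij(2,1)] ij s[of i] by (cases "i = j") auto
    finally show ?thesis .
  qed
  then have "W\<^sup>\<dagger> * W = 1\<^sub>m n" by (intro eq_matI) (auto simp: W_def)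
  moreover have "col W 0 = (1 / s 0) \<cdot>\<^sub>v v"
    using ws0 n v by (intro eq_vecI) (auto simp: W_def)
  ultimately show ?thesis using that[of W "1 / s 0"] by (auto simp: W_def)
qed

text \<open>Induction on the dimension: conjugating with a unitary matrix whose first column is an eigenvector leaves,
by Hermitian symmetry, a block diagonal matrix with a smaller Hermitian block.\<close>

lemma hermitian_diagonalizable:
  fixes A :: "complex mat"
  assumes "A \<in> carrier_mat n n" "A\<^sup>\<dagger> = A"
  shows "\<exists>V \<in> carrier_mat n n. V\<^sup>\<dagger> * V = 1\<^sub>m n \<and> diagonal_mat (V\<^sup>\<dagger> * A * V)"
  using assms
proof (induction n arbitrary: A)
  case 0
  then show ?case by (intro bexI[of _ "1\<^sub>m 0"]) (auto simp: diagonal_mat_def)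
next
  case (Suc n A)
  obtain e where "e \<in> spectrum A" using spectrum_non_empty[OF Suc.prems(1)] by auto
  then obtain v where ev: "eigenvector A v e" by (auto simp: spectrum_def eigenvalue_def)
  then have v: "v \<in> carrier_vec (Suc n)" "v \<noteq> 0\<^sub>v (Suc n)" and Av: "A *\<^sub>v v = e \<cdot>\<^sub>v v"
    using Suc.prems by (auto simp: eigenvector_def)
  obtain W c where W: "W \<in> carrier_mat (Suc n) (Suc n)" and WW: "W\<^sup>\<dagger> * W = 1\<^sub>m (Suc n)"
    and Wv: "col W 0 = c \<cdot>\<^sub>v v"
    using unitary_with_first_column[OF v] .
  note [simp] = carrier_matD[OF W] carrier_matD[OF Suc.prems(1)]
  define A' where "A' = W\<^sup>\<dagger> * A * W"
  have A': "A' \<in> carrier_mat (Suc n) (Suc n)" using W Suc.prems by (auto simp: A'_def)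
  have A'h: "A'\<^sup>\<dagger> = A'" using Suc.prems(2) by (simp add: A'_def mat_expand)
  have "col (A * W) 0 = e \<cdot>\<^sub>v col W 0"
  proof -
    have "col (A * W) 0 = A *\<^sub>v col W 0" by (rule col_mult2) (use W Suc.prems in auto)
    also have "\<dots> = e \<cdot>\<^sub>v col W 0"
      unfolding Wv using v Suc.prems Av by (simp add: mult_mat_vec smult_smult_assoc mult.commute)
    finally show ?thesis .
  qed
  moreover have "col A' 0 = W\<^sup>\<dagger> *\<^sub>v col (A * W) 0"
  proof -
    have "A' = W\<^sup>\<dagger> * (A * W)" by (simp add: A'_def mult_assoc_dim)
    then show ?thesis using W Suc.prems(1) by (simp add: col_mult2[of _ "Suc n" "Suc n" _ "Suc n"])
  qed
  ultimately have "col A' 0 = e \<cdot>\<^sub>v (W\<^sup>\<dagger> *\<^sub>v col W 0)"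
    using mult_mat_vec[of "W\<^sup>\<dagger>" "Suc n" "Suc n" "col W 0" e] W Wv v by simp
  also have "W\<^sup>\<dagger> *\<^sub>v col W 0 = col (W\<^sup>\<dagger> * W) 0"
    using W by (simp add: col_mult2[of _ "Suc n" "Suc n" _ "Suc n"])
  finally have colA': "col A' 0 = e \<cdot>\<^sub>v unit_vec (Suc n) 0" by (simp add: WW)
  have A'0: "A' $$ (i, 0) = (if i = 0 then e else 0)" if "i < Suc n" for i
    using arg_cong[OF colA', of "\<lambda>u. u $ i"] that A' by (auto simp: unit_vec_def)
  have A'0': "A' $$ (0, j) = 0" if "0 < j" "j < Suc n" for j
    using A'0[of j] arg_cong[OF A'h, of "\<lambda>M. M $$ (0, j)"] that A' by auto
  define E where "E = mat 1 1 (\<lambda>_. e)"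
  define A3 where "A3 = mat n n (\<lambda>(i, j). A' $$ (Suc i, Suc j))"
  have A3: "A3 \<in> carrier_mat n n" by (simp add: A3_def)
  have A3h: "A3\<^sup>\<dagger> = A3"
  proof (rule eq_matI)
    fix i j assume "i < dim_row A3" "j < dim_col A3"
    then show "A3\<^sup>\<dagger> $$ (i, j) = A3 $$ (i, j)"
      using arg_cong[OF A'h, of "\<lambda>M. M $$ (Suc i, Suc j)"] A' by (auto simp: A3_def)
  qed (auto simp: A3_def)
  have A'b: "A' = four_block_mat E (0\<^sub>m 1 n) (0\<^sub>m n 1) A3"
    using A' A'0 A'0' by (intro eq_matI) (auto simp: E_def A3_def not_less less_Suc_eq_0_disj)
  obtain V3 where V3: "V3 \<in> carrier_mat n n" "V3\<^sup>\<dagger> * V3 = 1\<^sub>m n" "diagonal_mat (V3\<^sup>\<dagger> * A3 * V3)"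
    using Suc.IH[OF A3 A3h] by auto
  define F where "F = four_block_mat (1\<^sub>m 1) (0\<^sub>m 1 n) (0\<^sub>m n 1) V3"
  have F: "F \<in> carrier_mat (Suc n) (Suc n)" using V3 by (auto simp: F_def)
  have Fa: "F\<^sup>\<dagger> = four_block_mat (1\<^sub>m 1) (0\<^sub>m 1 n) (0\<^sub>m n 1) (V3\<^sup>\<dagger>)"
    using carrier_matD[OF V3(1)] by (simp add: F_def adjoint_four_block)
  have E: "E \<in> carrier_mat 1 1" by (simp add: E_def)
  note [simp] = carrier_matD[OF F] carrier_matD[OF V3(1)] carrier_matD[OF A3] carrier_matD[OF E]
  have FF: "F\<^sup>\<dagger> * F = 1\<^sub>m (Suc n)"
    unfolding Fa unfolding F_def
    by (simp add: four_block_mult_dim mat_expand V3(2) del: assoc_mult_mat)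
  have FAF: "F\<^sup>\<dagger> * A' * F = four_block_mat E (0\<^sub>m 1 n) (0\<^sub>m n 1) (V3\<^sup>\<dagger> * A3 * V3)"
    unfolding Fa A'b unfolding F_def
    by (simp add: four_block_mult_dim mat_expand)
  show ?case
  proof (intro bexI[of _ "W * F"] conjI)
    show "W * F \<in> carrier_mat (Suc n) (Suc n)" using W F by auto
    have "(W * F)\<^sup>\<dagger> * (W * F) = F\<^sup>\<dagger> * F"
      by (simp add: mat_expand left_cancel_dim[OF WW])
    then show "(W * F)\<^sup>\<dagger> * (W * F) = 1\<^sub>m (Suc n)" using FF by simp
    have "(W * F)\<^sup>\<dagger> * A * (W * F) = F\<^sup>\<dagger> * A' * F"
      by (simp add: mat_expand A'_def)
    then show "diagonal_mat ((W * F)\<^sup>\<dagger> * A * (W * F))"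
      unfolding FAF using V3(3) by (auto simp: diagonal_mat_def E_def)
  qed
qed

definition real_diag :: "nat \<Rightarrow> (nat \<Rightarrow> real) \<Rightarrow> complex mat" where
  "real_diag n f = mat n n (\<lambda>(i, j). if i = j then complex_of_real (f i) else 0)"

lemma real_diag_simps [simp]:
  "dim_row (real_diag n f) = n" "dim_col (real_diag n f) = n"
  "(real_diag n f)\<^sup>\<dagger> = real_diag n f"
  by (auto simp: real_diag_def intro!: eq_matI)

lemma real_diag_mult: "real_diag n f * real_diag n g = real_diag n (\<lambda>i. f i * g i)"
  by (rule eq_matI) (auto simp: real_diag_def scalar_prod_def if_distrib[of "\<lambda>x. x * _"]
      if_distrib[of "\<lambda>x. _ * x"] sum.If_cases cong: if_cong)

text \<open>The entry is the value of the quadratic form of \<open>M\<close> at the \<open>i\<close>-th column of \<open>V\<close>, a unit vector.\<close>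

lemma pos_def_congruence_diag:
  assumes M: "M \<in> carrier_mat n n" "pos_def M" and V: "V \<in> carrier_mat n n" "V\<^sup>\<dagger> * V = 1\<^sub>m n"
    and i: "i < n"
  shows "0 < Re ((V\<^sup>\<dagger> * M * V) $$ (i, i))"
proof -
  note [simp] = carrier_matD[OF M(1)] carrier_matD[OF V(1)]
  let ?v = "col V i"
  have v: "?v \<in> carrier_vec n" using V(1) i by auto
  have "(V\<^sup>\<dagger> * V) $$ (i, i) = 1" using V(2) i by simp
  moreover have "V $$ (k, i) = 0" if "?v = 0\<^sub>v n" "k < n" for k
    using arg_cong[OF that(1), of "\<lambda>u. u $ k"] that(2) i by simp
  ultimately have "?v \<noteq> 0\<^sub>v n" using i by (auto simp: scalar_prod_def)
  then have "0 < Re ((M *\<^sub>v ?v) \<bullet>c ?v)" using M v by (auto simp: pos_def_def)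
  also have "(M *\<^sub>v ?v) \<bullet>c ?v = (V\<^sup>\<dagger> * (M * V)) $$ (i, i)"
    using i v by (simp add: scalar_prod_def sum_distrib_right mult.commute)
  finally show ?thesis by (simp add: mult_assoc_dim)
qed

text \<open>Diagonalize and take square roots of the eigenvalues. Positivity of the result is visible when it is
written as a Gram matrix, which is why fourth roots of the eigenvalues appear.\<close>

lemma ex_pos_def_sqrt:
  assumes M: "M \<in> carrier_mat n n" "pos_def M"
  shows "\<exists>S \<in> carrier_mat n n. pos_def S \<and> S * S = M"
proof -
  have Mh: "M\<^sup>\<dagger> = M" using M by (simp add: pos_def_def)
  obtain V where V: "V \<in> carrier_mat n n" "V\<^sup>\<dagger> * V = 1\<^sub>m n" and diag: "diagonal_mat (V\<^sup>\<dagger> * M * V)"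
    using hermitian_diagonalizable[OF M(1) Mh] by auto
  have VV: "V * V\<^sup>\<dagger> = 1\<^sub>m n" using mat_inverse_right[of "V\<^sup>\<dagger>" n V] V by auto
  note [simp] = carrier_matD[OF M(1)] carrier_matD[OF V(1)]
  define d where "d i = Re ((V\<^sup>\<dagger> * M * V) $$ (i, i))" for i
  have d: "0 < d i" if "i < n" for i
    unfolding d_def by (rule pos_def_congruence_diag[OF M V that])
  have h: "(V\<^sup>\<dagger> * M * V)\<^sup>\<dagger> = V\<^sup>\<dagger> * M * V" by (simp add: mat_expand Mh)
  have D: "V\<^sup>\<dagger> * M * V = real_diag n d"
  proof (rule eq_matI)
    fix i j assume ij: "i < dim_row (real_diag n d)" "j < dim_col (real_diag n d)"
    have "cnj ((V\<^sup>\<dagger> * M * V) $$ (i, i)) = (V\<^sup>\<dagger> * M * V) $$ (i, i)"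
      using arg_cong[OF h, of "\<lambda>M. M $$ (i, i)"] ij by simp
    then have "Im ((V\<^sup>\<dagger> * M * V) $$ (i, i)) = 0" by (metis Reals_cnj_iff complex_is_Real_iff)
    then show "(V\<^sup>\<dagger> * M * V) $$ (i, j) = real_diag n d $$ (i, j)"
      using diag ij by (auto simp: real_diag_def d_def diagonal_mat_def complex_eq_iff simp del: index_mult_mat(1))
  qed auto
  \<comment> \<open>The square root of \<open>M\<close> will be the Gram matrix of \<open>R V*\<close>, so \<open>R\<close> carries fourth roots.\<close>
  define r where "r i = sqrt (sqrt (d i))" for i
  define R where "R = real_diag n r"
  define R' where "R' = real_diag n (\<lambda>i. 1 / r i)"
  have [simp]: "dim_row R = n" "dim_col R = n" "dim_row R' = n" "dim_col R' = n" "R\<^sup>\<dagger> = R"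
    by (auto simp: R_def R'_def)
  have RR: "R' * R = 1\<^sub>m n"
    unfolding R_def R'_def real_diag_mult
    by (rule eq_matI) (use d in \<open>auto simp: real_diag_def r_def less_imp_neq[symmetric]\<close>)
  have R4: "R * (R * (R * R)) = V\<^sup>\<dagger> * M * V"
    unfolding D R_def real_diag_mult
    by (rule eq_matI) (use d in \<open>auto simp: real_diag_def r_def abs_of_pos simp flip: of_real_mult mult.assoc\<close>)
  define S where "S = (R * V\<^sup>\<dagger>)\<^sup>\<dagger> * (R * V\<^sup>\<dagger>)"
  have "S \<in> carrier_mat n n" by (simp add: S_def carrier_mat_iff)
  moreover have "pos_def S"
    unfolding S_def
    by (rule pos_def_gram[where C = "V * R'"])
      (simp_all add: carrier_mat_iff mat_expand left_cancel_dim[OF RR] VV)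
  moreover have "S * S = M"
  proof -
    have "S * S = V * (R * (R * (R * R))) * V\<^sup>\<dagger>"
      by (simp add: S_def mat_expand left_cancel_dim[OF V(2)])
    also have "\<dots> = M"
      unfolding R4 by (simp add: mat_expand left_cancel_dim[OF VV] VV)
    finally show ?thesis .
  qed
  ultimately show ?thesis by blast
qed

text \<open>If \<open>S\<^sup>2 = T\<^sup>2\<close>, then \<open>E = S - T\<close> satisfies \<open>S E + E T = 0\<close>. In an orthonormal eigenbasis of the Hermitian
matrix \<open>E\<close> the diagonal entries of this identity are \<open>e (s + t) = 0\<close>, with an eigenvalue \<open>e\<close> of \<open>E\<close> and
diagonal entries \<open>s, t > 0\<close> of the transformed positive definite matrices. So all eigenvalues of \<open>E\<close> vanish.\<close>

lemma pos_def_sqrt_unique: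
  assumes S: "S \<in> carrier_mat n n" "pos_def S" and T: "T \<in> carrier_mat n n" "pos_def T"
    and eq: "S * S = T * T"
  shows "S = T"
proof -
  note [simp] = carrier_matD[OF S(1)] carrier_matD[OF T(1)]
  have h: "(S - T)\<^sup>\<dagger> = S - T"
    using S T by (simp add: adjoint_minus pos_def_def)
  have "S - T \<in> carrier_mat n n" by (simp add: carrier_mat_iff)
  from hermitian_diagonalizable[OF this h] obtain V where
    V: "V \<in> carrier_mat n n" "V\<^sup>\<dagger> * V = 1\<^sub>m n" and diag: "diagonal_mat (V\<^sup>\<dagger> * (S - T) * V)" by auto
  have VV: "V * V\<^sup>\<dagger> = 1\<^sub>m n" using mat_inverse_right[of "V\<^sup>\<dagger>" n V] V by auto
  note [simp] = carrier_matD[OF V(1)]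
  define E where "E = V\<^sup>\<dagger> * (S - T) * V"
  define S' where "S' = V\<^sup>\<dagger> * S * V"
  define T' where "T' = V\<^sup>\<dagger> * T * V"
  have [simp]: "dim_row E = n" "dim_col E = n" "dim_row S' = n" "dim_col S' = n" "dim_row T' = n" "dim_col T' = n"
    by (auto simp: E_def S'_def T'_def)
  have sum0: "S' * E + E * T' = V\<^sup>\<dagger> * (S * S) * V - V\<^sup>\<dagger> * (T * T) * V"
    unfolding E_def S'_def T'_def
    by (simp add: mat_expand left_cancel_dim[OF VV]) (auto intro!: eq_matI simp del: index_mult_mat(1))
  have E0: "E $$ (i, j) = 0" if ij: "i < n" "j < n" for i j
  proof (cases "i = j")
    case True
    have off: "E $$ (k, l) = 0" if "k < n" "l < n" "k \<noteq> l" for k l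
      using diag that by (simp add: diagonal_mat_def E_def del: index_mult_mat(1))
    have "0 = (S' * E + E * T') $$ (i, i)"
      unfolding sum0 eq using ij by simp
    also have "\<dots> = (\<Sum>k<n. S' $$ (i, k) * E $$ (k, i)) + (\<Sum>k<n. E $$ (i, k) * T' $$ (k, i))"
      using ij by (simp add: scalar_prod_def atLeast0LessThan)
    also have "(\<Sum>k<n. S' $$ (i, k) * E $$ (k, i)) = (\<Sum>k<n. if k = i then S' $$ (i, i) * E $$ (i, i) else 0)"
      by (rule sum.cong) (use off ij in auto)
    also have "(\<Sum>k<n. E $$ (i, k) * T' $$ (k, i)) = (\<Sum>k<n. if k = i then E $$ (i, i) * T' $$ (i, i) else 0)"
      by (rule sum.cong) (use off ij in auto)
    finally have "E $$ (i, i) * (S' $$ (i, i) + T' $$ (i, i)) = 0"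
      using ij by (simp add: algebra_simps)
    moreover have "0 < Re (S' $$ (i, i) + T' $$ (i, i))"
      using pos_def_congruence_diag[OF S V ij(1)] pos_def_congruence_diag[OF T V ij(1)]
      by (simp add: S'_def T'_def)
    ultimately show ?thesis using True by (metis less_irrefl mult_eq_0_iff zero_complex.sel(1))
  qed (use diag ij in \<open>simp add: diagonal_mat_def E_def del: index_mult_mat(1)\<close>)
  have "V * E * V\<^sup>\<dagger> = S - T"
    unfolding E_def by (simp add: mult_assoc_dim left_cancel_dim[OF VV] VV)
  moreover have "E = 0\<^sub>m n n" by (rule eq_matI) (use E0 in auto)
  ultimately have "S - T = 0\<^sub>m n n" by (simp add: zero_mult_dim)
  then show ?thesis by (rule eq_mat_diffI) auto
qed

lemma mat_sqrt_works:
  assumes M: "M \<in> carrier_mat n n" "pos_def M"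
  shows "mat_sqrt M \<in> carrier_mat n n" "pos_def (mat_sqrt M)" "mat_sqrt M * mat_sqrt M = M"
    "(mat_sqrt M)\<^sup>\<dagger> = mat_sqrt M"
proof -
  have car: "S \<in> carrier_mat n n" if "pos_def S" "S * S = M" for S
  proof (rule carrier_matI)
    show "dim_row S = n" using arg_cong[OF that(2), of dim_row] M(1) by simp
    then show "dim_col S = n" using that(1) by (simp add: pos_def_def)
  qed
  obtain S where S: "S \<in> carrier_mat n n" "pos_def S" "S * S = M"
    using ex_pos_def_sqrt[OF M] by auto
  have "mat_sqrt M = S"
    unfolding mat_sqrt_def
    using S by (intro the_equality conjI pos_def_sqrt_unique[of _ n S]) (auto intro: car)
  with S show "mat_sqrt M \<in> carrier_mat n n" "pos_def (mat_sqrt M)" "mat_sqrt M * mat_sqrt M = M"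
    "(mat_sqrt M)\<^sup>\<dagger> = mat_sqrt M" by (auto simp: pos_def_def)
qed

lemma mat_isqrt_works:
  assumes M: "M \<in> carrier_mat n n" "pos_def M"
  shows "mat_isqrt M \<in> carrier_mat n n" "(mat_isqrt M)\<^sup>\<dagger> = mat_isqrt M"
    "mat_isqrt M * (M * mat_isqrt M) = 1\<^sub>m n"
proof -
  note s = mat_sqrt_works[OF M]
  note d = pos_def_det[OF s(1,2)]
  note i = minv_works[OF s(1) d]
  note [simp] = carrier_matD[OF s(1)] carrier_matD[OF i(1)] carrier_matD[OF M(1)]
  show "mat_isqrt M \<in> carrier_mat n n" "(mat_isqrt M)\<^sup>\<dagger> = mat_isqrt M"
    using i adjoint_minv[OF s(1) d] s by (auto simp: mat_isqrt_def)
  have "mat_isqrt M * (M * mat_isqrt M) = minv (mat_sqrt M) * ((mat_sqrt M * mat_sqrt M) * minv (mat_sqrt M))"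
    by (simp add: s mat_isqrt_def)
  also have "\<dots> = 1\<^sub>m n"
    by (simp only: mult_assoc_dim i carrier_matD[OF s(1)] carrier_matD[OF i(1)] left_cancel_dim[OF i(3)] i(2,3) one_mult_dim)
  finally show "mat_isqrt M * (M * mat_isqrt M) = 1\<^sub>m n" .
qed

section \<open>Unitary matrices in block form\<close>

lemma four_block_eqD:
  fixes A B C D A' B' C' D' :: "complex mat"
  assumes eq: "four_block_mat A B C D = four_block_mat A' B' C' D'"
    and "A \<in> carrier_mat p p" "B \<in> carrier_mat p n" "C \<in> carrier_mat n p" "D \<in> carrier_mat n n"
    and "A' \<in> carrier_mat p p" "B' \<in> carrier_mat p n" "C' \<in> carrier_mat n p" "D' \<in> carrier_mat n n"
  shows "A = A'" "B = B'" "C = C'" "D = D'"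
proof -
  have e: "four_block_mat A B C D $$ (i, j) = four_block_mat A' B' C' D' $$ (i, j)" for i j
    using eq by simp
  note [simp] = assms(2-9)[THEN carrier_matD(1)] assms(2-9)[THEN carrier_matD(2)]
  show "A = A'"
  proof (rule eq_matI)
    fix i j assume "i < dim_row A'" "j < dim_col A'"
    then show "A $$ (i, j) = A' $$ (i, j)" using e[of i j] by simp
  qed auto
  show "B = B'"
  proof (rule eq_matI)
    fix i j assume "i < dim_row B'" "j < dim_col B'"
    then show "B $$ (i, j) = B' $$ (i, j)" using e[of i "j + p"] by simp
  qed auto
  show "C = C'"
  proof (rule eq_matI)
    fix i j assume "i < dim_row C'" "j < dim_col C'"
    then show "C $$ (i, j) = C' $$ (i, j)" using e[of "i + p" j] by simp
  qed auto
  show "D = D'"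
  proof (rule eq_matI)
    fix i j assume "i < dim_row D'" "j < dim_col D'"
    then show "D $$ (i, j) = D' $$ (i, j)" using e[of "i + p" "j + p"] by simp
  qed auto
qed

lemma unitary_matI:
  assumes "M \<in> carrier_mat n n" "M\<^sup>\<dagger> * M = 1\<^sub>m n"
  shows "unitary_mat M"
  using assms mat_inverse_right[of "M\<^sup>\<dagger>" n M] by (auto simp: unitary_mat_def)

lemma unitary_matD:
  assumes "unitary_mat M" "M \<in> carrier_mat n n"
  shows "M\<^sup>\<dagger> * M = 1\<^sub>m n" "M * M\<^sup>\<dagger> = 1\<^sub>m n"
  using assms by (auto simp: unitary_mat_def)

lemma unitary_four_block_iff:
  fixes A B C D :: "complex mat"
  assumes A: "A \<in> carrier_mat p p" and B: "B \<in> carrier_mat p n"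
    and C: "C \<in> carrier_mat n p" and D: "D \<in> carrier_mat n n"
  shows "unitary_mat (four_block_mat A B C D) \<longleftrightarrow>
    A\<^sup>\<dagger> * A + C\<^sup>\<dagger> * C = 1\<^sub>m p \<and> A\<^sup>\<dagger> * B + C\<^sup>\<dagger> * D = 0\<^sub>m p n \<and>
    B\<^sup>\<dagger> * A + D\<^sup>\<dagger> * C = 0\<^sub>m n p \<and> B\<^sup>\<dagger> * B + D\<^sup>\<dagger> * D = 1\<^sub>m n" (is "?u \<longleftrightarrow> ?b")
proof -
  note [simp] = carrier_matD[OF A] carrier_matD[OF B] carrier_matD[OF C] carrier_matD[OF D]
  let ?M = "four_block_mat A B C D"
  have car: "?M \<in> carrier_mat (p + n) (p + n)" by (simp add: carrier_mat_iff)
  have prod: "?M\<^sup>\<dagger> * ?M = four_block_mat (A\<^sup>\<dagger> * A + C\<^sup>\<dagger> * C) (A\<^sup>\<dagger> * B + C\<^sup>\<dagger> * D)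
    (B\<^sup>\<dagger> * A + D\<^sup>\<dagger> * C) (B\<^sup>\<dagger> * B + D\<^sup>\<dagger> * D)"
    by (simp add: adjoint_four_block four_block_mult_dim)
  have one: "1\<^sub>m (p + n) = four_block_mat (1\<^sub>m p) (0\<^sub>m p n) (0\<^sub>m n p) (1\<^sub>m n)"
    by simp
  show ?thesis
  proof
    assume ?u
    then have "four_block_mat (A\<^sup>\<dagger> * A + C\<^sup>\<dagger> * C) (A\<^sup>\<dagger> * B + C\<^sup>\<dagger> * D)
      (B\<^sup>\<dagger> * A + D\<^sup>\<dagger> * C) (B\<^sup>\<dagger> * B + D\<^sup>\<dagger> * D) =
      four_block_mat (1\<^sub>m p) (0\<^sub>m p n) (0\<^sub>m n p) (1\<^sub>m n)"
      using unitary_matD(1)[OF _ car] prod one by metis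
    from four_block_eqD[OF this, of p n] show ?b by (simp add: carrier_mat_iff)
  next
    assume ?b
    then show ?u by (intro unitary_matI[OF car]) (simp add: prod)
  qed
qed

text \<open>For unitary \<open>[a, b; c, d]\<close> the block columns \<open>[x; y]\<close> and \<open>[a x + b y; c x + d y]\<close> have the same Gram
matrix. This yields the equation for \<open>P\<close> when applied to the adjoint of the realization matrix, and the two
expressions for \<open>K\<close> when applied to the realization matrix itself.\<close>

lemma unitary_block_isometry:
  fixes a b c d x y :: "complex mat"
  assumes a: "a \<in> carrier_mat p p" and b: "b \<in> carrier_mat p n"
    and c: "c \<in> carrier_mat n p" and d: "d \<in> carrier_mat n n"
    and u: "unitary_mat (four_block_mat a b c d)"
    and x: "x \<in> carrier_mat p m" and y: "y \<in> carrier_mat n m"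
  shows "(a * x + b * y)\<^sup>\<dagger> * (a * x + b * y) + (c * x + d * y)\<^sup>\<dagger> * (c * x + d * y) = x\<^sup>\<dagger> * x + y\<^sup>\<dagger> * y"
proof -
  note [simp] = carrier_matD[OF a] carrier_matD[OF b] carrier_matD[OF c] carrier_matD[OF d]
    carrier_matD[OF x] carrier_matD[OF y]
  note iso = u[unfolded unitary_four_block_iff[OF a b c d]]
  have "(a * x + b * y)\<^sup>\<dagger> * (a * x + b * y) + (c * x + d * y)\<^sup>\<dagger> * (c * x + d * y) =
    x\<^sup>\<dagger> * ((a\<^sup>\<dagger> * a + c\<^sup>\<dagger> * c) * x) + x\<^sup>\<dagger> * ((a\<^sup>\<dagger> * b + c\<^sup>\<dagger> * d) * y) +
    y\<^sup>\<dagger> * ((b\<^sup>\<dagger> * a + d\<^sup>\<dagger> * c) * x) + y\<^sup>\<dagger> * ((b\<^sup>\<dagger> * b + d\<^sup>\<dagger> * d) * y)"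
    by (simp add: mat_expand) (auto intro!: eq_matI simp del: index_mult_mat(1))
  also have "\<dots> = x\<^sup>\<dagger> * x + y\<^sup>\<dagger> * y"
    using iso by (simp add: mat_expand)
  finally show ?thesis .
qed

lemma block_apply_adjoint:
  fixes a b c d x y :: "complex mat"
  assumes a: "a \<in> carrier_mat p p" and b: "b \<in> carrier_mat p n"
    and c: "c \<in> carrier_mat n p" and d: "d \<in> carrier_mat n n"
    and u: "unitary_mat (four_block_mat a b c d)"
    and x: "x \<in> carrier_mat p m" and y: "y \<in> carrier_mat n m"
  shows "a\<^sup>\<dagger> * (a * x + b * y) + c\<^sup>\<dagger> * (c * x + d * y) = x"
    "b\<^sup>\<dagger> * (a * x + b * y) + d\<^sup>\<dagger> * (c * x + d * y) = y"
proof -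
  note [simp] = carrier_matD[OF a] carrier_matD[OF b] carrier_matD[OF c] carrier_matD[OF d]
    carrier_matD[OF x] carrier_matD[OF y]
  note iso = u[unfolded unitary_four_block_iff[OF a b c d]]
  have "a\<^sup>\<dagger> * (a * x + b * y) + c\<^sup>\<dagger> * (c * x + d * y) =
    (a\<^sup>\<dagger> * a + c\<^sup>\<dagger> * c) * x + (a\<^sup>\<dagger> * b + c\<^sup>\<dagger> * d) * y"
    by (simp add: mat_expand) (auto intro!: eq_matI simp del: index_mult_mat(1))
  also have "\<dots> = x" using iso by (simp add: mat_expand)
  finally show "a\<^sup>\<dagger> * (a * x + b * y) + c\<^sup>\<dagger> * (c * x + d * y) = x" .
  have "b\<^sup>\<dagger> * (a * x + b * y) + d\<^sup>\<dagger> * (c * x + d * y) =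
    (b\<^sup>\<dagger> * a + d\<^sup>\<dagger> * c) * x + (b\<^sup>\<dagger> * b + d\<^sup>\<dagger> * d) * y"
    by (simp add: mat_expand) (auto intro!: eq_matI simp del: index_mult_mat(1))
  also have "\<dots> = y" using iso by (simp add: mat_expand)
  finally show "b\<^sup>\<dagger> * (a * x + b * y) + d\<^sup>\<dagger> * (c * x + d * y) = y" .
qed

lemma unitary_block_adjoint:
  fixes a b c d :: "complex mat"
  assumes "a \<in> carrier_mat p p" "b \<in> carrier_mat p n" "c \<in> carrier_mat n p" "d \<in> carrier_mat n n"
    and u: "unitary_mat (four_block_mat a b c d)"
  shows "unitary_mat (four_block_mat (a\<^sup>\<dagger>) (c\<^sup>\<dagger>) (b\<^sup>\<dagger>) (d\<^sup>\<dagger>))"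
proof -
  note [simp] = assms(1-4)[THEN carrier_matD(1)] assms(1-4)[THEN carrier_matD(2)]
  have "four_block_mat a b c d \<in> carrier_mat (p + n) (p + n)" by (rule carrier_matI) simp_all
  from unitary_matD[OF u this] this have "unitary_mat ((four_block_mat a b c d)\<^sup>\<dagger>)"
    by (intro unitary_matI[of _ "p + n"]) simp_all
  then show ?thesis by (simp add: adjoint_four_block)
qed

text \<open>The block columns are \<open>[I; -V*]\<close> and \<open>[V; I]\<close>, which are orthogonal to each other, normalized by the
inverse square roots of their Gram matrices.\<close>

lemma halmos_unitary:
  fixes V :: "complex mat"
  assumes V: "V \<in> carrier_mat p n"
  shows "unitary_mat (four_block_mat
    (mat_isqrt (1\<^sub>m p + V * V\<^sup>\<dagger>)) (V * mat_isqrt (1\<^sub>m n + V\<^sup>\<dagger> * V))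
    (- (V\<^sup>\<dagger> * mat_isqrt (1\<^sub>m p + V * V\<^sup>\<dagger>))) (mat_isqrt (1\<^sub>m n + V\<^sup>\<dagger> * V)))"
proof -
  note [simp] = carrier_matD[OF V]
  define M where "M = 1\<^sub>m p + V * V\<^sup>\<dagger>"
  define N where "N = 1\<^sub>m n + V\<^sup>\<dagger> * V"
  have M: "M \<in> carrier_mat p p" "pos_def M"
    using pos_def_one_plus_gram[OF adjoint_carrier[OF V]] by (simp_all only: M_def adjoint_adjoint)
  have N: "N \<in> carrier_mat n n" "pos_def N"
    using pos_def_one_plus_gram[OF V] by (simp_all only: N_def)
  note m = mat_isqrt_works[OF M] and n = mat_isqrt_works[OF N]
  note [simp] = carrier_matD[OF m(1)] carrier_matD[OF n(1)] m(2) n(2)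
  let ?m = "mat_isqrt M" and ?n = "mat_isqrt N"
  have "unitary_mat (four_block_mat ?m (V * ?n) (- (V\<^sup>\<dagger> * ?m)) ?n)"
  proof (subst unitary_four_block_iff)
    have M_mult: "M * F = F + V * (V\<^sup>\<dagger> * F)" if "dim_row F = p" for F
      using that by (simp add: M_def mat_expand)
    have N_mult: "N * F = V\<^sup>\<dagger> * (V * F) + F" if "dim_row F = n" for F
      using that by (simp add: N_def mat_expand) (auto intro!: eq_matI simp del: index_mult_mat(1))
    have "?m * ?m + ?m * (V * (V\<^sup>\<dagger> * ?m)) = 1\<^sub>m p"
      using m(3) by (simp add: M_mult mat_expand)
    moreover have "?n * (V\<^sup>\<dagger> * (V * ?n)) + ?n * ?n = 1\<^sub>m n"
      using n(3) by (simp add: N_mult mat_expand)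
    moreover have "?m * (V * ?n) + - (?m * (V * ?n)) = 0\<^sub>m p n" "?n * (V\<^sup>\<dagger> * ?m) + - (?n * (V\<^sup>\<dagger> * ?m)) = 0\<^sub>m n p"
      by (auto intro!: eq_matI simp del: index_mult_mat(1))
    ultimately show "?m\<^sup>\<dagger> * ?m + (- (V\<^sup>\<dagger> * ?m))\<^sup>\<dagger> * - (V\<^sup>\<dagger> * ?m) = 1\<^sub>m p \<and>
      ?m\<^sup>\<dagger> * (V * ?n) + (- (V\<^sup>\<dagger> * ?m))\<^sup>\<dagger> * ?n = 0\<^sub>m p n \<and>
      (V * ?n)\<^sup>\<dagger> * ?m + ?n\<^sup>\<dagger> * - (V\<^sup>\<dagger> * ?m) = 0\<^sub>m n p \<and>
      (V * ?n)\<^sup>\<dagger> * (V * ?n) + ?n\<^sup>\<dagger> * ?n = 1\<^sub>m n"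
      by (simp add: mat_expand)
  qed (simp_all add: carrier_mat_iff)
  then show ?thesis by (simp add: M_def N_def)
qed

text \<open>Block Gram-Schmidt for an invertible matrix \<open>M = [A1, A2; A3, A4]\<close> with inverse \<open>[B1, B2; B3, B4]\<close>, processing the
last block column first. Normalizing that column uses its Gram matrix \<open>K\<close>. The projection \<open>P = [P1; P3]\<close> of the
first block column onto the orthogonal complement of the last one has as Gram matrix the Schur complement of
\<open>K\<close> in \<open>M* M\<close>. The inverse of this complement is the upper left corner of \<open>(M* M)^{-1} = M^{-1} M^{-*}\<close>,
that is, \<open>Z = B1 B1* + B2 B2*\<close>.\<close>

lemma unitary_from_invertible:
  fixes A1 A2 A3 A4 B1 B2 B3 B4 :: "complex mat"
  assumes A: "A1 \<in> carrier_mat p p" "A2 \<in> carrier_mat p n" "A3 \<in> carrier_mat n p" "A4 \<in> carrier_mat n n"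
    and B: "B1 \<in> carrier_mat p p" "B2 \<in> carrier_mat p n" "B3 \<in> carrier_mat n p" "B4 \<in> carrier_mat n n"
    and inv: "B1 * A1 + B2 * A3 = 1\<^sub>m p" "B1 * A2 + B2 * A4 = 0\<^sub>m p n"
      "B3 * A1 + B4 * A3 = 0\<^sub>m n p" "B3 * A2 + B4 * A4 = 1\<^sub>m n"
  defines "K \<equiv> A2\<^sup>\<dagger> * A2 + A4\<^sup>\<dagger> * A4" and "L \<equiv> A2\<^sup>\<dagger> * A1 + A4\<^sup>\<dagger> * A3"
    and "Z \<equiv> B1 * B1\<^sup>\<dagger> + B2 * B2\<^sup>\<dagger>"
  shows "unitary_mat (four_block_mat A1 A2 A3 A4 *
    four_block_mat (mat_sqrt Z) (0\<^sub>m p n) (- (minv K * L * mat_sqrt Z)) (mat_isqrt K))"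
proof -
  note [simp] = A[THEN carrier_matD(1)] A[THEN carrier_matD(2)] B[THEN carrier_matD(1)] B[THEN carrier_matD(2)]
  have K: "K \<in> carrier_mat n n" "pos_def K"
    unfolding K_def using pos_def_gram_sum[OF A(2,4) B(3,4) inv(4)] by (auto simp: carrier_mat_iff)
  have L: "L \<in> carrier_mat n p" by (simp add: L_def carrier_mat_iff)
  have Z: "Z \<in> carrier_mat p p" "pos_def Z"
  proof -
    have "(B1 * A1 + B2 * A3)\<^sup>\<dagger> = 1\<^sub>m p" using inv(1) by simp
    then have "A1\<^sup>\<dagger> * B1\<^sup>\<dagger> + A3\<^sup>\<dagger> * B2\<^sup>\<dagger> = 1\<^sub>m p" by (simp add: mat_expand)
    then show "pos_def Z"
      using pos_def_gram_sum[of "B1\<^sup>\<dagger>" p p "B2\<^sup>\<dagger>" n "A1\<^sup>\<dagger>" "A3\<^sup>\<dagger>"] by (simp add: Z_def carrier_mat_iff)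
  qed (simp add: Z_def carrier_mat_iff)
  note Ki = minv_works[OF K(1) pos_def_det[OF K]]
  note k = mat_isqrt_works[OF K] and z = mat_sqrt_works[OF Z]
  note [simp] = carrier_matD[OF K(1)] carrier_matD[OF L] carrier_matD[OF Z(1)] carrier_matD[OF Ki(1)]
    carrier_matD[OF k(1)] carrier_matD[OF z(1)] k(2) z(4)
  define P1 where "P1 = A1 - A2 * (minv K * L)"
  define P3 where "P3 = A3 - A4 * (minv K * L)"
  have [simp]: "dim_row P1 = p" "dim_col P1 = p" "dim_row P3 = n" "dim_col P3 = p"
    by (simp_all add: P1_def P3_def)
  have K_mult: "K * F = A2\<^sup>\<dagger> * (A2 * F) + A4\<^sup>\<dagger> * (A4 * F)" if "dim_row F = n" for F
    using that by (simp add: K_def mat_expand)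
  have orth: "A2\<^sup>\<dagger> * P1 + A4\<^sup>\<dagger> * P3 = 0\<^sub>m n p"
  proof -
    have "A2\<^sup>\<dagger> * P1 + A4\<^sup>\<dagger> * P3 = L - K * (minv K * L)"
      unfolding P1_def P3_def by (simp add: K_mult mat_expand) (auto intro!: eq_matI simp: L_def simp del: index_mult_mat(1))
    also have "\<dots> = 0\<^sub>m n p" by (simp add: left_cancel_dim[OF Ki(2)]) (auto intro!: eq_matI)
    finally show ?thesis .
  qed
  have orth': "P1\<^sup>\<dagger> * A2 + P3\<^sup>\<dagger> * A4 = 0\<^sub>m p n"
    using arg_cong[OF orth, of mat_adjoint] by (simp add: mat_expand)
  define S where "S = A1\<^sup>\<dagger> * P1 + A3\<^sup>\<dagger> * P3"
  have [simp]: "dim_row S = p" "dim_col S = p" by (simp_all add: S_def)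
  have inv': "four_block_mat A1 A2 A3 A4 * four_block_mat B1 B2 B3 B4 = 1\<^sub>m (p + n)"
    by (rule mat_inverse_right) (simp_all add: carrier_mat_iff four_block_mult_dim inv)
  \<comment> \<open>The second block row of \<open>M* P\<close> is zero, so \<open>P\<close> is \<open>M^{-*}\<close> applied to \<open>[S; 0]\<close>.\<close>
  have P: "P1 = B1\<^sup>\<dagger> * S" "P3 = B2\<^sup>\<dagger> * S"
  proof -
    have "four_block_mat (A1 * B1 + A2 * B3) (A1 * B2 + A2 * B4) (A3 * B1 + A4 * B3) (A3 * B2 + A4 * B4) =
      four_block_mat (1\<^sub>m p) (0\<^sub>m p n) (0\<^sub>m n p) (1\<^sub>m n)"
      using inv' by (simp add: four_block_mult_dim)
    note r = four_block_eqD[OF this, of p n, simplified carrier_mat_iff, simplified]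
    have r': "B1\<^sup>\<dagger> * A1\<^sup>\<dagger> + B3\<^sup>\<dagger> * A2\<^sup>\<dagger> = 1\<^sub>m p" "B2\<^sup>\<dagger> * A1\<^sup>\<dagger> + B4\<^sup>\<dagger> * A2\<^sup>\<dagger> = 0\<^sub>m n p"
      "B1\<^sup>\<dagger> * A3\<^sup>\<dagger> + B3\<^sup>\<dagger> * A4\<^sup>\<dagger> = 0\<^sub>m p n" "B2\<^sup>\<dagger> * A3\<^sup>\<dagger> + B4\<^sup>\<dagger> * A4\<^sup>\<dagger> = 1\<^sub>m n"
      using r[THEN arg_cong[of _ _ mat_adjoint]] by (simp_all add: mat_expand)
    have "B1\<^sup>\<dagger> * S + B3\<^sup>\<dagger> * (A2\<^sup>\<dagger> * P1 + A4\<^sup>\<dagger> * P3) =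
      (B1\<^sup>\<dagger> * A1\<^sup>\<dagger> + B3\<^sup>\<dagger> * A2\<^sup>\<dagger>) * P1 + (B1\<^sup>\<dagger> * A3\<^sup>\<dagger> + B3\<^sup>\<dagger> * A4\<^sup>\<dagger>) * P3"
      by (simp add: S_def mat_expand) (auto intro!: eq_matI simp del: index_mult_mat(1))
    then show "P1 = B1\<^sup>\<dagger> * S" unfolding orth r' by (simp add: mat_expand)
    have "B2\<^sup>\<dagger> * S + B4\<^sup>\<dagger> * (A2\<^sup>\<dagger> * P1 + A4\<^sup>\<dagger> * P3) =
      (B2\<^sup>\<dagger> * A1\<^sup>\<dagger> + B4\<^sup>\<dagger> * A2\<^sup>\<dagger>) * P1 + (B2\<^sup>\<dagger> * A3\<^sup>\<dagger> + B4\<^sup>\<dagger> * A4\<^sup>\<dagger>) * P3"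
      by (simp add: S_def mat_expand) (auto intro!: eq_matI simp del: index_mult_mat(1))
    then show "P3 = B2\<^sup>\<dagger> * S" unfolding orth r' by (simp add: mat_expand)
  qed
  have "Z * S = B1 * (B1\<^sup>\<dagger> * S) + B2 * (B2\<^sup>\<dagger> * S)" by (simp add: Z_def mat_expand)
  also have "\<dots> = B1 * P1 + B2 * P3" by (simp add: P[symmetric])
  also have "\<dots> = (B1 * A1 + B2 * A3) - (B1 * A2 + B2 * A4) * (minv K * L)"
    by (simp add: P1_def P3_def mat_expand) (auto intro!: eq_matI simp del: index_mult_mat(1))
  also have "\<dots> = 1\<^sub>m p" unfolding inv by (simp add: zero_mult_dim) (auto intro!: eq_matI)
  finally have ZS: "Z * S = 1\<^sub>m p" .
  have sZ: "mat_sqrt Z * (S * mat_sqrt Z) = 1\<^sub>m p"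
  proof -
    have "mat_sqrt Z * (mat_sqrt Z * S) = (mat_sqrt Z * mat_sqrt Z) * S" by (simp add: mult_assoc_dim)
    also have "\<dots> = 1\<^sub>m p" by (simp only: z(3) ZS)
    finally have "(mat_sqrt Z * S) * mat_sqrt Z = 1\<^sub>m p"
      using mat_inverse_right[of "mat_sqrt Z" p "mat_sqrt Z * S"] by (simp add: carrier_mat_iff)
    then show ?thesis by (simp add: mult_assoc_dim)
  qed
  have gram: "P1\<^sup>\<dagger> * P1 + P3\<^sup>\<dagger> * P3 = S"
  proof -
    have "S = (P1 + A2 * (minv K * L))\<^sup>\<dagger> * P1 + (P3 + A4 * (minv K * L))\<^sup>\<dagger> * P3"
    proof -
      have "A1 = P1 + A2 * (minv K * L)" "A3 = P3 + A4 * (minv K * L)"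
        unfolding P1_def P3_def by (auto intro!: eq_matI simp del: index_mult_mat(1))
      then show ?thesis by (simp add: S_def)
    qed
    also have "\<dots> = P1\<^sup>\<dagger> * P1 + P3\<^sup>\<dagger> * P3 + (minv K * L)\<^sup>\<dagger> * (A2\<^sup>\<dagger> * P1 + A4\<^sup>\<dagger> * P3)"
      by (simp add: mat_expand) (auto intro!: eq_matI simp del: index_mult_mat(1))
    finally show ?thesis unfolding orth by (simp add: mat_expand)
  qed
  let ?z = "mat_sqrt Z" and ?k = "mat_isqrt K"
  have eq: "four_block_mat A1 A2 A3 A4 * four_block_mat ?z (0\<^sub>m p n) (- (minv K * L * ?z)) ?k =
    four_block_mat (P1 * ?z) (A2 * ?k) (P3 * ?z) (A4 * ?k)"
  proof -
    have "A1 * ?z + A2 * - (minv K * L * ?z) = P1 * ?z" "A3 * ?z + A4 * - (minv K * L * ?z) = P3 * ?z"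
      by (simp_all add: P1_def P3_def mat_expand) (auto intro!: eq_matI simp del: index_mult_mat(1))
    then show ?thesis by (simp add: four_block_mult_dim zero_mult_dim zero_add_dim)
  qed
  show ?thesis
    unfolding eq
  proof (subst unitary_four_block_iff)
    have "?z * ((P1\<^sup>\<dagger> * P1 + P3\<^sup>\<dagger> * P3) * ?z) = 1\<^sub>m p" using sZ gram by simp
    moreover have "?z * (P1\<^sup>\<dagger> * A2 + P3\<^sup>\<dagger> * A4) * ?k = 0\<^sub>m p n" by (simp add: orth' mat_expand)
    moreover have "?k * (A2\<^sup>\<dagger> * P1 + A4\<^sup>\<dagger> * P3) * ?z = 0\<^sub>m n p" by (simp add: orth mat_expand)
    moreover have "?k * ((A2\<^sup>\<dagger> * A2 + A4\<^sup>\<dagger> * A4) * ?k) = 1\<^sub>m n" using k(3) by (simp only: K_def)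
    ultimately show "(P1 * ?z)\<^sup>\<dagger> * (P1 * ?z) + (P3 * ?z)\<^sup>\<dagger> * (P3 * ?z) = 1\<^sub>m p \<and>
      (P1 * ?z)\<^sup>\<dagger> * (A2 * ?k) + (P3 * ?z)\<^sup>\<dagger> * (A4 * ?k) = 0\<^sub>m p n \<and>
      (A2 * ?k)\<^sup>\<dagger> * (P1 * ?z) + (A4 * ?k)\<^sup>\<dagger> * (P3 * ?z) = 0\<^sub>m n p \<and>
      (A2 * ?k)\<^sup>\<dagger> * (A2 * ?k) + (A4 * ?k)\<^sup>\<dagger> * (A4 * ?k) = 1\<^sub>m n"
      by (simp add: mat_expand)
  qed (simp_all add: carrier_mat_iff)
qed

text \<open>The unitary matrices \<open>Uh = [H1, F2; H3, F4]\<close> and \<open>R Vh = [E1, F2; E3, F4]\<close> share their last block column. Hence the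
last block column of \<open>Uh* R Vh\<close> is \<open>[0; I]\<close>; orthogonality of the columns of \<open>R Vh\<close> kills the lower left block.\<close>

lemma unitary_block_factorization:
  fixes R Vh H1 H3 E1 E3 F2 F4 :: "complex mat"
  assumes R: "R \<in> carrier_mat (p + n) (p + n)" "unitary_mat R"
    and Vh: "Vh \<in> carrier_mat (p + n) (p + n)" "unitary_mat Vh"
    and c: "H1 \<in> carrier_mat p p" "H3 \<in> carrier_mat n p" "E1 \<in> carrier_mat p p" "E3 \<in> carrier_mat n p"
      "F2 \<in> carrier_mat p n" "F4 \<in> carrier_mat n n"
    and Uh: "unitary_mat (four_block_mat H1 F2 H3 F4)"
    and RV: "R * Vh = four_block_mat E1 F2 E3 F4"
  shows "\<exists>G0 \<in> unitary_group p. R = four_block_mat H1 F2 H3 F4 *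
    four_block_mat G0 (0\<^sub>m p n) (0\<^sub>m n p) (1\<^sub>m n) * Vh\<^sup>\<dagger>"
proof -
  let ?U = "four_block_mat H1 F2 H3 F4" and ?E = "four_block_mat E1 F2 E3 F4"
  note [simp] = c[THEN carrier_matD(1)] c[THEN carrier_matD(2)] carrier_matD[OF R(1)] carrier_matD[OF Vh(1)]
  have Uc: "?U \<in> carrier_mat (p + n) (p + n)" by (simp add: carrier_mat_iff)
  note uR = unitary_matD[OF R(2,1)] and uV = unitary_matD[OF Vh(2,1)] and uU = unitary_matD[OF Uh Uc]
  have uE: "unitary_mat ?E"
    unfolding RV[symmetric]
    by (rule unitary_matI[of _ "p + n"]) (simp_all add: carrier_mat_iff mat_expand left_cancel_dim[OF uR(1)] uV)
  note e = uE[unfolded unitary_four_block_iff[OF c(3,5,4,6)]]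
  note u = Uh[unfolded unitary_four_block_iff[OF c(1,5,2,6)]]
  define G0 where "G0 = H1\<^sup>\<dagger> * E1 + H3\<^sup>\<dagger> * E3"
  have G0: "G0 \<in> carrier_mat p p" by (simp add: G0_def carrier_mat_iff)
  note [simp] = carrier_matD[OF G0]
  let ?G = "four_block_mat G0 (0\<^sub>m p n) (0\<^sub>m n p) (1\<^sub>m n)"
  have UE: "?U\<^sup>\<dagger> * ?E = ?G"
    using e u by (simp add: adjoint_four_block four_block_mult_dim G0_def)
  have "unitary_mat ?G"
  proof (rule unitary_matI[of _ "p + n"])
    have Ec: "?E \<in> carrier_mat (p + n) (p + n)" by (simp add: carrier_mat_iff)
    have "?G\<^sup>\<dagger> * ?G = ?E\<^sup>\<dagger> * (?U * (?U\<^sup>\<dagger> * ?E))"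
      unfolding UE[symmetric] by (simp add: mat_expand)
    also have "\<dots> = 1\<^sub>m (p + n)"
      by (simp add: left_cancel_dim[OF uU(2)] unitary_matD(1)[OF uE Ec])
    finally show "?G\<^sup>\<dagger> * ?G = 1\<^sub>m (p + n)" .
  qed (simp add: carrier_mat_iff)
  then have "G0\<^sup>\<dagger> * G0 = 1\<^sub>m p"
    using unitary_four_block_iff[OF G0, of "0\<^sub>m p n" n "0\<^sub>m n p" "1\<^sub>m n"]
    by (simp add: carrier_mat_iff zero_mult_dim zero_add_dim)
  then have "G0 \<in> unitary_group p" using G0 unitary_matI[OF G0] by (simp add: unitary_group_def)
  moreover have "R = ?U * ?G * Vh\<^sup>\<dagger>"
  proof -
    have "?U * (?U\<^sup>\<dagger> * ?E) * Vh\<^sup>\<dagger> = R"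
      unfolding RV[symmetric]
      by (simp add: mult_assoc_dim uV left_cancel_dim[OF uU(2)] one_mult_dim)
    then show ?thesis unfolding UE by simp
  qed
  ultimately show ?thesis by blast
qed

text \<open>The Cayley-type completion of the isometry \<open>[U; W]\<close>. All three relations reduce to the identity
\<open>U* U + W* W = I\<close> and to the cancellation of \<open>I - W\<close> against its inverse.\<close>

lemma isometry_completion:
  fixes U W :: "complex mat"
  assumes U: "U \<in> carrier_mat p n" and W: "W \<in> carrier_mat n n"
    and iso: "U\<^sup>\<dagger> * U + W\<^sup>\<dagger> * W = 1\<^sub>m n" and det: "det (1\<^sub>m n - W) \<noteq> 0"
  defines "X \<equiv> 1\<^sub>m p - U * minv (1\<^sub>m n - W\<^sup>\<dagger>) * U\<^sup>\<dagger>"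
    and "Y \<equiv> (1\<^sub>m n - W) * minv (1\<^sub>m n - W\<^sup>\<dagger>) * U\<^sup>\<dagger>"
  shows "X\<^sup>\<dagger> * X + Y\<^sup>\<dagger> * Y = 1\<^sub>m p" "U\<^sup>\<dagger> * X + W\<^sup>\<dagger> * Y = 0\<^sub>m n p" "X\<^sup>\<dagger> * U + Y\<^sup>\<dagger> * W = 0\<^sub>m p n"
    "X \<in> carrier_mat p p" "Y \<in> carrier_mat n p"
proof -
  note [simp] = carrier_matD[OF U] carrier_matD[OF W]
  have c: "1\<^sub>m n - W \<in> carrier_mat n n" by (simp add: carrier_mat_iff)
  note j = minv_works[OF c det]
  define J where "J = minv (1\<^sub>m n - W)"
  have J[simp]: "dim_row J = n" "dim_col J = n" using j by (auto simp: J_def)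
  have "minv (1\<^sub>m n - W\<^sup>\<dagger>) = J\<^sup>\<dagger>"
    using adjoint_minv[OF c det] by (simp add: J_def adjoint_minus)
  then have X: "X = 1\<^sub>m p - U * (J\<^sup>\<dagger> * U\<^sup>\<dagger>)" and Y: "Y = (1\<^sub>m n - W) * (J\<^sup>\<dagger> * U\<^sup>\<dagger>)"
    by (simp_all add: X_def Y_def mult_assoc_dim)
  have J1: "J * (1\<^sub>m n - W) = 1\<^sub>m n" using j by (simp add: J_def)
  have JJ: "(1\<^sub>m n - W\<^sup>\<dagger>) * J\<^sup>\<dagger> = 1\<^sub>m n"
    using arg_cong[OF J1, of mat_adjoint] by (simp add: adjoint_mult adjoint_minus)
  show "X \<in> carrier_mat p p" "Y \<in> carrier_mat n p" by (simp_all add: X Y carrier_mat_iff)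
  show UX: "U\<^sup>\<dagger> * X + W\<^sup>\<dagger> * Y = 0\<^sub>m n p"
  proof -
    have "U\<^sup>\<dagger> * X + W\<^sup>\<dagger> * Y = (1\<^sub>m n - (U\<^sup>\<dagger> * U + W\<^sup>\<dagger> * W) * J\<^sup>\<dagger> + W\<^sup>\<dagger> * J\<^sup>\<dagger>) * U\<^sup>\<dagger>"
      unfolding X Y by (simp add: mat_expand) (auto intro!: eq_matI simp del: index_mult_mat(1))
    also have "\<dots> = (1\<^sub>m n - (1\<^sub>m n - W\<^sup>\<dagger>) * J\<^sup>\<dagger>) * U\<^sup>\<dagger>"
      unfolding iso by (simp add: mat_expand) (auto intro!: eq_matI simp del: index_mult_mat(1))
    also have "\<dots> = 0\<^sub>m n p" unfolding JJ by (simp add: mat_expand) (auto intro!: eq_matI simp del: index_mult_mat(1))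
    finally show ?thesis .
  qed
  have [simp]: "dim_row X = p" "dim_col X = p" "dim_row Y = n" "dim_col Y = p" by (simp_all add: X Y)
  show "X\<^sup>\<dagger> * U + Y\<^sup>\<dagger> * W = 0\<^sub>m p n"
    using arg_cong[OF UX, of mat_adjoint] by (simp add: mat_expand)
  show "X\<^sup>\<dagger> * X + Y\<^sup>\<dagger> * Y = 1\<^sub>m p"
  proof -
    have "X\<^sup>\<dagger> * X + Y\<^sup>\<dagger> * Y = X - U * (J * (U\<^sup>\<dagger> * X + W\<^sup>\<dagger> * Y)) + U * (J * Y)"
      by (subst (1) X, subst (1) Y, simp add: mat_expand) (auto intro!: eq_matI simp del: index_mult_mat(1))
    also have "\<dots> = X + U * (J * Y)" unfolding UX by (auto intro!: eq_matI simp: mat_expand simp del: index_mult_mat(1))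
    also have "J * Y = J\<^sup>\<dagger> * U\<^sup>\<dagger>" unfolding Y by (rule left_cancel_dim[OF J1]) auto
    also have "X + U * (J\<^sup>\<dagger> * U\<^sup>\<dagger>) = 1\<^sub>m p" unfolding X by (auto intro!: eq_matI simp del: index_mult_mat(1))
    finally show ?thesis .
  qed
qed

section \<open>Stein equations\<close>

lemma pow_mat_Suc_left:
  fixes A :: "complex mat"
  assumes A: "A \<in> carrier_mat n n"
  shows "A ^\<^sub>m Suc k = A * A ^\<^sub>m k"
proof (induction k)
  case (Suc k)
  have "A ^\<^sub>m Suc (Suc k) = A * A ^\<^sub>m k * A" using Suc by simp
  also have "\<dots> = A * (A ^\<^sub>m k * A)"
    by (rule assoc_mult_mat[OF A _ A]) (use A in simp)
  finally show ?case by simp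
qed (use A in simp)

lemma pow_mat_adjoint:
  fixes A :: "complex mat"
  assumes A: "A \<in> carrier_mat n n"
  shows "(A\<^sup>\<dagger>) ^\<^sub>m k = (A ^\<^sub>m k)\<^sup>\<dagger>"
proof (induction k)
  case (Suc k)
  have "(A ^\<^sub>m Suc k)\<^sup>\<dagger> = A\<^sup>\<dagger> * (A ^\<^sub>m k)\<^sup>\<dagger>" using A by (simp add: adjoint_mult)
  then show ?case
    unfolding Suc[symmetric] using pow_mat_Suc_left[of "A\<^sup>\<dagger>" n k] A by simp
qed (use A in simp)

lemma pow_mat_smult:
  fixes A :: "complex mat"
  assumes A: "A \<in> carrier_mat n n"
  shows "(c \<cdot>\<^sub>m A) ^\<^sub>m k = c ^ k \<cdot>\<^sub>m (A ^\<^sub>m k)"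
proof (induction k)
  case (Suc k)
  note [simp] = carrier_matD[OF A] carrier_matD[OF pow_carrier_mat[OF A]]
  show ?case by (simp add: Suc smult_mult_dim) (auto intro!: eq_matI simp: mult_ac simp del: index_mult_mat(1))
qed (use A in auto)

text \<open>Choose \<open>r\<close> strictly between the spectral radius of \<open>W\<close> and one. Then \<open>W / r\<close> still has spectral radius below
one, so its powers are bounded, which is the claim for \<open>W\<close>.\<close>

lemma stable_powers_geometric:
  assumes W: "W \<in> carrier_mat n n" and stable: "stable W"
  obtains c r where "0 < r" "r < 1" "0 \<le> c"
    "\<And>k i j. i < n \<Longrightarrow> j < n \<Longrightarrow> cmod ((W ^\<^sub>m k) $$ (i, j)) \<le> c * r ^ k"
proof (cases "n = 0")
  case True
  then show ?thesis using that[of "1/2" 0] by simp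
next
  case False
  define s where "s = spectral_radius W"
  obtain e where e: "e \<in> spectrum W" "s = cmod e"
    using spectral_radius_mem_max(1)[OF W] False by (auto simp: s_def)
  have s: "0 \<le> s" "s < 1" using stable e by (auto simp: stable_def spectrum_def)
  define r where "r = (1 + s) / 2"
  have r: "0 < r" "r < 1" "s < r" using s by (auto simp: r_def)
  define W' where "W' = complex_of_real (1 / r) \<cdot>\<^sub>m W"
  have W': "W' \<in> carrier_mat n n" using W by (simp add: W'_def)
  have "spectral_radius W' < 1"
  proof -
    obtain k where k: "k \<in> spectrum W'" "spectral_radius W' = cmod k"
      using spectral_radius_mem_max(1)[OF W'] False by auto
    then obtain v where v: "v \<in> carrier_vec n" "v \<noteq> 0\<^sub>v n" "W' *\<^sub>v v = k \<cdot>\<^sub>v v"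
      using W' by (auto simp: spectrum_def eigenvalue_def eigenvector_def)
    have "W *\<^sub>v v = complex_of_real r \<cdot>\<^sub>v (W' *\<^sub>v v)"
      using W v(1) r by (intro eq_vecI) (auto simp: W'_def scalar_prod_def sum_distrib_left)
    then have "W *\<^sub>v v = (complex_of_real r * k) \<cdot>\<^sub>v v" using v by (simp add: smult_smult_assoc)
    then have "complex_of_real r * k \<in> spectrum W"
      using v W by (auto simp: spectrum_def eigenvalue_def eigenvector_def)
    then have "cmod (complex_of_real r * k) \<le> s"
      using spectral_radius_mem_max(2)[OF W] False by (auto simp: s_def)
    then have "r * cmod k \<le> s" using r by (simp add: norm_mult)
    then have "r * cmod k < r * 1" using r by linarith
    then show ?thesis using r(1) k(2) by (simp only: mult_less_cancel_left_pos)
  qed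
  from spectral_radius_jnf_norm_bound_less_1_upper_triangular[OF W' this]
  obtain c where c: "\<And>k. norm_bound (W' ^\<^sub>m k) c" by auto
  have WW: "W = complex_of_real r \<cdot>\<^sub>m W'"
    using r W by (auto simp: W'_def intro!: eq_matI)
  have "cmod ((W ^\<^sub>m k) $$ (i, j)) \<le> max c 0 * r ^ k" if "i < n" "j < n" for k i j
  proof -
    have "cmod ((W' ^\<^sub>m k) $$ (i, j)) \<le> max c 0"
      using c[of k] that carrier_matD[OF pow_carrier_mat[OF W', of k]] by (auto simp: norm_bound_def le_max_iff_disj simp del: pow_mat_dim)
    then have "r ^ k * cmod ((W' ^\<^sub>m k) $$ (i, j)) \<le> r ^ k * max c 0"
      using r by (intro mult_left_mono) auto
    moreover have "(W ^\<^sub>m k) $$ (i, j) = complex_of_real r ^ k * (W' ^\<^sub>m k) $$ (i, j)"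
      unfolding WW pow_mat_smult[OF W'] using that W' by (simp add: pow_mat_dim_square)
    ultimately show ?thesis using r by (simp add: norm_mult norm_power mult.commute)
  qed
  then show ?thesis using that[of r "max c 0"] r by simp
qed

text \<open>The lower right block of \<open>R R* = I\<close> for a unitary realization matrix makes \<open>A*\<close> a contraction.\<close>

lemma adjoint_contraction:
  fixes A B :: "complex mat"
  assumes A: "A \<in> carrier_mat n n" and B: "B \<in> carrier_mat n p" and iso: "B * B\<^sup>\<dagger> + A * A\<^sup>\<dagger> = 1\<^sub>m n"
    and v: "v \<in> carrier_vec n"
  shows "Re ((A\<^sup>\<dagger> *\<^sub>v v) \<bullet>c (A\<^sup>\<dagger> *\<^sub>v v)) \<le> Re (v \<bullet>c v)"
proof -
  note [simp] = carrier_matD[OF A] carrier_matD[OF B] carrier_vecD[OF v]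
  have BB: "B * B\<^sup>\<dagger> \<in> carrier_mat n n" and AA: "A * A\<^sup>\<dagger> \<in> carrier_mat n n" by (rule carrier_matI; simp)+
  have Bv: "B * B\<^sup>\<dagger> *\<^sub>v v \<in> carrier_vec n" and Av: "A * A\<^sup>\<dagger> *\<^sub>v v \<in> carrier_vec n" and cv: "conjugate v \<in> carrier_vec n"
    by (rule carrier_vecI; simp)+
  have "v = (B * B\<^sup>\<dagger> + A * A\<^sup>\<dagger>) *\<^sub>v v" unfolding iso using v by simp
  also have "\<dots> = B * B\<^sup>\<dagger> *\<^sub>v v + A * A\<^sup>\<dagger> *\<^sub>v v" by (rule add_mult_distrib_mat_vec[OF BB AA v])
  finally have "v \<bullet>c v = (B * B\<^sup>\<dagger> *\<^sub>v v + A * A\<^sup>\<dagger> *\<^sub>v v) \<bullet>c v" by simp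
  also have "\<dots> = (B * B\<^sup>\<dagger> *\<^sub>v v) \<bullet>c v + (A * A\<^sup>\<dagger> *\<^sub>v v) \<bullet>c v" by (rule add_scalar_prod_distrib[OF Bv Av cv])
  also have "\<dots> = (B\<^sup>\<dagger> *\<^sub>v v) \<bullet>c (B\<^sup>\<dagger> *\<^sub>v v) + (A\<^sup>\<dagger> *\<^sub>v v) \<bullet>c (A\<^sup>\<dagger> *\<^sub>v v)"
    using quadratic_form_gram[OF adjoint_carrier[OF A] v] quadratic_form_gram[OF adjoint_carrier[OF B] v] by (simp only: adjoint_adjoint)
  finally show ?thesis using Re_cscalar_self_nonneg[of "B\<^sup>\<dagger> *\<^sub>v v"] by simp
qed

lemma contraction_power_entries:
  fixes M :: "complex mat"
  assumes M: "M \<in> carrier_mat n n"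
    and contr: "\<And>v. v \<in> carrier_vec n \<Longrightarrow> Re ((M *\<^sub>v v) \<bullet>c (M *\<^sub>v v)) \<le> Re (v \<bullet>c v)"
    and ij: "i < n" "j < n"
  shows "cmod ((M ^\<^sub>m k) $$ (i, j)) \<le> 1"
proof -
  have Mk: "M ^\<^sub>m k \<in> carrier_mat n n" for k using M by simp
  have pow: "Re ((M ^\<^sub>m k *\<^sub>v v) \<bullet>c (M ^\<^sub>m k *\<^sub>v v)) \<le> Re (v \<bullet>c v)" if "v \<in> carrier_vec n" for v k
    using that
  proof (induction k arbitrary: v)
    case (Suc k)
    have "M ^\<^sub>m Suc k *\<^sub>v v = M ^\<^sub>m k *\<^sub>v (M *\<^sub>v v)"
      using assoc_mult_mat_vec[OF Mk M Suc.prems] by simp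
    moreover have "M *\<^sub>v v \<in> carrier_vec n" using M Suc.prems by simp
    ultimately show ?case using order.trans[OF Suc.IH contr[OF Suc.prems]] by (simp only:)
  qed (use M in simp)
  have e: "unit_vec n j \<in> carrier_vec n" by simp
  have col: "M ^\<^sub>m k *\<^sub>v unit_vec n j = col (M ^\<^sub>m k) j"
  proof (rule eq_vecI)
    fix l assume "l < dim_vec (col (M ^\<^sub>m k) j)"
    then have l: "l < n" using Mk[of k] by (simp only: dim_col carrier_matD)
    have "row (M ^\<^sub>m k) l \<bullet> unit_vec n j = row (M ^\<^sub>m k) l $ j"
      by (rule scalar_prod_right_unit) (use Mk[of k] l ij in auto)
    then show "(M ^\<^sub>m k *\<^sub>v unit_vec n j) $ l = col (M ^\<^sub>m k) j $ l"
      using l ij carrier_matD[OF Mk[of k]] by (simp del: pow_mat_dim)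
  qed (use carrier_matD[OF Mk[of k]] in \<open>simp del: pow_mat_dim\<close>)
  from ij have "(cmod (col (M ^\<^sub>m k) j $ i))\<^sup>2 \<le> (\<Sum>i<n. (cmod (col (M ^\<^sub>m k) j $ i))\<^sup>2)"
    by (intro member_le_sum) auto
  also have "\<dots> = Re (col (M ^\<^sub>m k) j \<bullet>c col (M ^\<^sub>m k) j)"
    by (rule Re_cscalar_self[symmetric]) (use carrier_matD[OF Mk[of k]] in \<open>simp add: carrier_vec_iff\<close>)
  also have "\<dots> \<le> Re (unit_vec n j \<bullet>c unit_vec n j)"
    using pow[OF e, of k] unfolding col .
  also have "\<dots> = 1"
  proof -
    have "Re (unit_vec n j \<bullet>c unit_vec n j) = (\<Sum>l<n. if l = j then 1 else 0)"
      unfolding Re_cscalar_self[OF e] by (rule sum.cong) (use ij in auto)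
    then show ?thesis using ij by simp
  qed
  finally have "(cmod ((M ^\<^sub>m k) $$ (i, j)))\<^sup>2 \<le> 1"
    using ij carrier_matD[OF Mk[of k]] by (simp del: pow_mat_dim)
  then show ?thesis by (simp add: abs_square_le_1)
qed

lemma sums_mult_mat:
  fixes M N :: "complex mat"
  assumes F: "\<And>k. F k \<in> carrier_mat n n" and X: "X \<in> carrier_mat n n"
    and M: "M \<in> carrier_mat n n" and N: "N \<in> carrier_mat n n"
    and sums: "\<And>i j. i < n \<Longrightarrow> j < n \<Longrightarrow> (\<lambda>k. F k $$ (i, j)) sums (X $$ (i, j))"
    and ij: "i < n" "j < n"
  shows "(\<lambda>k. (M * F k * N) $$ (i, j)) sums ((M * X * N) $$ (i, j))"
proof -
  have entry: "(M * Y * N) $$ (i, j) = (\<Sum>b<n. (\<Sum>a<n. M $$ (i, a) * Y $$ (a, b)) * N $$ (b, j))"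
    if "Y \<in> carrier_mat n n" for Y
    using that ij carrier_matD[OF M] carrier_matD[OF N]
    by (simp add: scalar_prod_def atLeast0LessThan)
  show ?thesis
    unfolding entry[OF F] entry[OF X]
    by (intro sums_sum sums_mult2 sums_mult sums) auto
qed

lemma sandwich_entry_bound:
  fixes M S N :: "complex mat"
  assumes M: "M \<in> carrier_mat n n" and S: "S \<in> carrier_mat n n" and N: "N \<in> carrier_mat n n"
    and Mb: "norm_bound M a" and Nb: "norm_bound N b" and Sb: "norm_bound S s"
    and ij: "i < n" "j < n"
  shows "cmod ((M * S * N) $$ (i, j)) \<le> a * s * real n * b * real n"
proof -
  have "norm_bound (M * S * N) (a * s * of_nat n * b * of_nat n)"
    by (rule norm_bound_mult[OF _ N norm_bound_mult[OF M S Mb Sb] Nb]) (rule mult_carrier_mat[OF M S])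
  then show ?thesis using ij M N by (auto simp: norm_bound_def)
qed

lemma stein_solution_rearranged:
  assumes X: "stein_solution n M N S X" and M: "M \<in> carrier_mat n n" and N: "N \<in> carrier_mat n n"
  shows "X = S + M * (X * N)"
proof -
  have Xc: "X \<in> carrier_mat n n" using X by (simp add: stein_solution_def)
  note [simp] = carrier_matD[OF M] carrier_matD[OF N] carrier_matD[OF Xc]
  have "S + M * (X * N) = (X - M * X * N) + M * X * N"
    using X by (simp add: stein_solution_def mult_assoc_dim)
  also have "\<dots> = X" by (auto intro!: eq_matI simp del: index_mult_mat(1))
  finally show ?thesis ..
qed

text \<open>The solution is the series of the terms \<open>M\<^sup>k S N\<^sup>k\<close>, which converges geometrically in every entry and
telescopes when it is inserted into the equation. A difference \<open>E\<close> of two solutions satisfies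
\<open>E = M\<^sup>k E N\<^sup>k\<close> for all \<open>k\<close>, and the right-hand side tends to zero.\<close>

lemma stein_solution_ex1:
  fixes M N S :: "complex mat"
  assumes M: "M \<in> carrier_mat n n" and N: "N \<in> carrier_mat n n" and S: "S \<in> carrier_mat n n"
    and Mb: "\<And>k i j. i < n \<Longrightarrow> j < n \<Longrightarrow> cmod ((M ^\<^sub>m k) $$ (i, j)) \<le> a"
    and Nb: "\<And>k i j. i < n \<Longrightarrow> j < n \<Longrightarrow> cmod ((N ^\<^sub>m k) $$ (i, j)) \<le> c * r ^ k"
    and r: "0 < r" "r < 1"
  shows "\<exists>!X. stein_solution n M N S X"
proof -
  have Mk: "M ^\<^sub>m k \<in> carrier_mat n n" and Nk: "N ^\<^sub>m k \<in> carrier_mat n n" for k using M N by auto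
  note [simp] = carrier_matD[OF M] carrier_matD[OF N] carrier_matD[OF S] carrier_matD[OF Mk] carrier_matD[OF Nk]
  define T where "T X k = M ^\<^sub>m k * X * N ^\<^sub>m k" for X k
  have Tc: "T X k \<in> carrier_mat n n" for X k by (rule carrier_matI) (simp_all add: T_def)
  have TSuc: "T X (Suc k) = M * T X k * N" if "X \<in> carrier_mat n n" for X k
    using carrier_matD[OF that]
    unfolding T_def pow_mat_Suc_left[OF M] by (simp add: mult_assoc_dim)
  have Mnb: "norm_bound (M ^\<^sub>m k) a" and Nnb: "norm_bound (N ^\<^sub>m k) (c * r ^ k)" for k
    using Mb Nb by (simp_all only: norm_bound_def carrier_matD[OF Mk] carrier_matD[OF Nk]) blast+
  have geo: "\<exists>K. \<forall>k i j. i < n \<longrightarrow> j < n \<longrightarrow> cmod (T X k $$ (i, j)) \<le> K * r ^ k"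
    if X: "X \<in> carrier_mat n n" for X
  proof -
    obtain s where s: "norm_bound X s" using norm_bound_max by blast
    have "cmod (T X k $$ (i, j)) \<le> a * s * real n * (c * r ^ k) * real n" if "i < n" "j < n" for k i j
      unfolding T_def
      by (rule sandwich_entry_bound[OF Mk X Nk Mnb Nnb s that])
    then show ?thesis by (intro exI[of _ "a * s * real n * c * real n"]) (simp add: mult_ac)
  qed
  obtain K where K: "\<And>k i j. i < n \<Longrightarrow> j < n \<Longrightarrow> cmod (T S k $$ (i, j)) \<le> K * r ^ k"
    using geo[OF S] by blast
  have summ: "summable (\<lambda>k. T S k $$ (i, j))" if "i < n" "j < n" for i j
    by (rule summable_comparison_test[of _ "\<lambda>k. K * r ^ k"])
      (use K[OF that] r in \<open>auto intro!: summable_mult summable_geometric\<close>)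
  define X where "X = mat n n (\<lambda>(i, j). \<Sum>k. T S k $$ (i, j))"
  have X: "X \<in> carrier_mat n n" by (simp add: X_def)
  note [simp] = carrier_matD[OF X]
  have sums: "(\<lambda>k. T S k $$ (i, j)) sums (X $$ (i, j))" if "i < n" "j < n" for i j
    using summable_sums[OF summ[OF that]] that by (simp add: X_def)
  have sol: "stein_solution n M N S X"
    unfolding stein_solution_def
  proof (intro conjI X eq_matI)
    fix i j assume "i < dim_row S" "j < dim_col S"
    then have ij: "i < n" "j < n" by auto
    have "(\<lambda>k. T S (Suc k) $$ (i, j)) sums ((M * X * N) $$ (i, j))"
      unfolding TSuc[OF S] by (rule sums_mult_mat[OF Tc X M N sums ij])
    moreover have "(\<lambda>k. T S (Suc k) $$ (i, j)) sums (X $$ (i, j) - T S 0 $$ (i, j))"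
      using sums[OF ij] by (subst sums_Suc_iff) simp
    ultimately have "(M * X * N) $$ (i, j) = X $$ (i, j) - T S 0 $$ (i, j)" by (rule sums_unique2)
    moreover have "T S 0 = S" by (simp add: T_def one_mult_dim)
    ultimately show "(X - M * X * N) $$ (i, j) = S $$ (i, j)" using ij by (simp del: index_mult_mat(1))
  qed auto
  have unique: "Y = X" if Y: "stein_solution n M N S Y" for Y
  proof -
    have Yc: "Y \<in> carrier_mat n n" using Y by (simp add: stein_solution_def)
    note [simp] = carrier_matD[OF Yc]
    define E where "E = Y - X"
    have E: "E \<in> carrier_mat n n" by (simp add: E_def carrier_mat_iff)
    have fixE: "M * E * N = E"
    proof -
      have "Y - M * Y * N = X - M * X * N" using Y sol by (simp add: stein_solution_def)
      then have e0: "(Y - M * Y * N) $$ (i, j) = (X - M * X * N) $$ (i, j)" for i j by (rule arg_cong)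
      have e: "Y $$ (i, j) - (M * Y * N) $$ (i, j) = X $$ (i, j) - (M * X * N) $$ (i, j)"
        if "i < n" "j < n" for i j
        using e0[of i j] that by (simp del: index_mult_mat(1))
      have swap: "b - d = a - c" if "a - b = c - d" for a b c d :: complex
      proof -
        have "b - d = b - d + ((a - b) - (c - d))" using that by simp
        also have "\<dots> = a - c" by simp
        finally show ?thesis .
      qed
      have "M * Y * N - M * X * N = Y - X"
      proof (rule eq_matI)
        fix i j assume "i < dim_row (Y - X)" "j < dim_col (Y - X)"
        then show "(M * Y * N - M * X * N) $$ (i, j) = (Y - X) $$ (i, j)"
          using swap[OF e[of i j]] by (simp del: index_mult_mat(1))
      qed auto
      then show ?thesis by (simp add: E_def mult_minus_dim minus_mult_dim)
    qed
    have T0: "T E k = E" for k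
    proof (induction k)
      case 0
      then show ?case using carrier_matD[OF E] by (simp add: T_def one_mult_dim)
    qed (simp add: TSuc[OF E] fixE)
    obtain K where K: "\<And>k i j. i < n \<Longrightarrow> j < n \<Longrightarrow> cmod (T E k $$ (i, j)) \<le> K * r ^ k"
      using geo[OF E] by blast
    have "E $$ (i, j) = 0" if "i < n" "j < n" for i j
    proof -
      have "(\<lambda>k. K * r ^ k) \<longlonglongrightarrow> K * 0"
        using r by (intro tendsto_mult tendsto_const LIMSEQ_realpow_zero) auto
      then have "cmod (E $$ (i, j)) \<le> 0"
        using K[OF that] unfolding T0 by (intro LIMSEQ_le_const[of "\<lambda>k. K * r ^ k" 0]) auto
      then show ?thesis by simp
    qed
    then have "Y - X = 0\<^sub>m n n" using carrier_matD[OF E] by (intro eq_matI) (auto simp: E_def)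
    then show ?thesis by (rule eq_mat_diffI) auto
  qed
  from sol unique show ?thesis by blast
qed

section \<open>Matrix-valued functions and their integrals over the unit circle\<close>

definition mat_holomorphic_on :: "(complex \<Rightarrow> complex mat) \<Rightarrow> nat \<Rightarrow> nat \<Rightarrow> complex set \<Rightarrow> bool" where
  "mat_holomorphic_on M m n S \<longleftrightarrow> (\<forall>z \<in> S. M z \<in> carrier_mat m n) \<and>
     (\<forall>i<m. \<forall>j<n. (\<lambda>z. M z $$ (i, j)) holomorphic_on S)"

definition mat_continuous_on :: "(complex \<Rightarrow> complex mat) \<Rightarrow> nat \<Rightarrow> nat \<Rightarrow> complex set \<Rightarrow> bool" where
  "mat_continuous_on M m n S \<longleftrightarrow> (\<forall>z \<in> S. M z \<in> carrier_mat m n) \<and>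
     (\<forall>i<m. \<forall>j<n. continuous_on S (\<lambda>z. M z $$ (i, j)))"

lemma mat_holomorphic_imp_continuous:
  "mat_holomorphic_on M m n S \<Longrightarrow> mat_continuous_on M m n S"
  by (auto simp: mat_holomorphic_on_def mat_continuous_on_def holomorphic_on_imp_continuous_on)

lemma mat_continuous_on_subset:
  "mat_continuous_on M m n S \<Longrightarrow> T \<subseteq> S \<Longrightarrow> mat_continuous_on M m n T"
  unfolding mat_continuous_on_def using continuous_on_subset by blast

lemma mat_continuous_on_const: "A \<in> carrier_mat m n \<Longrightarrow> mat_continuous_on (\<lambda>z. A) m n S"
  by (auto simp: mat_continuous_on_def)

lemma mat_holomorphic_on_const: "A \<in> carrier_mat m n \<Longrightarrow> mat_holomorphic_on (\<lambda>z. A) m n S"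
  by (auto simp: mat_holomorphic_on_def)

lemma mult_mat_entry:
  fixes M N :: "complex mat"
  assumes "M \<in> carrier_mat m k" "N \<in> carrier_mat k n" "i < m" "j < n"
  shows "(M * N) $$ (i, j) = (\<Sum>l<k. M $$ (i, l) * N $$ (l, j))"
  using assms(3,4) carrier_matD[OF assms(1)] carrier_matD[OF assms(2)]
  by (simp add: scalar_prod_def atLeast0LessThan)

lemma mat_continuous_on_mult:
  assumes M: "mat_continuous_on M m k S" and N: "mat_continuous_on N k n S"
  shows "mat_continuous_on (\<lambda>z. M z * N z) m n S"
  unfolding mat_continuous_on_def
proof (intro conjI allI impI ballI)
  fix i j assume ij: "i < m" "j < n"
  have "continuous_on S (\<lambda>z. \<Sum>l<k. M z $$ (i, l) * N z $$ (l, j))"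
    using M N ij by (intro continuous_intros) (auto simp: mat_continuous_on_def)
  then show "continuous_on S (\<lambda>z. (M z * N z) $$ (i, j))"
    using M N ij by (subst continuous_on_cong[OF refl mult_mat_entry]) (auto simp: mat_continuous_on_def)
qed (use M N in \<open>auto simp: mat_continuous_on_def\<close>)

lemma mat_holomorphic_on_mult:
  assumes M: "mat_holomorphic_on M m k S" and N: "mat_holomorphic_on N k n S"
  shows "mat_holomorphic_on (\<lambda>z. M z * N z) m n S"
  unfolding mat_holomorphic_on_def
proof (intro conjI allI impI ballI)
  fix i j assume ij: "i < m" "j < n"
  have "(\<lambda>z. \<Sum>l<k. M z $$ (i, l) * N z $$ (l, j)) holomorphic_on S"
    using M N ij by (intro holomorphic_intros) (auto simp: mat_holomorphic_on_def)
  then show "(\<lambda>z. (M z * N z) $$ (i, j)) holomorphic_on S"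
    using M N ij by (subst holomorphic_cong[OF refl mult_mat_entry]) (auto simp: mat_holomorphic_on_def)
qed (use M N in \<open>auto simp: mat_holomorphic_on_def\<close>)

lemma mat_continuous_on_minus:
  assumes "mat_continuous_on M m n S" "mat_continuous_on N m n S"
  shows "mat_continuous_on (\<lambda>z. M z - N z) m n S"
  unfolding mat_continuous_on_def
proof (intro conjI allI impI ballI)
  fix i j assume ij: "i < m" "j < n"
  have "continuous_on S (\<lambda>z. M z $$ (i, j) - N z $$ (i, j))"
    using assms ij by (intro continuous_intros) (auto simp: mat_continuous_on_def)
  moreover have "(M z - N z) $$ (i, j) = M z $$ (i, j) - N z $$ (i, j)" if "z \<in> S" for z
    using assms that ij carrier_matD[of "N z" m n] by (simp add: mat_continuous_on_def)
  ultimately show "continuous_on S (\<lambda>z. (M z - N z) $$ (i, j))"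
    by (subst continuous_on_cong[OF refl]) auto
qed (use assms in \<open>auto simp: mat_continuous_on_def intro!: minus_carrier_mat\<close>)

lemma mat_continuous_on_smult:
  assumes "continuous_on S f" "mat_continuous_on M m n S"
  shows "mat_continuous_on (\<lambda>z. f z \<cdot>\<^sub>m M z) m n S"
  unfolding mat_continuous_on_def
proof (intro conjI allI impI ballI)
  fix i j assume ij: "i < m" "j < n"
  have "continuous_on S (\<lambda>z. f z * M z $$ (i, j))"
    using assms ij by (intro continuous_intros) (auto simp: mat_continuous_on_def)
  moreover have "(f z \<cdot>\<^sub>m M z) $$ (i, j) = f z * M z $$ (i, j)" if "z \<in> S" for z
    using assms that ij carrier_matD[of "M z" m n] by (simp add: mat_continuous_on_def)
  ultimately show "continuous_on S (\<lambda>z. (f z \<cdot>\<^sub>m M z) $$ (i, j))"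
    by (subst continuous_on_cong[OF refl]) auto
qed (use assms in \<open>auto simp: mat_continuous_on_def\<close>)

lemma mat_holomorphic_on_smult:
  assumes "f holomorphic_on S" "mat_holomorphic_on M m n S"
  shows "mat_holomorphic_on (\<lambda>z. f z \<cdot>\<^sub>m M z) m n S"
  unfolding mat_holomorphic_on_def
proof (intro conjI allI impI ballI)
  fix i j assume ij: "i < m" "j < n"
  have "(\<lambda>z. f z * M z $$ (i, j)) holomorphic_on S"
    using assms ij by (intro holomorphic_intros) (auto simp: mat_holomorphic_on_def)
  moreover have "(f z \<cdot>\<^sub>m M z) $$ (i, j) = f z * M z $$ (i, j)" if "z \<in> S" for z
    using assms that ij carrier_matD[of "M z" m n] by (simp add: mat_holomorphic_on_def)
  ultimately show "(\<lambda>z. (f z \<cdot>\<^sub>m M z) $$ (i, j)) holomorphic_on S"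
    by (subst holomorphic_cong[OF refl]) auto
qed (use assms in \<open>auto simp: mat_holomorphic_on_def\<close>)

lemma holomorphic_on_det:
  assumes M: "mat_holomorphic_on M n n S"
  shows "(\<lambda>z. det (M z)) holomorphic_on S"
proof -
  have "(\<lambda>z. \<Sum>p\<in>{p. p permutes {0..<n}}. signof p * (\<Prod>i = 0..<n. M z $$ (i, p i))) holomorphic_on S"
    using M by (intro holomorphic_intros) (auto simp: mat_holomorphic_on_def permutes_in_image)
  then show ?thesis
    by (subst holomorphic_cong[OF refl det_def'[of _ n]]) (use M in \<open>auto simp: mat_holomorphic_on_def\<close>)
qed

lemma minv_eq_adj_mat:
  assumes A: "A \<in> carrier_mat n n" and d: "det A \<noteq> 0"
  shows "minv A = (1 / det A) \<cdot>\<^sub>m adj_mat A"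
proof (rule minv_eq[OF A])
  note adj = adj_mat[OF A]
  show "(1 / det A) \<cdot>\<^sub>m adj_mat A \<in> carrier_mat n n" using adj(1) by simp
  have "A * ((1 / det A) \<cdot>\<^sub>m adj_mat A) = (1 / det A) \<cdot>\<^sub>m (A * adj_mat A)"
    using carrier_matD[OF A] carrier_matD[OF adj(1)] by (intro smult_mult_dim) simp
  also have "\<dots> = 1\<^sub>m n" unfolding adj(2) using d by (auto intro!: eq_matI)
  finally show "A * ((1 / det A) \<cdot>\<^sub>m adj_mat A) = 1\<^sub>m n" .
qed

text \<open>By Cramer's rule the entries of an inverse are quotients of determinants.\<close>

lemma mat_holomorphic_on_minv:
  assumes M: "mat_holomorphic_on M n n S" and d: "\<And>z. z \<in> S \<Longrightarrow> det (M z) \<noteq> 0"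
  shows "mat_holomorphic_on (\<lambda>z. minv (M z)) n n S"
proof -
  have Mc: "M z \<in> carrier_mat n n" if "z \<in> S" for z using M that by (auto simp: mat_holomorphic_on_def)
  have "(\<lambda>z. minv (M z) $$ (i, j)) holomorphic_on S" if ij: "i < n" "j < n" for i j
  proof -
    have "mat_holomorphic_on (\<lambda>z. mat_delete (M z) j i) (n - 1) (n - 1) S"
      unfolding mat_holomorphic_on_def
    proof (intro conjI allI impI ballI)
      fix k l assume kl: "k < n - 1" "l < n - 1"
      let ?k = "if k < j then k else Suc k" and ?l = "if l < i then l else Suc l"
      have "(\<lambda>z. M z $$ (?k, ?l)) holomorphic_on S" using M kl by (auto simp: mat_holomorphic_on_def)
      moreover have "mat_delete (M z) j i $$ (k, l) = M z $$ (?k, ?l)" if "z \<in> S" for z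
        using Mc[OF that] kl by (simp add: mat_delete_def)
      ultimately show "(\<lambda>z. mat_delete (M z) j i $$ (k, l)) holomorphic_on S"
        by (subst holomorphic_cong[OF refl]) auto
    qed (rule mat_delete_carrier[OF Mc])
    from holomorphic_on_det[OF this] holomorphic_on_det[OF M]
    have "(\<lambda>z. 1 / det (M z) * ((-1) ^ (j + i) * det (mat_delete (M z) j i))) holomorphic_on S"
      by (intro holomorphic_intros d)
    moreover have "minv (M z) $$ (i, j) = 1 / det (M z) * ((-1) ^ (j + i) * det (mat_delete (M z) j i))" if "z \<in> S" for z
      using minv_eq_adj_mat[OF Mc[OF that] d[OF that]] Mc[OF that] ij by (simp add: adj_mat_def cofactor_def)
    ultimately show ?thesis by (subst holomorphic_cong[OF refl]) auto
  qed
  then show ?thesis using minv_works(1)[OF Mc d] by (auto simp: mat_holomorphic_on_def)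
qed

text \<open>The dimensions are those of the value \<open>J\<close>, and the carrier condition concerns only points of the circle, since
the integrands used below have poles inside the disc.\<close>

definition has_circle_integral :: "(complex \<Rightarrow> complex mat) \<Rightarrow> complex mat \<Rightarrow> bool" where
  "has_circle_integral F J \<longleftrightarrow> (\<forall>z. cmod z = 1 \<longrightarrow> F z \<in> carrier_mat (dim_row J) (dim_col J)) \<and>
     (\<forall>i<dim_row J. \<forall>j<dim_col J. ((\<lambda>z. F z $$ (i, j)) has_contour_integral J $$ (i, j)) (circlepath 0 1))"

lemma has_circle_integral_unique:
  assumes "has_circle_integral F I" "has_circle_integral F J"
    and "dim_row I = dim_row J" "dim_col I = dim_col J"
  shows "I = J"
proof (rule eq_matI)
  fix i j assume ij: "i < dim_row J" "j < dim_col J"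
  show "I $$ (i, j) = J $$ (i, j)"
    by (rule has_contour_integral_unique[of "\<lambda>z. F z $$ (i, j)" _ "circlepath 0 1"])
      (use assms ij in \<open>simp_all add: has_circle_integral_def\<close>)
qed (use assms in auto)

lemma has_circle_integral_cong:
  assumes "has_circle_integral F J" "\<And>z. cmod z = 1 \<Longrightarrow> F z = F' z"
  shows "has_circle_integral F' J"
  unfolding has_circle_integral_def
proof (intro conjI allI impI)
  fix i j assume ij: "i < dim_row J" "j < dim_col J"
  show "((\<lambda>z. F' z $$ (i, j)) has_contour_integral J $$ (i, j)) (circlepath 0 1)"
    by (rule has_contour_integral_eq[of "\<lambda>z. F z $$ (i, j)"])
      (use assms ij in \<open>auto simp: has_circle_integral_def\<close>)
next
  fix z :: complex assume "cmod z = 1"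
  then show "F' z \<in> carrier_mat (dim_row J) (dim_col J)"
    using assms(1) unfolding has_circle_integral_def assms(2)[OF \<open>cmod z = 1\<close>, symmetric] by simp
qed

lemma ex_circle_integral:
  assumes "mat_continuous_on F m n (sphere 0 1)"
  shows "\<exists>J \<in> carrier_mat m n. has_circle_integral F J"
proof (intro bexI)
  let ?J = "mat m n (\<lambda>(i, j). contour_integral (circlepath 0 1) (\<lambda>z. F z $$ (i, j)))"
  show "has_circle_integral F ?J"
    unfolding has_circle_integral_def using assms
    by (auto simp: mat_continuous_on_def intro!: has_contour_integral_integral contour_integrable_continuous_circlepath)
qed simp

lemma has_circle_integral_mult_left:
  assumes F: "has_circle_integral F J" and A: "dim_col A = dim_row J"
  shows "has_circle_integral (\<lambda>z. A * F z) (A * J)"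
  unfolding has_circle_integral_def
proof (intro conjI allI impI)
  fix i j assume ij: "i < dim_row (A * J)" "j < dim_col (A * J)"
  have "((\<lambda>z. \<Sum>l<dim_row J. A $$ (i, l) * F z $$ (l, j)) has_contour_integral (\<Sum>l<dim_row J. A $$ (i, l) * J $$ (l, j))) (circlepath 0 1)"
    using F ij by (intro has_contour_integral_sum has_contour_integral_lmul) (auto simp: has_circle_integral_def)
  moreover have "(A * J) $$ (i, j) = (\<Sum>l<dim_row J. A $$ (i, l) * J $$ (l, j))"
    by (rule mult_mat_entry[where m = "dim_row A" and n = "dim_col J"]; (rule carrier_matI)?) (use ij A in simp_all)
  moreover have "(A * F z) $$ (i, j) = (\<Sum>l<dim_row J. A $$ (i, l) * F z $$ (l, j))" if "cmod z = 1" for z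
  proof (rule mult_mat_entry[where m = "dim_row A" and n = "dim_col J"])
    show "A \<in> carrier_mat (dim_row A) (dim_row J)" using A by (intro carrier_matI) auto
  qed (use ij F that in \<open>simp_all add: has_circle_integral_def\<close>)
  ultimately show "((\<lambda>z. (A * F z) $$ (i, j)) has_contour_integral (A * J) $$ (i, j)) (circlepath 0 1)"
    by (auto elim: has_contour_integral_eq)
next
  fix z :: complex assume "cmod z = 1"
  then have "F z \<in> carrier_mat (dim_row J) (dim_col J)" using F by (simp add: has_circle_integral_def)
  from carrier_matD[OF this] show "A * F z \<in> carrier_mat (dim_row (A * J)) (dim_col (A * J))"
    by (intro carrier_matI) simp_all
qed

lemma has_circle_integral_add:
  assumes "has_circle_integral F I" "has_circle_integral G J" "dim_row I = dim_row J" "dim_col I = dim_col J"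
  shows "has_circle_integral (\<lambda>z. F z + G z) (I + J)"
  unfolding has_circle_integral_def
proof (intro conjI allI impI)
  fix i j assume ij: "i < dim_row (I + J)" "j < dim_col (I + J)"
  have "((\<lambda>z. F z $$ (i, j) + G z $$ (i, j)) has_contour_integral I $$ (i, j) + J $$ (i, j)) (circlepath 0 1)"
    using assms ij by (intro has_contour_integral_add) (auto simp: has_circle_integral_def)
  moreover have "(F z + G z) $$ (i, j) = F z $$ (i, j) + G z $$ (i, j)" if "cmod z = 1" for z
    using assms ij that carrier_matD[of "G z" "dim_row J" "dim_col J"] by (simp add: has_circle_integral_def)
  ultimately show "((\<lambda>z. (F z + G z) $$ (i, j)) has_contour_integral (I + J) $$ (i, j)) (circlepath 0 1)"
    using ij assms(3,4) by (auto elim: has_contour_integral_eq)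
qed (use assms in \<open>simp add: has_circle_integral_def\<close>)

lemma has_circle_integral_entry_bound:
  assumes "has_circle_integral F J" "0 \<le> B" "i < dim_row J" "j < dim_col J"
    and "\<And>z. cmod z = 1 \<Longrightarrow> cmod (F z $$ (i, j)) \<le> B"
  shows "cmod (J $$ (i, j)) \<le> 2 * pi * B"
proof -
  have "cmod (J $$ (i, j)) \<le> B * (2 * pi * 1)"
    using assms by (intro has_contour_integral_bound_circlepath[of "\<lambda>z. F z $$ (i, j)" _ 0 1]) (auto simp: has_circle_integral_def)
  then show ?thesis by (simp add: mult_ac)
qed

lemma has_contour_integral_inverse_power:
  "((\<lambda>z. inverse z ^ Suc k) has_contour_integral (if k = 0 then 2 * of_real pi * \<i> else 0)) (circlepath 0 1)"
proof -
  have "((\<lambda>u. 1 / (u - 0) ^ Suc k) has_contour_integral ((2 * pi * \<i>) / fact k * (deriv ^^ k) (\<lambda>_. 1) 0)) (circlepath 0 1)"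
    by (rule Cauchy_has_contour_integral_higher_derivative_circlepath) auto
  moreover have "(deriv ^^ k) (\<lambda>_. 1::complex) 0 = (if k = 0 then 1 else 0)" by simp
  ultimately show ?thesis
    by (simp add: field_simps split: if_splits)
qed

text \<open>A kernel vector of \<open>z - W\<close> is an eigenvector of \<open>W\<close>.\<close>

lemma det_resolvent_nonzero:
  fixes W :: "complex mat"
  assumes W: "W \<in> carrier_mat n n" and "\<not> eigenvalue W z"
  shows "det (z \<cdot>\<^sub>m 1\<^sub>m n - W) \<noteq> 0"
proof
  assume "det (z \<cdot>\<^sub>m 1\<^sub>m n - W) = 0"
  then obtain v where v: "v \<in> carrier_vec n" "v \<noteq> 0\<^sub>v n" "(z \<cdot>\<^sub>m 1\<^sub>m n - W) *\<^sub>v v = 0\<^sub>v n"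
    using det_0_iff_vec_prod_zero_field[OF minus_carrier_mat[OF W], of "z \<cdot>\<^sub>m 1\<^sub>m n"] by auto
  have "(z \<cdot>\<^sub>m 1\<^sub>m n - W) *\<^sub>v v = z \<cdot>\<^sub>v v - W *\<^sub>v v"
    using minus_mult_distrib_mat_vec[of "z \<cdot>\<^sub>m 1\<^sub>m n" n n W v] W v by (auto intro!: eq_vecI)
  then have "z \<cdot>\<^sub>v v - W *\<^sub>v v = 0\<^sub>v n" using v(3) by metis
  then have e: "(z \<cdot>\<^sub>v v - W *\<^sub>v v) $ i = 0" if "i < n" for i using that by (simp only: index_zero_vec)
  have "W *\<^sub>v v = z \<cdot>\<^sub>v v"
  proof (rule eq_vecI)
    fix i assume "i < dim_vec (z \<cdot>\<^sub>v v)"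
    then show "(W *\<^sub>v v) $ i = (z \<cdot>\<^sub>v v) $ i" using e[of i] v(1) W by simp
  qed (use v W in auto)
  then have "eigenvalue W z" using v W by (auto simp: eigenvalue_def eigenvector_def)
  then show False using assms(2) by simp
qed

text \<open>A kernel vector satisfies \<open>v = z M v\<close>, whose right-hand side is strictly shorter than \<open>v\<close> unless \<open>v = 0\<close>.\<close>

lemma contraction_det_nonzero:
  fixes M :: "complex mat"
  assumes M: "M \<in> carrier_mat n n"
    and contr: "\<And>v. v \<in> carrier_vec n \<Longrightarrow> Re ((M *\<^sub>v v) \<bullet>c (M *\<^sub>v v)) \<le> Re (v \<bullet>c v)"
    and z: "cmod z < 1"
  shows "det (1\<^sub>m n - z \<cdot>\<^sub>m M) \<noteq> 0"
proof
  assume "det (1\<^sub>m n - z \<cdot>\<^sub>m M) = 0"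
  then obtain v where v: "v \<in> carrier_vec n" "v \<noteq> 0\<^sub>v n" "(1\<^sub>m n - z \<cdot>\<^sub>m M) *\<^sub>v v = 0\<^sub>v n"
    using det_0_iff_vec_prod_zero_field[OF minus_carrier_mat[of "z \<cdot>\<^sub>m M" n n], of "1\<^sub>m n"] M by auto
  note [simp] = carrier_matD[OF M] carrier_vecD[OF v(1)]
  have Mv: "M *\<^sub>v v \<in> carrier_vec n" using M v by simp
  have "(1\<^sub>m n - z \<cdot>\<^sub>m M) *\<^sub>v v = v - z \<cdot>\<^sub>v (M *\<^sub>v v)"
    using minus_mult_distrib_mat_vec[of "1\<^sub>m n" n n "z \<cdot>\<^sub>m M" v] M v by (auto intro!: eq_vecI)
  then have "v - z \<cdot>\<^sub>v (M *\<^sub>v v) = 0\<^sub>v n" using v(3) by metis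
  then have e: "(v - z \<cdot>\<^sub>v (M *\<^sub>v v)) $ i = 0" if "i < n" for i using that by (simp only: index_zero_vec)
  have "cmod (v $ i) = cmod z * cmod ((M *\<^sub>v v) $ i)" if "i < n" for i
    using e[OF that] that by (simp add: norm_mult flip: index_mult_mat_vec)
  then have "Re (v \<bullet>c v) = (\<Sum>i<n. (cmod z)\<^sup>2 * (cmod ((M *\<^sub>v v) $ i))\<^sup>2)"
    unfolding Re_cscalar_self[OF v(1)] by (intro sum.cong) (auto simp: power_mult_distrib simp del: index_mult_mat_vec)
  also have "\<dots> = (cmod z)\<^sup>2 * Re ((M *\<^sub>v v) \<bullet>c (M *\<^sub>v v))"
    unfolding Re_cscalar_self[OF Mv] by (simp add: sum_distrib_left)
  also have "\<dots> \<le> (cmod z)\<^sup>2 * Re (v \<bullet>c v)"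
    using contr[OF v(1)] by (intro mult_left_mono) auto
  also have "\<dots> < 1 * Re (v \<bullet>c v)"
    using Re_cscalar_self_pos[OF v(1,2)] z by (intro mult_strict_right_mono) (auto simp: abs_square_less_1)
  finally show False by simp
qed

lemma resolvent_shift:
  fixes W R :: "complex mat"
  assumes W: "W \<in> carrier_mat n n" and R: "R \<in> carrier_mat n n"
    and res: "(z \<cdot>\<^sub>m 1\<^sub>m n - W) * R = 1\<^sub>m n"
  shows "z \<cdot>\<^sub>m R = 1\<^sub>m n + W * R"
proof (rule eq_matI)
  note [simp] = carrier_matD[OF W] carrier_matD[OF R]
  fix i j assume ij: "i < dim_row (1\<^sub>m n + W * R)" "j < dim_col (1\<^sub>m n + W * R)"
  have "(z \<cdot>\<^sub>m 1\<^sub>m n - W) * R = z \<cdot>\<^sub>m R - W * R" by (simp add: mat_expand)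
  then have "(z \<cdot>\<^sub>m R - W * R) $$ (i, j) = 1\<^sub>m n $$ (i, j)" using res by simp
  then show "(z \<cdot>\<^sub>m R) $$ (i, j) = (1\<^sub>m n + W * R) $$ (i, j)"
    using ij by (simp add: diff_eq_eq del: index_mult_mat(1) index_one_mat(1))
qed (use carrier_matD[OF W] carrier_matD[OF R] in simp_all)

lemma resolvent_holomorphic:
  fixes W :: "complex mat"
  assumes W: "W \<in> carrier_mat n n"
  shows "mat_holomorphic_on (\<lambda>z. minv (z \<cdot>\<^sub>m 1\<^sub>m n - W)) n n {z. det (z \<cdot>\<^sub>m 1\<^sub>m n - W) \<noteq> 0}"
  by (rule mat_holomorphic_on_minv)
    (use W in \<open>auto simp: mat_holomorphic_on_def intro!: holomorphic_intros\<close>)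

text \<open>Let \<open>J k\<close> be the integral of \<open>z^{-k} R(z)\<close> for the resolvent \<open>R\<close> of \<open>W\<close>. Dividing the resolvent identity by
\<open>z\<close> gives \<open>J k = c k + W J (k + 1)\<close>, where \<open>c k\<close> is \<open>2\<pi>i\<close> for \<open>k = 0\<close> and zero otherwise. So
\<open>J 1 = W^N J (N + 1)\<close> for all \<open>N\<close>; the integrals \<open>J k\<close> are uniformly bounded and \<open>W^N\<close> tends to zero. Hence
\<open>J 1 = 0\<close> and \<open>J 0 = 2\<pi>i\<close>.\<close>

lemma resolvent_circle_integral:
  fixes W :: "complex mat"
  assumes W: "W \<in> carrier_mat n n" and stable: "stable W"
  shows "has_circle_integral (\<lambda>z. minv (z \<cdot>\<^sub>m 1\<^sub>m n - W)) ((2 * of_real pi * \<i>) \<cdot>\<^sub>m 1\<^sub>m n)"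
proof -
  define R where "R z = minv (z \<cdot>\<^sub>m 1\<^sub>m n - W)" for z
  define S where "S = {z. det (z \<cdot>\<^sub>m 1\<^sub>m n - W) \<noteq> 0}"
  have S: "z \<in> S" if "cmod z = 1" for z
  proof -
    have "\<not> eigenvalue W z" using stable that by (auto simp: stable_def)
    then show ?thesis using det_resolvent_nonzero[OF W] by (simp add: S_def)
  qed
  have Rhol: "mat_holomorphic_on R n n S"
    unfolding R_def S_def by (rule resolvent_holomorphic[OF W])
  then have Rc: "R z \<in> carrier_mat n n" if "cmod z = 1" for z
    using S[OF that] by (simp add: mat_holomorphic_on_def)
  have Rcont: "mat_continuous_on R n n (sphere 0 1)"
    by (rule mat_continuous_on_subset[OF mat_holomorphic_imp_continuous[OF Rhol]]) (use S in auto)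
  have step: "R z = inverse z \<cdot>\<^sub>m 1\<^sub>m n + W * (inverse z \<cdot>\<^sub>m R z)" if "cmod z = 1" for z
  proof -
    have "z \<noteq> 0" using that by auto
    have "(z \<cdot>\<^sub>m 1\<^sub>m n - W) * R z = 1\<^sub>m n"
      unfolding R_def using S[OF that] W by (intro minv_works) (auto simp: S_def)
    then have "inverse z \<cdot>\<^sub>m 1\<^sub>m n = inverse z \<cdot>\<^sub>m ((z \<cdot>\<^sub>m 1\<^sub>m n - W) * R z)" by simp
    also have "\<dots> = R z - W * (inverse z \<cdot>\<^sub>m R z)"
      using carrier_matD[OF Rc[OF that]] carrier_matD[OF W] \<open>z \<noteq> 0\<close>
      by (simp add: mat_expand) (auto intro!: eq_matI simp: field_simps simp del: index_mult_mat(1))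
    finally show ?thesis
      using carrier_matD[OF Rc[OF that]] carrier_matD[OF W] by (auto intro!: eq_matI simp del: index_mult_mat(1))
  qed
  have "\<exists>J \<in> carrier_mat n n. has_circle_integral (\<lambda>z. inverse z ^ k \<cdot>\<^sub>m R z) J" for k
    by (intro ex_circle_integral mat_continuous_on_smult Rcont continuous_intros) auto
  then obtain J where J: "\<And>k. J k \<in> carrier_mat n n"
    and Jint: "\<And>k. has_circle_integral (\<lambda>z. inverse z ^ k \<cdot>\<^sub>m R z) (J k)"
    by metis
  note [simp] = carrier_matD[OF J] carrier_matD[OF W]
  define c where "c k = (if k = 0 then 2 * of_real pi * \<i> else 0 :: complex)" for k :: nat
  have rec: "J k = c k \<cdot>\<^sub>m 1\<^sub>m n + W * J (Suc k)" for k
  proof (rule has_circle_integral_unique[OF Jint[of k]])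
    have "has_circle_integral (\<lambda>z. inverse z ^ Suc k \<cdot>\<^sub>m 1\<^sub>m n) (c k \<cdot>\<^sub>m 1\<^sub>m n)"
      unfolding has_circle_integral_def
    proof (intro conjI allI impI)
      fix i j assume ij: "i < dim_row (c k \<cdot>\<^sub>m 1\<^sub>m n)" "j < dim_col (c k \<cdot>\<^sub>m 1\<^sub>m n)"
      have "((\<lambda>z. inverse z ^ Suc k * (1\<^sub>m n $$ (i, j))) has_contour_integral c k * (1\<^sub>m n $$ (i, j))) (circlepath 0 1)"
        using has_contour_integral_inverse_power[of k] unfolding c_def by (intro has_contour_integral_rmul)
      then show "((\<lambda>z. (inverse z ^ Suc k \<cdot>\<^sub>m 1\<^sub>m n) $$ (i, j)) has_contour_integral (c k \<cdot>\<^sub>m 1\<^sub>m n) $$ (i, j)) (circlepath 0 1)"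
        using ij by simp
    qed simp
    from has_circle_integral_add[OF this has_circle_integral_mult_left[OF Jint[of "Suc k"], of W]]
    have "has_circle_integral (\<lambda>z. inverse z ^ Suc k \<cdot>\<^sub>m 1\<^sub>m n + W * (inverse z ^ Suc k \<cdot>\<^sub>m R z)) (c k \<cdot>\<^sub>m 1\<^sub>m n + W * J (Suc k))"
      by simp
    then show "has_circle_integral (\<lambda>z. inverse z ^ k \<cdot>\<^sub>m R z) (c k \<cdot>\<^sub>m 1\<^sub>m n + W * J (Suc k))"
    proof (rule has_circle_integral_cong)
      fix z :: complex assume z: "cmod z = 1"
      note [simp] = carrier_matD[OF Rc[OF z]]
      have "inverse z ^ k \<cdot>\<^sub>m R z = inverse z ^ k \<cdot>\<^sub>m (inverse z \<cdot>\<^sub>m 1\<^sub>m n + W * (inverse z \<cdot>\<^sub>m R z))"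
        using step[OF z] by simp
      also have "\<dots> = inverse z ^ Suc k \<cdot>\<^sub>m 1\<^sub>m n + W * (inverse z ^ Suc k \<cdot>\<^sub>m R z)"
        by (simp add: smult_mult_dim) (auto intro!: eq_matI simp: algebra_simps simp del: index_mult_mat(1))
      finally show "inverse z ^ Suc k \<cdot>\<^sub>m 1\<^sub>m n + W * (inverse z ^ Suc k \<cdot>\<^sub>m R z) = inverse z ^ k \<cdot>\<^sub>m R z" ..
    qed
  qed auto
  obtain B where B: "\<And>k i j. i < n \<Longrightarrow> j < n \<Longrightarrow> cmod (J k $$ (i, j)) \<le> B"
  proof -
    have "\<exists>b. \<forall>z \<in> sphere 0 1. cmod (R z $$ (i, j)) \<le> b" if "i < n" "j < n" for i j
    proof -
      have "compact ((\<lambda>z. R z $$ (i, j)) ` sphere 0 1)"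
        using Rcont that by (intro compact_continuous_image) (auto simp: mat_continuous_on_def)
      from compact_imp_bounded[OF this] show ?thesis by (auto simp: bounded_iff)
    qed
    then obtain b where b: "\<And>i j z. i < n \<Longrightarrow> j < n \<Longrightarrow> z \<in> sphere 0 1 \<Longrightarrow> cmod (R z $$ (i, j)) \<le> b i j"
      by metis
    define b' where "b' = (\<Sum>i<n. \<Sum>j<n. \<bar>b i j\<bar>)"
    have bb: "b i j \<le> b'" if "i < n" "j < n" for i j
    proof -
      have "\<bar>b i j\<bar> \<le> (\<Sum>j<n. \<bar>b i j\<bar>)" using that by (intro member_le_sum) auto
      also have "\<dots> \<le> b'" unfolding b'_def
        using that by (intro member_le_sum[of i "{..<n}" "\<lambda>i. \<Sum>j<n. \<bar>b i j\<bar>"]) (auto intro: sum_nonneg)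
      finally show ?thesis by simp
    qed
    have "0 \<le> b'" unfolding b'_def by (intro sum_nonneg) auto
    then have "cmod (J k $$ (i, j)) \<le> 2 * pi * b'" if ij: "i < n" "j < n" for i j k
    proof (intro has_circle_integral_entry_bound[OF Jint[of k]])
      fix z :: complex assume z: "cmod z = 1"
      have "cmod ((inverse z ^ k \<cdot>\<^sub>m R z) $$ (i, j)) = cmod (R z $$ (i, j))"
        using carrier_matD[OF Rc[OF z]] ij z by (simp add: norm_mult norm_power norm_inverse)
      also have "\<dots> \<le> b'" using b[OF ij, of z] bb[OF ij] z by simp
      finally show "cmod ((inverse z ^ k \<cdot>\<^sub>m R z) $$ (i, j)) \<le> b'" .
    qed (use ij in simp_all)
    then show ?thesis by (rule that)
  qed
  have Wk: "W ^\<^sub>m N \<in> carrier_mat n n" for N using W by simp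
  have iter: "J 1 = W ^\<^sub>m N * J (Suc N)" for N
  proof (induction N)
    case 0
    then show ?case by (simp add: one_mult_dim)
  next
    case (Suc N)
    have "W ^\<^sub>m N * J (Suc N) = W ^\<^sub>m N * (W * J (Suc (Suc N)))"
    proof -
      have "J (Suc N) = W * J (Suc (Suc N))"
        by (subst rec) (auto simp: c_def intro!: eq_matI simp del: index_mult_mat(1))
      then show ?thesis by simp
    qed
    also have "\<dots> = W ^\<^sub>m Suc N * J (Suc (Suc N))"
      using assoc_mult_mat[OF Wk W J] by simp
    finally show ?case using Suc by simp
  qed
  obtain a r where r: "0 < r" "r < 1" "0 \<le> a"
    and a: "\<And>k i j. i < n \<Longrightarrow> j < n \<Longrightarrow> cmod ((W ^\<^sub>m k) $$ (i, j)) \<le> a * r ^ k"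
    using stable_powers_geometric[OF W stable] by metis
  have J1: "J 1 $$ (i, j) = 0" if ij: "i < n" "j < n" for i j
  proof -
    have "cmod (J 1 $$ (i, j)) \<le> a * real n * B * r ^ N" for N
    proof -
      have "cmod (J 1 $$ (i, j)) = cmod (\<Sum>l<n. (W ^\<^sub>m N) $$ (i, l) * J (Suc N) $$ (l, j))"
        using mult_mat_entry[OF Wk J ij, of N "Suc N"] iter[of N] by simp
      also have "\<dots> \<le> (\<Sum>l<n. (a * r ^ N) * B)"
        unfolding norm_mult
        by (rule sum_norm_le) (use a B ij r in \<open>auto simp: norm_mult intro!: mult_mono\<close>)
      finally show ?thesis by (simp add: mult_ac)
    qed
    moreover have "(\<lambda>N. a * real n * B * r ^ N) \<longlonglongrightarrow> a * real n * B * 0"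
      using r by (intro tendsto_mult tendsto_const LIMSEQ_realpow_zero) auto
    ultimately have "cmod (J 1 $$ (i, j)) \<le> 0"
      by (intro LIMSEQ_le_const[of "\<lambda>N. a * real n * B * r ^ N"]) auto
    then show ?thesis by simp
  qed
  have "J 1 = 0\<^sub>m n n" by (rule eq_matI) (use J1 in auto)
  then have "J 0 = (2 * of_real pi * \<i>) \<cdot>\<^sub>m 1\<^sub>m n"
    using rec[of 0] by (simp add: c_def zero_mult_dim)
  moreover have "has_circle_integral R (J 0)"
    by (rule has_circle_integral_cong[OF Jint[of 0]]) (auto intro!: eq_matI)
  ultimately show ?thesis by (simp add: R_def[abs_def])
qed

section \<open>The interpolation value of a lossless function\<close>

text \<open>The \<open>i\<close>-th diagonal entry of \<open>G G*\<close> is the squared norm of the \<open>i\<close>-th row of \<open>G\<close>, and losslessness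
bounds it by one.\<close>

lemma lossless_entry_bound:
  assumes G: "lossless p G" and w: "1 \<le> cmod w" and ij: "i < p" "j < p"
  shows "cmod (G w $$ (i, j)) \<le> 1"
proof -
  have Gc: "G w \<in> carrier_mat p p" using G by (simp add: lossless_def rational_mat_fun_def)
  note [simp] = carrier_matD[OF Gc]
  have diag: "Re ((G w * (G w)\<^sup>\<dagger>) $$ (i, i)) = (\<Sum>j<p. (cmod (G w $$ (i, j)))\<^sup>2)"
  proof -
    have "(G w * (G w)\<^sup>\<dagger>) $$ (i, i) = (\<Sum>j<p. G w $$ (i, j) * cnj (G w $$ (i, j)))"
      using ij by (simp add: scalar_prod_def atLeast0LessThan)
    also have "Re \<dots> = (\<Sum>j<p. Re (G w $$ (i, j) * cnj (G w $$ (i, j))))" by (rule Re_sum)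
    also have "\<dots> = (\<Sum>j<p. (cmod (G w $$ (i, j)))\<^sup>2)"
      by (rule sum.cong) (auto simp: complex_mult_cnj cmod_power2)
    finally show ?thesis .
  qed
  have "Re ((G w * (G w)\<^sup>\<dagger>) $$ (i, i)) \<le> 1"
  proof (cases "cmod w = 1")
    case True
    then have "G w * (G w)\<^sup>\<dagger> = 1\<^sub>m p" using G by (simp add: lossless_def)
    then show ?thesis using ij by simp
  next
    case False
    define N where "N = 1\<^sub>m p - G w * (G w)\<^sup>\<dagger>"
    have N: "N \<in> carrier_mat p p" by (rule carrier_matI) (simp_all add: N_def)
    have "pos_semidef N" using G False w by (simp add: lossless_def N_def)
    then have "0 \<le> Re ((N *\<^sub>v unit_vec p i) \<bullet>c unit_vec p i)"
      using N by (simp add: pos_semidef_def)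
    also have "conjugate (unit_vec p i) = (unit_vec p i :: complex vec)" by (intro eq_vecI) (auto simp: unit_vec_def)
    also have "(N *\<^sub>v unit_vec p i) \<bullet> unit_vec p i = N $$ (i, i)"
      using N ij by (simp add: scalar_prod_right_unit)
    finally show ?thesis using ij by (simp add: N_def del: index_mult_mat(1))
  qed
  moreover have "(cmod (G w $$ (i, j)))\<^sup>2 \<le> (\<Sum>j<p. (cmod (G w $$ (i, j)))\<^sup>2)"
    by (rule member_le_sum) (use ij in auto)
  ultimately have "(cmod (G w $$ (i, j)))\<^sup>2 \<le> 1" using diag by linarith
  then show ?thesis by (simp add: abs_square_le_1)
qed

text \<open>With \<open>f = a / b\<close> in lowest terms, \<open>|a| \<le> |b|\<close> holds for \<open>|w| \<ge> 1\<close> off the zeros of \<open>b\<close>. A zero \<open>w\<close> of \<open>b\<close> with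
\<open>|w| \<ge> 1\<close> can be approached from outside by points that are not zeros of \<open>b\<close>, so \<open>a\<close> would vanish there as
well, against coprimality.\<close>

lemma rational_fun_bounded_continuous:
  assumes f: "rational_fun f" and bounded: "\<And>w. 1 \<le> cmod w \<Longrightarrow> cmod (f w) \<le> 1"
  shows "continuous_on {w. 1 \<le> cmod w} f"
proof -
  obtain a b where ab: "b \<noteq> 0" "coprime a b" and f_eq: "f = (\<lambda>z. poly a z / poly b z)"
    using f by (auto simp: rational_fun_def)
  have "poly b w \<noteq> 0" if w: "1 \<le> cmod w" for w
  proof
    assume bw: "poly b w = 0"
    obtain d where d: "d > 0" "\<And>x. poly b x = 0 \<Longrightarrow> x \<noteq> w \<Longrightarrow> d \<le> dist w x"
      using finite_set_avoid[OF poly_roots_finite[OF ab(1)], of w] by auto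
    \<comment> \<open>Points on the ray through \<open>w\<close>, outside the unit circle and different from \<open>w\<close>.\<close>
    define u where "u k = w * (1 + of_real (inverse (real (Suc k))))" for k
    have u: "u \<longlonglongrightarrow> w"
    proof -
      have "(\<lambda>k. w * (1 + of_real (inverse (real (Suc k))))) \<longlonglongrightarrow> w * (1 + of_real 0)"
        by (intro tendsto_intros LIMSEQ_inverse_real_of_nat)
      then show ?thesis by (simp add: u_def[abs_def])
    qed
    have u1: "1 \<le> cmod (u k)" and uw: "u k \<noteq> w" for k
    proof -
      have "1 + complex_of_real (inverse (real (Suc k))) = complex_of_real (1 + inverse (real (Suc k)))"
        by (simp only: of_real_add of_real_1)
      then have "cmod (u k) = cmod w * (1 + inverse (real (Suc k)))"
        unfolding u_def norm_mult by (simp only: norm_of_real) simp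
      moreover have "cmod w * 1 < cmod w * (1 + inverse (real (Suc k)))"
        by (intro mult_strict_left_mono) (use w in auto)
      ultimately have "cmod w < cmod (u k)" by simp
      then show "1 \<le> cmod (u k)" "u k \<noteq> w" using w by auto
    qed
    have "eventually (\<lambda>k. dist (u k) w < d) sequentially" using tendstoD[OF u d(1)] .
    then have "eventually (\<lambda>k. cmod (poly a (u k)) \<le> cmod (poly b (u k))) sequentially"
    proof eventually_elim
      case (elim k)
      then have "poly b (u k) \<noteq> 0" using d(2)[of "u k"] uw[of k] by (auto simp: dist_commute)
      then show ?case using bounded[OF u1[of k]] by (simp add: f_eq norm_divide divide_simps)
    qed
    moreover have "(\<lambda>k. cmod (poly a (u k))) \<longlonglongrightarrow> cmod (poly a w)" "(\<lambda>k. cmod (poly b (u k))) \<longlonglongrightarrow> cmod (poly b w)"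
      using u by (auto intro!: tendsto_intros)
    ultimately have "cmod (poly a w) \<le> cmod (poly b w)"
      by (intro tendsto_le[of sequentially]) auto
    then show False using bw coprime_poly_0[OF ab(2), of w] by simp
  qed
  then show ?thesis unfolding f_eq by (intro continuous_intros) auto
qed

text \<open>The reflection \<open>z \<mapsto> 1 / cnj z\<close> maps the punctured closed disc to the closed exterior of the unit circle, where
the entries of \<open>G\<close> have no poles.\<close>

lemma lossless_sharp_continuous:
  assumes G: "lossless p G"
  shows "mat_continuous_on (sharp G) p p (cball 0 1 - {0})"
  unfolding mat_continuous_on_def
proof (intro conjI allI impI ballI)
  have Gc: "G w \<in> carrier_mat p p" for w using G by (simp add: lossless_def rational_mat_fun_def)
  show "sharp G z \<in> carrier_mat p p" for z using Gc[of "1 / cnj z"] by (simp add: sharp_def)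
  fix i j assume ij: "i < p" "j < p"
  have "continuous_on {w. 1 \<le> cmod w} (\<lambda>w. G w $$ (j, i))"
    using G ij lossless_entry_bound[OF G] by (intro rational_fun_bounded_continuous) (auto simp: lossless_def rational_mat_fun_def)
  then have "continuous_on (cball 0 1 - {0}) (\<lambda>z. cnj (G (1 / cnj z) $$ (j, i)))"
    by (intro continuous_intros continuous_on_compose2[where f = "\<lambda>z. 1 / cnj z" and g = "\<lambda>w. G w $$ (j, i)"])
      (auto simp: norm_divide divide_simps)
  then show "continuous_on (cball 0 1 - {0}) (\<lambda>z. sharp G z $$ (i, j))"
    using ij carrier_matD[OF Gc] by (simp add: sharp_def)
qed

text \<open>For \<open>w = 1 / cnj z\<close> one has \<open>(w - A)* = z^{-1} (1 - z A*)\<close>, and \<open>1 - z A*\<close> is invertible in the disc as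
\<open>A*\<close> is a contraction.\<close>

lemma sharp_of_realization:
  assumes real: "realization p n A B C D G"
    and contr: "\<And>v. v \<in> carrier_vec n \<Longrightarrow> Re ((A\<^sup>\<dagger> *\<^sub>v v) \<bullet>c (A\<^sup>\<dagger> *\<^sub>v v)) \<le> Re (v \<bullet>c v)"
    and z: "cmod z < 1" "z \<noteq> 0"
  shows "sharp G z = D\<^sup>\<dagger> + z \<cdot>\<^sub>m (B\<^sup>\<dagger> * minv (1\<^sub>m n - z \<cdot>\<^sub>m A\<^sup>\<dagger>) * C\<^sup>\<dagger>)"
proof -
  have A: "A \<in> carrier_mat n n" and B: "B \<in> carrier_mat n p" and C: "C \<in> carrier_mat p n" and D: "D \<in> carrier_mat p p"
    and G: "\<And>z. invertible_mat (z \<cdot>\<^sub>m 1\<^sub>m n - A) \<Longrightarrow> G z = D + C * minv (z \<cdot>\<^sub>m 1\<^sub>m n - A) * B"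
    using real by (auto simp: realization_def)
  note [simp] = carrier_matD[OF A] carrier_matD[OF B] carrier_matD[OF C] carrier_matD[OF D]
  define w where "w = 1 / cnj z"
  define N where "N = 1\<^sub>m n - z \<cdot>\<^sub>m A\<^sup>\<dagger>"
  define M where "M = w \<cdot>\<^sub>m 1\<^sub>m n - A"
  have N: "N \<in> carrier_mat n n" and M: "M \<in> carrier_mat n n"
    by (rule carrier_matI; simp add: N_def M_def)+
  have "det N \<noteq> 0"
    unfolding N_def by (rule contraction_det_nonzero[OF adjoint_carrier[OF A] contr z(1)])
  note Ni = minv_works[OF N this]
  note [simp] = carrier_matD[OF N] carrier_matD[OF M] carrier_matD[OF Ni(1)]
  have Mdag: "M\<^sup>\<dagger> = (1 / z) \<cdot>\<^sub>m N"
    unfolding M_def N_def w_def using z by (intro eq_matI) (auto simp: field_simps)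
  have "M\<^sup>\<dagger> * (z \<cdot>\<^sub>m minv N) = 1\<^sub>m n"
    unfolding Mdag using z by (simp add: smult_mult_dim Ni) (auto intro!: eq_matI)
  then have det: "det (M\<^sup>\<dagger>) \<noteq> 0" and inv: "minv (M\<^sup>\<dagger>) = z \<cdot>\<^sub>m minv N"
    using M Ni(1) det_nonzero_of_inverse[of "M\<^sup>\<dagger>" n "z \<cdot>\<^sub>m minv N"] minv_eq[of "M\<^sup>\<dagger>" n "z \<cdot>\<^sub>m minv N"] by auto
  have detM: "det M \<noteq> 0" using det det_adjoint_eq_0_iff[OF M] by simp
  note Mi = minv_works[OF M detM]
  note [simp] = carrier_matD[OF Mi(1)]
  have "G w = D + C * minv M * B"
    using G[of w] invertible_mat_iff_det[OF M] detM by (simp add: M_def)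
  then have "sharp G z = (D + C * minv M * B)\<^sup>\<dagger>" by (simp add: sharp_def w_def)
  also have "\<dots> = D\<^sup>\<dagger> + B\<^sup>\<dagger> * ((minv M)\<^sup>\<dagger> * C\<^sup>\<dagger>)"
    by (simp add: adjoint_add adjoint_mult)
  also have "(minv M)\<^sup>\<dagger> = z \<cdot>\<^sub>m minv N" using adjoint_minv[OF M detM] inv by simp
  finally show ?thesis by (simp add: N_def[symmetric] smult_mult_dim mult_assoc_dim)
qed

text \<open>With \<open>R\<close> and \<open>N\<close> the inverses of \<open>z - W\<close> and \<open>1 - z A\<close>, this is the decomposition
\<open>Q - A Q W = (1 - z A) Q + A Q (z - W)\<close> multiplied by both inverses. It separates the singularities of
\<open>R\<close>, which lie inside the disc, from those of \<open>N\<close>.\<close>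

lemma stein_resolvent_identity:
  fixes A Q W R N :: "complex mat"
  assumes A: "A \<in> carrier_mat n n" and Q: "Q \<in> carrier_mat n n" and W: "W \<in> carrier_mat n n"
    and R: "R \<in> carrier_mat n n" and N: "N \<in> carrier_mat n n"
    and res: "(z \<cdot>\<^sub>m 1\<^sub>m n - W) * R = 1\<^sub>m n" and N1: "N * (1\<^sub>m n - z \<cdot>\<^sub>m A) = 1\<^sub>m n"
  shows "N * ((Q - A * Q * W) * R) = Q * R + N * (A * Q)"
proof -
  note [simp] = carrier_matD[OF A] carrier_matD[OF Q] carrier_matD[OF W] carrier_matD[OF R] carrier_matD[OF N]
  have "(Q - A * Q * W) * R = Q * R - A * (Q * (W * R))" by (simp add: mat_expand)
  also have "\<dots> = (1\<^sub>m n - z \<cdot>\<^sub>m A) * (Q * R) + A * (Q * (z \<cdot>\<^sub>m R - W * R))"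
    by (simp add: mat_expand) (auto intro!: eq_matI simp del: index_mult_mat(1))
  also have "z \<cdot>\<^sub>m R - W * R = 1\<^sub>m n"
    unfolding resolvent_shift[OF W R res] by (auto intro!: eq_matI simp del: index_mult_mat(1))
  also have "A * (Q * 1\<^sub>m n) = A * Q" by (simp add: one_mult_dim)
  finally show ?thesis by (simp add: mult_add_dim left_cancel_dim[OF N1])
qed

text \<open>In the punctured disc \<open>stein_resolvent_identity\<close> gives \<open>G\<^sup>\<sharp>(z) U R(z) = E(z) + H(z)\<close> away from the eigenvalues of
\<open>W\<close>, where \<open>E\<close> is a combination of \<open>R(z)\<close> and \<open>z R(z)\<close>, and \<open>H\<close> is holomorphic in the open disc. The difference
\<open>F\<close> of the integrand and \<open>E\<close> is continuous near the circle, from inside and on it. Pasting \<open>F\<close> on the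
circle to \<open>H\<close> in the disc gives a function to which Cauchy's theorem applies, so that only \<open>E\<close> contributes.\<close>

lemma interpolation_integral:
  assumes lossless: "lossless p G" and real: "realization p n A B C D G"
    and contr: "\<And>v. v \<in> carrier_vec n \<Longrightarrow> Re ((A\<^sup>\<dagger> *\<^sub>v v) \<bullet>c (A\<^sup>\<dagger> *\<^sub>v v)) \<le> Re (v \<bullet>c v)"
    and U: "U \<in> carrier_mat p n" and W: "W \<in> carrier_mat n n" and stable: "stable W"
    and Q: "stein_solution n (A\<^sup>\<dagger>) W (C\<^sup>\<dagger> * U) Q"
  shows "has_circle_integral (interp_integrand G U W) ((2 * of_real pi * \<i>) \<cdot>\<^sub>m (D\<^sup>\<dagger> * U + B\<^sup>\<dagger> * Q * W))"
proof -
  have A: "A \<in> carrier_mat n n" and B: "B \<in> carrier_mat n p" and C: "C \<in> carrier_mat p n" and D: "D \<in> carrier_mat p p"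
    using real by (auto simp: realization_def)
  have Qc: "Q \<in> carrier_mat n n" and Qeq: "Q - A\<^sup>\<dagger> * Q * W = C\<^sup>\<dagger> * U" using Q by (auto simp: stein_solution_def)
  note [simp] = carrier_matD[OF A] carrier_matD[OF B] carrier_matD[OF C] carrier_matD[OF D]
    carrier_matD[OF U] carrier_matD[OF W] carrier_matD[OF Qc]
  define R where "R z = minv (z \<cdot>\<^sub>m 1\<^sub>m n - W)" for z
  define S where "S = {z. det (z \<cdot>\<^sub>m 1\<^sub>m n - W) \<noteq> 0}"
  define E where "E z = D\<^sup>\<dagger> * U * R z + B\<^sup>\<dagger> * Q * (z \<cdot>\<^sub>m R z)" for z
  define F where "F z = sharp G z * U * R z - E z" for z
  define N where "N z = minv (1\<^sub>m n - z \<cdot>\<^sub>m A\<^sup>\<dagger>)" for z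
  define H where "H z = z \<cdot>\<^sub>m (B\<^sup>\<dagger> * (N z * (A\<^sup>\<dagger> * Q)))" for z
  have Rhol: "mat_holomorphic_on R n n S"
    unfolding R_def S_def by (rule resolvent_holomorphic[OF W])
  have S1: "z \<in> S" if "cmod z = 1" for z
  proof -
    have "\<not> eigenvalue W z" using stable that by (auto simp: stable_def)
    then show ?thesis using det_resolvent_nonzero[OF W] by (simp add: S_def)
  qed
  have "open S"
    unfolding S_def
  proof (rule open_Collect_neq)
    show "continuous_on UNIV (\<lambda>z. det (z \<cdot>\<^sub>m 1\<^sub>m n - W))"
      by (intro holomorphic_on_imp_continuous_on holomorphic_on_det[of _ n])
        (use W in \<open>auto simp: mat_holomorphic_on_def intro!: holomorphic_intros\<close>)
  qed auto
  have Rc: "R z \<in> carrier_mat n n" if "z \<in> S" for z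
    using Rhol that by (simp add: mat_holomorphic_on_def)
  have res: "(z \<cdot>\<^sub>m 1\<^sub>m n - W) * R z = 1\<^sub>m n" if "z \<in> S" for z
    unfolding R_def by (rule minv_works(2)[OF minus_carrier_mat[OF W]]) (use that in \<open>simp add: S_def\<close>)
  have Sc: "sharp G z \<in> carrier_mat p p" for z
    using lossless by (auto simp: lossless_def rational_mat_fun_def sharp_def)
  have FH: "F z = H z" if z: "cmod z < 1" "z \<noteq> 0" "z \<in> S" for z
  proof -
    note [simp] = carrier_matD[OF Rc[OF z(3)]]
    have c: "1\<^sub>m n - z \<cdot>\<^sub>m A\<^sup>\<dagger> \<in> carrier_mat n n" by (rule carrier_matI) simp_all
    have "det (1\<^sub>m n - z \<cdot>\<^sub>m A\<^sup>\<dagger>) \<noteq> 0"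
      by (rule contraction_det_nonzero[OF adjoint_carrier[OF A] contr z(1)])
    note Ni = minv_works[OF c this, folded N_def]
    note [simp] = carrier_matD[OF Ni(1)]
    have key: "N z * (C\<^sup>\<dagger> * U * R z) = Q * R z + N z * (A\<^sup>\<dagger> * Q)"
      using stein_resolvent_identity[OF adjoint_carrier[OF A] Qc W Rc[OF z(3)] Ni(1) res[OF z(3)] Ni(3)]
      unfolding Qeq .
    have "sharp G z * U * R z = (D\<^sup>\<dagger> + z \<cdot>\<^sub>m (B\<^sup>\<dagger> * N z * C\<^sup>\<dagger>)) * U * R z"
      by (simp only: sharp_of_realization[OF real contr z(1,2)] N_def)
    also have "\<dots> = D\<^sup>\<dagger> * U * R z + z \<cdot>\<^sub>m (B\<^sup>\<dagger> * (N z * (C\<^sup>\<dagger> * U * R z)))"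
      by (simp add: mat_expand)
    also have "\<dots> = D\<^sup>\<dagger> * U * R z + z \<cdot>\<^sub>m (B\<^sup>\<dagger> * (Q * R z + N z * (A\<^sup>\<dagger> * Q)))"
      by (simp only: key)
    also have "\<dots> = E z + H z"
      by (simp add: E_def H_def mat_expand) (auto intro!: eq_matI simp: distrib_left simp del: index_mult_mat(1))
    finally have sum: "sharp G z * U * R z = E z + H z" .
    have "dim_row (E z) = p" "dim_col (E z) = n" "dim_row (H z) = p" "dim_col (H z) = n"
      by (simp_all add: E_def H_def)
    then show ?thesis unfolding F_def sum by (intro eq_matI) simp_all
  qed
  have Nhol: "mat_holomorphic_on N n n (ball 0 1)"
    unfolding N_def
  proof (rule mat_holomorphic_on_minv)
    show "det (1\<^sub>m n - z \<cdot>\<^sub>m A\<^sup>\<dagger>) \<noteq> 0" if "z \<in> ball 0 1" for z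
      using that by (intro contraction_det_nonzero[OF adjoint_carrier[OF A] contr]) simp_all
    show "mat_holomorphic_on (\<lambda>z. 1\<^sub>m n - z \<cdot>\<^sub>m A\<^sup>\<dagger>) n n (ball 0 1)"
      unfolding mat_holomorphic_on_def
    proof (intro conjI ballI allI impI)
      show "1\<^sub>m n - z \<cdot>\<^sub>m A\<^sup>\<dagger> \<in> carrier_mat n n" for z by (rule carrier_matI) simp_all
      fix i j assume "i < n" "j < n"
      then show "(\<lambda>z. (1\<^sub>m n - z \<cdot>\<^sub>m A\<^sup>\<dagger>) $$ (i, j)) holomorphic_on ball 0 1"
        by (simp del: index_one_mat(1)) (intro holomorphic_intros)
    qed
  qed
  have AQ: "A\<^sup>\<dagger> * Q \<in> carrier_mat n n" by (rule carrier_matI) simp_all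
  have Hhol: "mat_holomorphic_on H p n (ball 0 1)"
    unfolding H_def
    by (rule mat_holomorphic_on_smult[OF _ mat_holomorphic_on_mult[OF mat_holomorphic_on_const[OF adjoint_carrier[OF B]]
          mat_holomorphic_on_mult[OF Nhol mat_holomorphic_on_const[OF AQ]]]]) (intro holomorphic_intros)
  have Rcont: "mat_continuous_on R n n (S \<inter> cball 0 1 - {0})"
    by (rule mat_continuous_on_subset[OF mat_holomorphic_imp_continuous[OF Rhol]]) auto
  have sharp_cont: "mat_continuous_on (sharp G) p p (S \<inter> cball 0 1 - {0})"
    by (rule mat_continuous_on_subset[OF lossless_sharp_continuous[OF lossless]]) auto
  have GUR: "mat_continuous_on (\<lambda>z. sharp G z * U * R z) p n (S \<inter> cball 0 1 - {0})"
    by (rule mat_continuous_on_mult[OF mat_continuous_on_mult[OF sharp_cont mat_continuous_on_const[OF U]] Rcont])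
  have DU: "D\<^sup>\<dagger> * U \<in> carrier_mat p n" and BQ: "B\<^sup>\<dagger> * Q \<in> carrier_mat p n"
    by (rule carrier_matI; simp)+
  have DUR: "mat_continuous_on (\<lambda>z. D\<^sup>\<dagger> * U * R z) p n (S \<inter> cball 0 1 - {0})"
    by (rule mat_continuous_on_mult[OF mat_continuous_on_const[OF DU] Rcont])
  have BQR: "mat_continuous_on (\<lambda>z. (- z) \<cdot>\<^sub>m (B\<^sup>\<dagger> * Q * R z)) p n (S \<inter> cball 0 1 - {0})"
    by (rule mat_continuous_on_smult[OF _ mat_continuous_on_mult[OF mat_continuous_on_const[OF BQ] Rcont]])
      (intro continuous_intros)
  \<comment> \<open>Written as a difference, so that the rules for differences of continuous functions apply.\<close>
  have E2: "E z = D\<^sup>\<dagger> * U * R z - (- z) \<cdot>\<^sub>m (B\<^sup>\<dagger> * Q * R z)" if "z \<in> S" for z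
    using carrier_matD[OF Rc[OF that]] by (auto intro!: eq_matI simp: E_def smult_mult_dim simp del: index_mult_mat(1))
  have Fcont: "continuous_on (S \<inter> cball 0 1 - {0}) (\<lambda>z. F z $$ (i, j))" if ij: "i < p" "j < n" for i j
  proof (rule continuous_on_eq)
    show "continuous_on (S \<inter> cball 0 1 - {0})
      (\<lambda>z. (sharp G z * U * R z - (D\<^sup>\<dagger> * U * R z - (- z) \<cdot>\<^sub>m (B\<^sup>\<dagger> * Q * R z))) $$ (i, j))"
      using mat_continuous_on_minus[OF GUR mat_continuous_on_minus[OF DUR BQR]] ij
      unfolding mat_continuous_on_def by blast
    fix z assume "z \<in> S \<inter> cball 0 1 - {0}"
    then have "z \<in> S" by simp
    then show "(sharp G z * U * R z - (D\<^sup>\<dagger> * U * R z - (- z) \<cdot>\<^sub>m (B\<^sup>\<dagger> * Q * R z))) $$ (i, j) = F z $$ (i, j)"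
      by (simp only: F_def E2)
  qed
  have Fint: "has_circle_integral F (0\<^sub>m p n)"
    unfolding has_circle_integral_def
  proof (intro conjI allI impI)
    fix z :: complex assume z: "cmod z = 1"
    show "F z \<in> carrier_mat (dim_row (0\<^sub>m p n)) (dim_col (0\<^sub>m p n))"
      using carrier_matD[OF Rc[OF S1[OF z]]] carrier_matD[OF Sc] by (intro carrier_matI) (simp_all add: F_def E_def)
  next
    fix i j assume "i < dim_row (0\<^sub>m p n)" "j < dim_col (0\<^sub>m p n)"
    then have ij: "i < p" "j < n" by auto
    \<comment> \<open>In the disc \<open>F\<close> has removable singularities at \<open>0\<close> and at the eigenvalues of \<open>W\<close>; \<open>H\<close> fills them in.\<close>
    define f where "f z = (if z \<in> sphere 0 1 then F z $$ (i, j) else H z $$ (i, j))" for z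
    have Hij: "(\<lambda>z. H z $$ (i, j)) holomorphic_on ball 0 1" using Hhol ij by (simp add: mat_holomorphic_on_def)
    have un: "(S \<inter> cball 0 1 - {0}) \<union> ball 0 1 = cball 0 1" using S1 by force
    have "continuous_on ((S \<inter> cball 0 1 - {0}) \<union> ball 0 1) f"
      unfolding f_def
    proof (rule continuous_on_cases_local_open)
      show "openin (top_of_set (S \<inter> cball 0 1 - {0} \<union> ball 0 1)) (S \<inter> cball 0 1 - {0})"
        unfolding un openin_open using \<open>open S\<close> by (intro exI[of _ "S - {0}"]) (auto intro: open_delete)
      show "openin (top_of_set (S \<inter> cball 0 1 - {0} \<union> ball 0 1)) (ball 0 1)"
        unfolding un openin_open by (intro exI[of _ "ball 0 1"]) auto
      show "continuous_on (S \<inter> cball 0 1 - {0}) (\<lambda>z. F z $$ (i, j))" by (rule Fcont[OF ij])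
      show "continuous_on (ball 0 1) (\<lambda>z. H z $$ (i, j))" by (rule holomorphic_on_imp_continuous_on[OF Hij])
      show "F z $$ (i, j) = H z $$ (i, j)" if "z \<in> S \<inter> cball 0 1 - {0} \<and> z \<notin> sphere 0 1 \<or> z \<in> ball 0 1 \<and> z \<in> sphere 0 1" for z
        using that FH[of z] by auto
    qed
    then have "(f has_contour_integral 0) (circlepath 0 1)"
      unfolding un
    proof (intro Cauchy_theorem_disc[of "{}" 0 1])
      fix z :: complex assume "z \<in> ball 0 1 - {}"
      then have z: "z \<in> ball 0 1" by simp
      have "f holomorphic_on ball 0 1"
        by (rule holomorphic_transform[OF Hij]) (auto simp: f_def)
      then show "f field_differentiable at z"
        by (rule holomorphic_on_imp_differentiable_at[OF _ open_ball z])
    qed auto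
    then have "((\<lambda>z. F z $$ (i, j)) has_contour_integral 0) (circlepath 0 1)"
      by (rule has_contour_integral_eq) (simp add: f_def)
    then show "((\<lambda>z. F z $$ (i, j)) has_contour_integral 0\<^sub>m p n $$ (i, j)) (circlepath 0 1)"
      using ij by simp
  qed
  have R0: "has_circle_integral R ((2 * of_real pi * \<i>) \<cdot>\<^sub>m 1\<^sub>m n)"
    unfolding R_def[abs_def] by (rule resolvent_circle_integral[OF W stable])
  have R1: "has_circle_integral (\<lambda>z. z \<cdot>\<^sub>m R z) ((2 * of_real pi * \<i>) \<cdot>\<^sub>m W)"
  proof -
    have "has_circle_integral (\<lambda>z. 1\<^sub>m n) (0\<^sub>m n n)"
    proof -
      have "((\<lambda>z. 1\<^sub>m n $$ (i, j)) has_contour_integral 0) (circlepath 0 1)" for i j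
        by (rule Cauchy_theorem_disc[of "{}" 0 1]) auto
      then show ?thesis by (simp add: has_circle_integral_def del: index_one_mat)
    qed
    from has_circle_integral_add[OF this has_circle_integral_mult_left[OF R0, of W]]
    have "has_circle_integral (\<lambda>z. 1\<^sub>m n + W * R z) (0\<^sub>m n n + W * ((2 * of_real pi * \<i>) \<cdot>\<^sub>m 1\<^sub>m n))" by simp
    then have "has_circle_integral (\<lambda>z. z \<cdot>\<^sub>m R z) (0\<^sub>m n n + W * ((2 * of_real pi * \<i>) \<cdot>\<^sub>m 1\<^sub>m n))"
    proof (rule has_circle_integral_cong)
      fix z :: complex assume z: "cmod z = 1"
      show "1\<^sub>m n + W * R z = z \<cdot>\<^sub>m R z"
        by (rule resolvent_shift[OF W Rc[OF S1[OF z]] res[OF S1[OF z]], symmetric])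
    qed
    then show ?thesis by (simp add: mat_expand)
  qed
  have Eint: "has_circle_integral E ((2 * of_real pi * \<i>) \<cdot>\<^sub>m (D\<^sup>\<dagger> * U + B\<^sup>\<dagger> * Q * W))"
  proof -
    have "has_circle_integral E (D\<^sup>\<dagger> * U * ((2 * of_real pi * \<i>) \<cdot>\<^sub>m 1\<^sub>m n) + B\<^sup>\<dagger> * Q * ((2 * of_real pi * \<i>) \<cdot>\<^sub>m W))"
      unfolding E_def[abs_def]
      by (rule has_circle_integral_add[OF has_circle_integral_mult_left[OF R0, of "D\<^sup>\<dagger> * U"]
            has_circle_integral_mult_left[OF R1, of "B\<^sup>\<dagger> * Q"]]) simp_all
    moreover have "D\<^sup>\<dagger> * U * ((2 * of_real pi * \<i>) \<cdot>\<^sub>m 1\<^sub>m n) + B\<^sup>\<dagger> * Q * ((2 * of_real pi * \<i>) \<cdot>\<^sub>m W) =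
      (2 * of_real pi * \<i>) \<cdot>\<^sub>m (D\<^sup>\<dagger> * U + B\<^sup>\<dagger> * Q * W)"
      by (simp add: mat_expand) (auto intro!: eq_matI simp: ring_distribs simp del: index_mult_mat(1))
    ultimately show ?thesis by simp
  qed
  have "has_circle_integral (\<lambda>z. F z + E z) (0\<^sub>m p n + (2 * of_real pi * \<i>) \<cdot>\<^sub>m (D\<^sup>\<dagger> * U + B\<^sup>\<dagger> * Q * W))"
    by (rule has_circle_integral_add[OF Fint Eint]) simp_all
  then have "has_circle_integral (interp_integrand G U W) (0\<^sub>m p n + (2 * of_real pi * \<i>) \<cdot>\<^sub>m (D\<^sup>\<dagger> * U + B\<^sup>\<dagger> * Q * W))"
  proof (rule has_circle_integral_cong)
    fix z :: complex assume z: "cmod z = 1"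
    note [simp] = carrier_matD[OF Rc[OF S1[OF z]]] carrier_matD[OF Sc]
    have "interp_integrand G U W z = sharp G z * U * R z" by (simp add: interp_integrand_def R_def)
    then show "F z + E z = interp_integrand G U W z"
      unfolding F_def E_def by (auto intro!: eq_matI simp del: index_mult_mat(1))
  qed
  then show ?thesis by (simp add: zero_add_dim)
qed

section \<open>Factorization of the realization matrix\<close>

text \<open>The hypotheses on \<open>Q\<close> and \<open>V\<close> say that \<open>R*\<close> maps \<open>[U; Q W]\<close> to \<open>[V; Q]\<close>. Multiplied by \<open>Q^{-1}\<close> on the right and
inverted, this becomes \<open>R [Vt; I] = [Ut; Wt]\<close>, on which both the formula for \<open>K\<close> and the factorization rest.\<close>

lemma realization_matrix_factorization:
  fixes U W A B C D Q V :: "complex mat"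
  assumes U: "U \<in> carrier_mat p n" and W: "W \<in> carrier_mat n n"
    and iso: "U\<^sup>\<dagger> * U + W\<^sup>\<dagger> * W = 1\<^sub>m n" and detW: "det (1\<^sub>m n - W) \<noteq> 0"
    and A: "A \<in> carrier_mat n n" and B: "B \<in> carrier_mat n p" and C: "C \<in> carrier_mat p n" and D: "D \<in> carrier_mat p p"
    and R: "unitary_mat (four_block_mat D C B A)"
    and Qc: "Q \<in> carrier_mat n n" and Qeq: "Q = C\<^sup>\<dagger> * U + A\<^sup>\<dagger> * (Q * W)" and detQ: "det Q \<noteq> 0"
    and Veq: "V = D\<^sup>\<dagger> * U + B\<^sup>\<dagger> * (Q * W)"
  defines "Ut \<equiv> U * minv Q" and "Wt \<equiv> Q * W * minv Q" and "Vt \<equiv> V * minv Q"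
  defines "X \<equiv> 1\<^sub>m p - U * minv (1\<^sub>m n - W\<^sup>\<dagger>) * U\<^sup>\<dagger>"
    and "Y \<equiv> (1\<^sub>m n - W) * minv (1\<^sub>m n - W\<^sup>\<dagger>) * U\<^sup>\<dagger>"
  defines "K \<equiv> Ut\<^sup>\<dagger> * Ut + Wt\<^sup>\<dagger> * Wt" and "L \<equiv> Ut\<^sup>\<dagger> * X + Wt\<^sup>\<dagger> * Q * Y"
    and "Z \<equiv> X\<^sup>\<dagger> * X + Y\<^sup>\<dagger> * minv (Q\<^sup>\<dagger> * Q) * Y"
  defines "Uhat \<equiv> four_block_mat X Ut (Q * Y) Wt *
      four_block_mat (mat_sqrt Z) (0\<^sub>m p n) (- (minv K * L * mat_sqrt Z)) (mat_isqrt K)"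
    and "Vhat \<equiv> four_block_mat
      (mat_isqrt (1\<^sub>m p + Vt * Vt\<^sup>\<dagger>)) (Vt * mat_isqrt (1\<^sub>m n + Vt\<^sup>\<dagger> * Vt))
      (- (Vt\<^sup>\<dagger> * mat_isqrt (1\<^sub>m p + Vt * Vt\<^sup>\<dagger>))) (mat_isqrt (1\<^sub>m n + Vt\<^sup>\<dagger> * Vt))"
  shows "K = 1\<^sub>m n + Vt\<^sup>\<dagger> * Vt" "unitary_mat Uhat" "unitary_mat Vhat"
    "\<exists>G0 \<in> unitary_group p. four_block_mat D C B A =
      Uhat * four_block_mat G0 (0\<^sub>m p n) (0\<^sub>m n p) (1\<^sub>m n) * Vhat\<^sup>\<dagger>"
proof -
  note Qi = minv_works[OF Qc detQ]
  define J where "J = minv Q"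
  note J = Qi[folded J_def]
  note [simp] = carrier_matD[OF U] carrier_matD[OF W] carrier_matD[OF A] carrier_matD[OF B]
    carrier_matD[OF C] carrier_matD[OF D] carrier_matD[OF Qc] carrier_matD[OF J(1)]
  have Ut: "Ut = U * J" and Wt: "Wt = Q * (W * J)" and Vt: "Vt = V * J"
    by (simp_all add: Ut_def Wt_def Vt_def J_def[symmetric] mult_assoc_dim)
  have Vdim: "dim_row V = p" "dim_col V = n" by (simp_all add: Veq)
  have Utc: "Ut \<in> carrier_mat p n" and Wtc: "Wt \<in> carrier_mat n n" and Vtc: "Vt \<in> carrier_mat p n"
    by (rule carrier_matI; simp add: Ut Wt Vt Vdim)+
  note xy = isometry_completion[OF U W iso detW, folded X_def Y_def]
  note [simp] = carrier_matD[OF Utc] carrier_matD[OF Wtc] carrier_matD[OF Vtc] carrier_matD[OF xy(4)] carrier_matD[OF xy(5)]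
  have JQ: "J\<^sup>\<dagger> * Q\<^sup>\<dagger> = 1\<^sub>m n" and QJ: "Q\<^sup>\<dagger> * J\<^sup>\<dagger> = 1\<^sub>m n"
    using arg_cong[OF J(2), of mat_adjoint] arg_cong[OF J(3), of mat_adjoint] by (simp_all add: adjoint_mult)

  have VtR: "Vt = D\<^sup>\<dagger> * Ut + B\<^sup>\<dagger> * Wt"
    by (simp add: Vt Veq Ut Wt mat_expand)
  have oneR: "1\<^sub>m n = C\<^sup>\<dagger> * Ut + A\<^sup>\<dagger> * Wt"
  proof -
    have "Q * J = C\<^sup>\<dagger> * Ut + A\<^sup>\<dagger> * Wt"
      by (subst Qeq) (simp add: Ut Wt mat_expand)
    then show ?thesis using J by simp
  qed
  note Rdag = unitary_block_adjoint[OF D C B A R]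
  note apply_R = block_apply_adjoint[OF adjoint_carrier[OF D] adjoint_carrier[OF B] adjoint_carrier[OF C]
      adjoint_carrier[OF A] Rdag Utc Wtc]
  have UtR: "D * Vt + C * 1\<^sub>m n = Ut" and WtR: "B * Vt + A * 1\<^sub>m n = Wt"
    using apply_R by (simp_all only: adjoint_adjoint VtR[symmetric] oneR[symmetric])
  show K_eq: "K = 1\<^sub>m n + Vt\<^sup>\<dagger> * Vt"
  proof -
    have "K = Vt\<^sup>\<dagger> * Vt + (1\<^sub>m n)\<^sup>\<dagger> * 1\<^sub>m n"
      unfolding K_def using unitary_block_isometry[OF D C B A R Vtc one_carrier_mat] by (simp only: UtR WtR)
    also have "\<dots> = 1\<^sub>m n + Vt\<^sup>\<dagger> * Vt" by (simp add: one_mult_dim) (auto intro!: eq_matI simp del: index_mult_mat(1))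
    finally show ?thesis .
  qed
  have K: "K \<in> carrier_mat n n" "pos_def K"
    unfolding K_eq by (rule pos_def_one_plus_gram[OF Vtc])+
  show Vhat: "unitary_mat Vhat" unfolding Vhat_def by (rule halmos_unitary[OF Vtc])

  have "minv (Q\<^sup>\<dagger> * Q) = J * J\<^sup>\<dagger>"
  proof (rule minv_eq)
    show "Q\<^sup>\<dagger> * Q \<in> carrier_mat n n" "J * J\<^sup>\<dagger> \<in> carrier_mat n n" by (rule carrier_matI; simp)+
    show "Q\<^sup>\<dagger> * Q * (J * J\<^sup>\<dagger>) = 1\<^sub>m n"
      by (simp add: mult_assoc_dim left_cancel_dim[OF J(2)] QJ)
  qed
  then have Z_eq: "Z = X\<^sup>\<dagger> * (X\<^sup>\<dagger>)\<^sup>\<dagger> + (Y\<^sup>\<dagger> * J) * (Y\<^sup>\<dagger> * J)\<^sup>\<dagger>"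
    by (simp add: Z_def mat_expand)
  have L_eq: "L = Ut\<^sup>\<dagger> * X + Wt\<^sup>\<dagger> * (Q * Y)"
    by (simp add: L_def mult_assoc_dim)
  have Z: "Z \<in> carrier_mat p p" "pos_def Z"
  proof -
    have JY: "J\<^sup>\<dagger> * Y \<in> carrier_mat n p" and YQ: "Y\<^sup>\<dagger> * Q\<^sup>\<dagger> \<in> carrier_mat p n"
      by (rule carrier_matI; simp)+
    have "X\<^sup>\<dagger> * X + (Y\<^sup>\<dagger> * Q\<^sup>\<dagger>) * (J\<^sup>\<dagger> * Y) = 1\<^sub>m p"
      by (simp add: mult_assoc_dim left_cancel_dim[OF QJ] xy)
    from pos_def_gram_sum[OF xy(4) JY adjoint_carrier[OF xy(4)] YQ this]
    show "pos_def Z" by (simp add: Z_eq mat_expand)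
    show "Z \<in> carrier_mat p p" by (rule carrier_matI) (simp_all add: Z_eq)
  qed
  have QY: "Q * Y \<in> carrier_mat n p" and YJ: "Y\<^sup>\<dagger> * J \<in> carrier_mat p n"
    and QU: "Q * U\<^sup>\<dagger> \<in> carrier_mat n p" and QW: "Q * (W\<^sup>\<dagger> * J) \<in> carrier_mat n n"
    by (rule carrier_matI; simp)+
  \<comment> \<open>The inverse of \<open>diag(I, Q) [X, U; Y, W] diag(I, Q^{-1})\<close>, obtained from the adjoint of the unitary middle factor.\<close>
  have inv: "X\<^sup>\<dagger> * X + Y\<^sup>\<dagger> * J * (Q * Y) = 1\<^sub>m p" "X\<^sup>\<dagger> * Ut + Y\<^sup>\<dagger> * J * Wt = 0\<^sub>m p n"
    "Q * U\<^sup>\<dagger> * X + Q * (W\<^sup>\<dagger> * J) * (Q * Y) = 0\<^sub>m n p" "Q * U\<^sup>\<dagger> * Ut + Q * (W\<^sup>\<dagger> * J) * Wt = 1\<^sub>m n"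
  proof -
    show "X\<^sup>\<dagger> * X + Y\<^sup>\<dagger> * J * (Q * Y) = 1\<^sub>m p"
      by (simp add: mult_assoc_dim left_cancel_dim[OF J(3)] xy)
    have "X\<^sup>\<dagger> * Ut + Y\<^sup>\<dagger> * J * Wt = (X\<^sup>\<dagger> * U + Y\<^sup>\<dagger> * W) * J"
      by (simp add: Ut Wt mat_expand left_cancel_dim[OF J(3)])
    then show "X\<^sup>\<dagger> * Ut + Y\<^sup>\<dagger> * J * Wt = 0\<^sub>m p n" by (simp add: xy zero_mult_dim)
    have "Q * U\<^sup>\<dagger> * X + Q * (W\<^sup>\<dagger> * J) * (Q * Y) = Q * (U\<^sup>\<dagger> * X + W\<^sup>\<dagger> * Y)"
      by (simp add: mat_expand left_cancel_dim[OF J(3)])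
    then show "Q * U\<^sup>\<dagger> * X + Q * (W\<^sup>\<dagger> * J) * (Q * Y) = 0\<^sub>m n p" by (simp add: xy zero_mult_dim)
    have "Q * U\<^sup>\<dagger> * Ut + Q * (W\<^sup>\<dagger> * J) * Wt = Q * ((U\<^sup>\<dagger> * U + W\<^sup>\<dagger> * W) * J)"
      by (simp add: Ut Wt mat_expand left_cancel_dim[OF J(3)])
    then show "Q * U\<^sup>\<dagger> * Ut + Q * (W\<^sup>\<dagger> * J) * Wt = 1\<^sub>m n" by (simp add: iso one_mult_dim J(2))
  qed
  show Uhat: "unitary_mat Uhat"
    using unitary_from_invertible[OF xy(4) Utc QY Wtc adjoint_carrier[OF xy(4)] YJ QU QW inv]
    unfolding Uhat_def by (simp only: K_def L_eq Z_eq)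

  define k where "k = mat_isqrt K"
  define m where "m = mat_isqrt (1\<^sub>m p + Vt * Vt\<^sup>\<dagger>)"
  define s where "s = mat_sqrt Z"
  have "m \<in> carrier_mat p p"
    using mat_isqrt_works(1)[OF pos_def_one_plus_gram[OF adjoint_carrier[OF Vtc]]] by (simp only: m_def adjoint_adjoint)
  then have [simp]: "dim_row m = p" "dim_col m = p" by auto
  have [simp]: "dim_row k = n" "dim_col k = n" "dim_row s = p" "dim_col s = p"
    "dim_row (minv K) = n" "dim_col (minv K) = n" "dim_row L = n" "dim_col L = p"
    using carrier_matD[OF mat_isqrt_works(1)[OF K]] carrier_matD[OF mat_sqrt_works(1)[OF Z]]
      carrier_matD[OF minv_works(1)[OF K(1) pos_def_det[OF K]]]
    by (simp_all add: k_def s_def L_eq)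
  define H1 where "H1 = X * s + Ut * - (minv K * L * s)"
  define H3 where "H3 = Q * Y * s + Wt * - (minv K * L * s)"
  have Uhat_eq: "Uhat = four_block_mat H1 (Ut * k) H3 (Wt * k)"
    unfolding Uhat_def k_def[symmetric] s_def[symmetric] H1_def H3_def
    by (simp add: four_block_mult_dim zero_mult_dim zero_add_dim)
  have Vhat_eq: "Vhat = four_block_mat m (Vt * k) (- (Vt\<^sup>\<dagger> * m)) k"
    unfolding Vhat_def k_def m_def K_eq ..
  have RV: "four_block_mat D C B A * Vhat =
    four_block_mat (D * m + C * - (Vt\<^sup>\<dagger> * m)) (Ut * k) (B * m + A * - (Vt\<^sup>\<dagger> * m)) (Wt * k)"
  proof -
    have "D * (Vt * k) + C * k = Ut * k" "B * (Vt * k) + A * k = Wt * k"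
      unfolding UtR[symmetric] WtR[symmetric] by (simp_all add: mat_expand)
    then show ?thesis by (simp add: Vhat_eq four_block_mult_dim)
  qed
  show "\<exists>G0 \<in> unitary_group p. four_block_mat D C B A =
      Uhat * four_block_mat G0 (0\<^sub>m p n) (0\<^sub>m n p) (1\<^sub>m n) * Vhat\<^sup>\<dagger>"
    unfolding Uhat_eq
    by (rule unitary_block_factorization[OF _ R _ Vhat _ _ _ _ _ _ Uhat[unfolded Uhat_eq] RV];
        rule carrier_matI; simp add: H1_def H3_def Vhat_eq)
qed

theorem proposition4:
  fixes n p :: nat
    and U W A B C D :: "complex mat"
    and G :: "complex \<Rightarrow> complex mat"
  assumes "output_normal_pair p n U W"
    and "G \<in> lossless_deg p n"
    and "balanced_realization p n A B C D G"
  shows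
    "(\<exists>!Q. stein_solution n (A\<^sup>\<dagger>) W (C\<^sup>\<dagger> * U) Q) \<and>
     (\<forall>i<p. \<forall>j<n. (\<lambda>z. interp_integrand G U W z $$ (i, j)) contour_integrable_on circlepath 0 1) \<and>
     (\<forall>Q V. stein_solution n (A\<^sup>\<dagger>) W (C\<^sup>\<dagger> * U) Q \<and> V = interp_value G U W \<longrightarrow>
        V = D\<^sup>\<dagger> * U + B\<^sup>\<dagger> * Q * W \<and>
        (\<exists>!P. stein_solution n (W\<^sup>\<dagger>) W (U\<^sup>\<dagger> * U - V\<^sup>\<dagger> * V) P) \<and>
        (\<forall>P. stein_solution n (W\<^sup>\<dagger>) W (U\<^sup>\<dagger> * U - V\<^sup>\<dagger> * V) P \<longrightarrow>
           P = Q\<^sup>\<dagger> * Q \<and>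
           (pos_def P \<longrightarrow> invertible_mat Q \<and>
             (let
                T = Q;
                Ut = U * minv T;
                Wt = T * W * minv T;
                Vt = V * minv T;
                X = 1\<^sub>m p - U * minv (1\<^sub>m n - W\<^sup>\<dagger>) * U\<^sup>\<dagger>;
                Y = (1\<^sub>m n - W) * minv (1\<^sub>m n - W\<^sup>\<dagger>) * U\<^sup>\<dagger>;
                K = Ut\<^sup>\<dagger> * Ut + Wt\<^sup>\<dagger> * Wt;
                L = Ut\<^sup>\<dagger> * X + Wt\<^sup>\<dagger> * T * Y;
                Z = X\<^sup>\<dagger> * X + Y\<^sup>\<dagger> * minv P * Y;
                Uhat = four_block_mat X Ut (T * Y) Wt *
                       four_block_mat (mat_sqrt Z) (0\<^sub>m p n)
                                      (- (minv K * L * mat_sqrt Z)) (mat_isqrt K);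
                Vhat = four_block_mat
                         (mat_isqrt (1\<^sub>m p + Vt * Vt\<^sup>\<dagger>)) (Vt * mat_isqrt (1\<^sub>m n + Vt\<^sup>\<dagger> * Vt))
                         (- (Vt\<^sup>\<dagger> * mat_isqrt (1\<^sub>m p + Vt * Vt\<^sup>\<dagger>))) (mat_isqrt (1\<^sub>m n + Vt\<^sup>\<dagger> * Vt))
              in K = 1\<^sub>m n + Vt\<^sup>\<dagger> * Vt \<and>
                 unitary_mat Uhat \<and> unitary_mat Vhat \<and>
                 (\<exists>G0 \<in> unitary_group p.
                    realization_matrix A B C D =
                      Uhat * four_block_mat G0 (0\<^sub>m p n) (0\<^sub>m n p) (1\<^sub>m n) * Vhat\<^sup>\<dagger>)))))"
proof -
  note onp = assms(1)[unfolded output_normal_pair_def]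
  have U: "U \<in> carrier_mat p n" and W: "W \<in> carrier_mat n n" and stable: "stable W"
    and iso: "U\<^sup>\<dagger> * U + W\<^sup>\<dagger> * W = 1\<^sub>m n"
    using onp by auto
  have lossless: "lossless p G" using assms(2) by (simp add: lossless_deg_def)
  have real: "realization p n A B C D G" and R: "unitary_mat (four_block_mat D C B A)"
    using assms(3) by (auto simp: balanced_realization_def minimal_realization_def realization_matrix_def)
  have A: "A \<in> carrier_mat n n" and B: "B \<in> carrier_mat n p" and C: "C \<in> carrier_mat p n" and D: "D \<in> carrier_mat p p"
    using real by (auto simp: realization_def)
  note Rdag = unitary_block_adjoint[OF D C B A R]
  have "B * B\<^sup>\<dagger> + A * A\<^sup>\<dagger> = 1\<^sub>m n"
    using Rdag[unfolded unitary_four_block_iff[OF adjoint_carrier[OF D] adjoint_carrier[OF B] adjoint_carrier[OF C] adjoint_carrier[OF A]]]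
    by (simp only: adjoint_adjoint)
  then have contr: "Re ((A\<^sup>\<dagger> *\<^sub>v v) \<bullet>c (A\<^sup>\<dagger> *\<^sub>v v)) \<le> Re (v \<bullet>c v)" if "v \<in> carrier_vec n" for v
    using adjoint_contraction[OF A B _ that] by simp
  obtain c r where r: "0 < r" "r < 1" and c: "0 \<le> c"
    and Wpow: "\<And>k i j. i < n \<Longrightarrow> j < n \<Longrightarrow> cmod ((W ^\<^sub>m k) $$ (i, j)) \<le> c * r ^ k"
    using stable_powers_geometric[OF W stable] by metis
  have W'pow: "cmod (((W\<^sup>\<dagger>) ^\<^sub>m k) $$ (i, j)) \<le> c" if ij: "i < n" "j < n" for k i j
  proof -
    have "cmod (((W\<^sup>\<dagger>) ^\<^sub>m k) $$ (i, j)) = cmod ((W ^\<^sub>m k) $$ (j, i))"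
      unfolding pow_mat_adjoint[OF W] using ij carrier_matD[OF pow_carrier_mat[OF W, of k]] by (simp del: pow_mat_dim)
    also have "\<dots> \<le> c * r ^ k" by (rule Wpow[OF ij(2,1)])
    also have "\<dots> \<le> c * 1" using c r by (intro mult_left_mono power_le_one) auto
    finally show ?thesis by simp
  qed
  have exQ: "\<exists>!Q. stein_solution n (A\<^sup>\<dagger>) W (C\<^sup>\<dagger> * U) Q"
    by (rule stein_solution_ex1[OF adjoint_carrier[OF A] W mult_carrier_mat[OF adjoint_carrier[OF C] U]
          contraction_power_entries[OF adjoint_carrier[OF A] contr] Wpow r])
  have integral: "has_circle_integral (interp_integrand G U W) ((2 * of_real pi * \<i>) \<cdot>\<^sub>m (D\<^sup>\<dagger> * U + B\<^sup>\<dagger> * Q * W))"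
    if "stein_solution n (A\<^sup>\<dagger>) W (C\<^sup>\<dagger> * U) Q" for Q
    by (rule interpolation_integral[OF lossless real contr U W stable that])
  have integrable: "(\<lambda>z. interp_integrand G U W z $$ (i, j)) contour_integrable_on circlepath 0 1" if "i < p" "j < n" for i j
  proof -
    obtain Q where "stein_solution n (A\<^sup>\<dagger>) W (C\<^sup>\<dagger> * U) Q" using exQ by auto
    from integral[OF this] that carrier_matD[OF B] carrier_matD[OF W] show ?thesis
      by (auto simp: has_circle_integral_def contour_integrable_on_def)
  qed
  have detW: "det (1\<^sub>m n - W) \<noteq> 0"
  proof -
    have "\<not> eigenvalue W 1" using stable by (auto simp: stable_def)
    then have "det (1 \<cdot>\<^sub>m 1\<^sub>m n - W) \<noteq> 0" by (rule det_resolvent_nonzero[OF W])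
    moreover have "(1 :: complex) \<cdot>\<^sub>m 1\<^sub>m n = 1\<^sub>m n" by (rule eq_matI) auto
    ultimately show ?thesis by metis
  qed
  have main: "V = D\<^sup>\<dagger> * U + B\<^sup>\<dagger> * Q * W"
    "stein_solution n (W\<^sup>\<dagger>) W (U\<^sup>\<dagger> * U - V\<^sup>\<dagger> * V) (Q\<^sup>\<dagger> * Q)"
    "\<exists>!P. stein_solution n (W\<^sup>\<dagger>) W (U\<^sup>\<dagger> * U - V\<^sup>\<dagger> * V) P"
    if Q: "stein_solution n (A\<^sup>\<dagger>) W (C\<^sup>\<dagger> * U) Q" and V: "V = interp_value G U W" for Q V
  proof -
    have Qc: "Q \<in> carrier_mat n n" using Q by (simp add: stein_solution_def)
    note [simp] = carrier_matD[OF U] carrier_matD[OF W] carrier_matD[OF A] carrier_matD[OF B]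
      carrier_matD[OF C] carrier_matD[OF D] carrier_matD[OF Qc]
    show V_eq: "V = D\<^sup>\<dagger> * U + B\<^sup>\<dagger> * Q * W"
    proof (rule eq_matI)
      fix i j assume "i < dim_row (D\<^sup>\<dagger> * U + B\<^sup>\<dagger> * Q * W)" "j < dim_col (D\<^sup>\<dagger> * U + B\<^sup>\<dagger> * Q * W)"
      then have ij: "i < p" "j < n" by auto
      then have "((\<lambda>z. interp_integrand G U W z $$ (i, j)) has_contour_integral
          ((2 * of_real pi * \<i>) \<cdot>\<^sub>m (D\<^sup>\<dagger> * U + B\<^sup>\<dagger> * Q * W)) $$ (i, j)) (circlepath 0 1)"
        using integral[OF Q] by (simp add: has_circle_integral_def del: index_smult_mat(1))
      from contour_integral_unique[OF this] ij
      show "V $$ (i, j) = (D\<^sup>\<dagger> * U + B\<^sup>\<dagger> * Q * W) $$ (i, j)"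
        by (simp add: V interp_value_def del: index_mult_mat(1) index_add_mat(1))
    qed (simp_all add: V interp_value_def)
    then have V': "V = D\<^sup>\<dagger> * U + B\<^sup>\<dagger> * (Q * W)" by (simp add: mult_assoc_dim)
    have [simp]: "dim_row V = p" "dim_col V = n" by (simp_all add: V')
    note Q' = stein_solution_rearranged[OF Q adjoint_carrier[OF A] W]
    have QW: "Q * W \<in> carrier_mat n n" by (rule carrier_matI) simp_all
    have sum: "V\<^sup>\<dagger> * V + Q\<^sup>\<dagger> * Q = U\<^sup>\<dagger> * U + (Q * W)\<^sup>\<dagger> * (Q * W)"
      using unitary_block_isometry[OF adjoint_carrier[OF D] adjoint_carrier[OF B] adjoint_carrier[OF C]
          adjoint_carrier[OF A] Rdag U QW]
      by (simp only: V'[symmetric] Q'[symmetric])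
    show "stein_solution n (W\<^sup>\<dagger>) W (U\<^sup>\<dagger> * U - V\<^sup>\<dagger> * V) (Q\<^sup>\<dagger> * Q)"
      unfolding stein_solution_def
    proof
      show "Q\<^sup>\<dagger> * Q \<in> carrier_mat n n" by (rule carrier_matI) simp_all
      have "W\<^sup>\<dagger> * (Q\<^sup>\<dagger> * Q) * W = (Q * W)\<^sup>\<dagger> * (Q * W)" by (simp add: mat_expand)
      moreover have "Q\<^sup>\<dagger> * Q - (Q * W)\<^sup>\<dagger> * (Q * W) = U\<^sup>\<dagger> * U - V\<^sup>\<dagger> * V"
      proof (rule eq_matI)
        fix i j assume "i < dim_row (U\<^sup>\<dagger> * U - V\<^sup>\<dagger> * V)" "j < dim_col (U\<^sup>\<dagger> * U - V\<^sup>\<dagger> * V)"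
        then have ij: "i < n" "j < n" by auto
        have e: "(V\<^sup>\<dagger> * V) $$ (i, j) + (Q\<^sup>\<dagger> * Q) $$ (i, j) = (U\<^sup>\<dagger> * U) $$ (i, j) + ((Q * W)\<^sup>\<dagger> * (Q * W)) $$ (i, j)"
          using arg_cong[OF sum, of "\<lambda>M. M $$ (i, j)"] ij by (simp del: index_mult_mat(1))
        have move: "q - w = u - v" if "v + q = u + w" for q u v w :: complex
        proof -
          have "q - w = (v + q) - v - w" by simp
          also have "\<dots> = u - v" unfolding that by simp
          finally show ?thesis .
        qed
        from move[OF e] have "(Q\<^sup>\<dagger> * Q) $$ (i, j) - ((Q * W)\<^sup>\<dagger> * (Q * W)) $$ (i, j) = (U\<^sup>\<dagger> * U) $$ (i, j) - (V\<^sup>\<dagger> * V) $$ (i, j)" .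
        then show "(Q\<^sup>\<dagger> * Q - (Q * W)\<^sup>\<dagger> * (Q * W)) $$ (i, j) = (U\<^sup>\<dagger> * U - V\<^sup>\<dagger> * V) $$ (i, j)"
          using ij by (simp del: index_mult_mat(1))
      qed simp_all
      ultimately show "Q\<^sup>\<dagger> * Q - W\<^sup>\<dagger> * (Q\<^sup>\<dagger> * Q) * W = U\<^sup>\<dagger> * U - V\<^sup>\<dagger> * V" by simp
    qed
    have "U\<^sup>\<dagger> * U - V\<^sup>\<dagger> * V \<in> carrier_mat n n" by (rule carrier_matI) simp_all
    then show "\<exists>!P. stein_solution n (W\<^sup>\<dagger>) W (U\<^sup>\<dagger> * U - V\<^sup>\<dagger> * V) P"
      by (rule stein_solution_ex1[OF adjoint_carrier[OF W] W _ W'pow Wpow r])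
  qed
  show ?thesis
  proof (intro conjI allI impI, goal_cases)
    case 1
    show ?case by (rule exQ)
  next
    case (2 i j)
    then show ?case by (rule integrable)
  next
    case (3 Q V)
    then show ?case using main(1) by simp
  next
    case (4 Q V)
    show ?case by (rule main(3)[OF conjunct1[OF 4] conjunct2[OF 4]])
  next
    case (5 Q V P)
    then show ?case using main(2,3) by metis
  next
    case (6 Q V P)
    then have Qc: "Q \<in> carrier_mat n n" by (simp add: stein_solution_def)
    have "P = Q\<^sup>\<dagger> * Q" using 6(1,2) main(2,3) by metis
    then show ?case using 6(3) det_factor_nonzero[OF Qc] invertible_mat_iff_det[OF Qc] by simp
  next
    case (7 Q V P)
    then have Q: "stein_solution n (A\<^sup>\<dagger>) W (C\<^sup>\<dagger> * U) Q" and V: "V = interp_value G U W" by auto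
    then have Qc: "Q \<in> carrier_mat n n" by (simp add: stein_solution_def)
    have P: "P = Q\<^sup>\<dagger> * Q" using 7(1,2) main(2,3) by metis
    then have detQ: "det Q \<noteq> 0" using 7(3) det_factor_nonzero[OF Qc] by simp
    have Veq: "V = D\<^sup>\<dagger> * U + B\<^sup>\<dagger> * (Q * W)"
      using main(1)[OF Q V] carrier_matD[OF B] carrier_matD[OF Qc] carrier_matD[OF W]
      by (simp add: mult_assoc_dim)
    note Qeq = stein_solution_rearranged[OF Q adjoint_carrier[OF A] W]
    show ?case
      unfolding Let_def realization_matrix_def P
      by (intro conjI realization_matrix_factorization[OF U W iso detW A B C D R Qc Qeq detQ Veq])
  qed
qed

end
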